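(* Set $w:=W(2n/\pi)$. For each integer $K\ge1$, as $n\to\infty$, $$\xi^{(2n)}(1/2)=4\pi^2e^{7w/4}\sqrt{\frac{2w}{w+1}}\left(\frac{w}{2e^{1/w}}\right)^{2n}\left(1+\sum_{k=1}^{K-1}\frac{\mu_k(w)}{n^k}+O\!\left(\frac{\log^K(n)}{n^K}\right)\right),$$ with an implied constant depending only on $K$. Each $\mu_k(w)$ is a rational function of $w$ (defined below) of size $O(\log^k(n))$.
   Context: $\xi(s):=\tfrac12 s(s-1)\pi^{-s/2}\Gamma(s/2)\zeta(s)$. $W$ is the Lambert function, inverse of $x\mapsto xe^x$ on $[0,\infty)$. Partial ordinary Bell polynomials $\hat B_{i,j}$ are defined by $(p_1x+p_2x^2+\cdots)^j=\sum_{i\ge j}\hat B_{i,j}(p_1,p_2,\dots)x^i$. For $u>0$ let $\ell_i(u):=\sum_{j=1}^i \hat B_{i,j}(1,-\tfrac12,\tfrac13,-\tfrac14,\dots)\frac{(-1)^{j+1}}{j\,u^j}$. For real $\beta$ and integer $r\ge0$, $$a^{(\beta)}_r(v):=\sum_{j=0}^{2r}\frac{(2j+2r-1)!!}{j!}\left(\frac{v^2}{v+1}\right)^{j+r}\sum_{i=j}^{2r}\hat B_{i,j}(\ell_3(v),\ell_4(v),\dots)\binom{\beta}{2r-i},$$ with $(-1)!!=1$ and $a^{(\beta)}_{-1}:=0$; and $\mu_r(w):=2^{-r-1}\big(2a^{(5/4)}_r(w)-3w\,a^{(1/4)}_{r-1}(w)\big)$. *)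

theory Defs
  imports
    "HOL-Complex_Analysis.Complex_Analysis"
    "HOL-Library.Landau_Symbols"
begin

(* The analytic continuation of the Dirichlet series to the complement of 1; by the identity
   theorem it is unique once a value at the pole is fixed.  The value 0 there is a convention. *)
definition riemann_zeta :: "complex \<Rightarrow> complex" where
  "riemann_zeta = (THE f. f holomorphic_on (- {1}) \<and>
     (\<forall>s. Re s > 1 \<longrightarrow> (\<lambda>n. 1 / of_nat (Suc n) powr s) sums f s) \<and> f 1 = 0)"

(* At the removable singularities 0, 1, -2, -4, ... of the formula the value is an artefact of
   the conventions for Gamma and riemann_zeta at their poles.  The formula agrees with the entire
   function xi everywhere else, in particular near 1/2. *)
definition riemann_xi :: "complex \<Rightarrow> complex" where
  "riemann_xi s = 1 / 2 * s * (s - 1) * of_real pi powr (- s / 2) * Gamma (s / 2) * riemann_zeta s"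

definition lambert_W :: "real \<Rightarrow> real" where
  "lambert_W = the_inv_into {0..} (\<lambda>x. x * exp x)"

(* Partial ordinary Bell polynomials.  The sequence p is indexed from 1; p 0 is ignored. *)
definition ord_bell :: "nat \<Rightarrow> nat \<Rightarrow> (nat \<Rightarrow> real) \<Rightarrow> real" where
  "ord_bell i j p = fps_nth (Abs_fps (\<lambda>k. if k = 0 then 0 else p k) ^ j) i"

definition ell :: "nat \<Rightarrow> real \<Rightarrow> real" where
  "ell i u = (\<Sum>j=1..i. ord_bell i j (\<lambda>k. (-1) ^ (k + 1) / real k) *
                ((-1) ^ (j + 1) / (real j * u ^ j)))"

fun double_fact :: "nat \<Rightarrow> nat" where
  "double_fact 0 = 1"
| "double_fact (Suc 0) = 1"
| "double_fact (Suc (Suc n)) = Suc (Suc n) * double_fact n"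

(* For j = r = 0 the truncated 2 * j + 2 * r - 1 is 0, and double_fact 0 = 1 is the required
   value of (-1)!!. *)
definition a_coeff :: "real \<Rightarrow> nat \<Rightarrow> real \<Rightarrow> real" where
  "a_coeff \<beta> r v = (\<Sum>j=0..2*r.
     real (double_fact (2 * j + 2 * r - 1)) / fact j * (v\<^sup>2 / (v + 1)) ^ (j + r) *
     (\<Sum>i=j..2*r. ord_bell i j (\<lambda>k. ell (k + 2) v) * (\<beta> gchoose (2 * r - i))))"

(* The case distinction is the convention that the coefficient with index -1 vanishes. *)
definition mu :: "nat \<Rightarrow> real \<Rightarrow> real" where
  "mu r w = 1 / 2 ^ (r + 1) *
     (2 * a_coeff (5 / 4) r w - 3 * w * (if r = 0 then 0 else a_coeff (1 / 4) (r - 1) w))"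

end

theory Submission
  imports Defs "HOL-Probability.Distributions" "HOL-Real_Asymp.Real_Asymp"
begin

text \<open>
  Polya's finite identity between powers of cosines and binomial coefficients tends to the functional
  equation of the theta function.  Applying a second-order differential operator that annihilates the
  constant term and the pole terms gives a kernel omega with omega(1/x) = sqrt x omega(x), whose Mellin
  transform is entire and equals xi; hence the even derivatives of xi at 1/2 are integrals of
  even powers of ln x against a rapidly decaying weight.

  In the integral of (ln x) ^ (2 n) x ^ b exp (- pi x) the saddle point is x = exp w, where
  pi w exp w = 2 n.  After x = exp w (1 + t) the exponent is L (w ln (1 + ln (1 + t) / w) - t) with
  L = pi exp w = 2 n / w, and it is analytic in t uniformly for w \<ge> 1.  It is split as a Gaussian
  with exponent of order L t^2 times a function G(L t^2, t); expanding G in its second argument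
  only, with the first one as a parameter, and integrating against Gaussian moments gives the
  coefficients a_r, and the remainder is of relative order L powr - K = (w / (2 n)) ^ K.
\<close>

section \<open>Polya's identity and the theta series\<close>

text \<open>The description behind \<open>riemann_zeta\<close> has a value only once a continuation
  exists, so the Mellin transform of \<open>omega\<close> does double duty: entire by its power
  series about 1/2, it supplies the continuation and evaluates the derivatives. The obstacle in the
  asymptotics is uniformity. Since w grows with n, no constant may depend on w; hence the analytic
  estimates are made for all \<open>w \<ge> 1\<close> on discs of fixed radius, where the factor w
  outside the outer logarithm cancels the 1 / w inside it. Also L is unbounded, so the Taylor
  coefficients in t of the whole integrand grow with powers of L; freezing s = L t^2 leaves
  coefficients that are at most a constant times exp (s / 4). The first theta term contributes x^2
  and x against the weight x powr (- 3 / 4), whence the exponents 5 / 4 and 1 / 4. The second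
  integral carries the relative factor 3 / (2 L) = 3 w / (4 n), the origin of the term - 3 w and of
  the shifted index in \<open>mu\<close>.\<close>

lemma power_le_fact_mult_exp:
  fixes y :: real assumes "y \<ge> 0" shows "y ^ k \<le> fact k * exp y"
proof -
  have "(\<lambda>n. y ^ n /\<^sub>R fact n) sums exp y" by (rule exp_converges)
  moreover have "\<And>n. 0 \<le> y ^ n /\<^sub>R fact n" using assms by simp
  ultimately have "sum (\<lambda>n. y ^ n /\<^sub>R fact n) {k} \<le> exp y"
    using sum_le_suminf [of "\<lambda>n. y ^ n /\<^sub>R fact n" "{k}"] by (auto simp: sums_iff)
  hence "y ^ k / fact k \<le> exp y" by (simp add: divide_inverse mult.commute)
  thus ?thesis by (simp only: divide_le_eq fact_gt_zero) (simp only: mult.commute)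
qed

text \<open>Half of the exponential pays for the power. This absorbs polynomial factors, both in x
  and later in L, throughout the proof.\<close>

lemma power_mult_exp_le:
  fixes y a :: real assumes "y \<ge> 0" "a > 0"
  shows "y ^ k * exp (- a * y) \<le> fact k * (2 / a) ^ k * exp (- (a / 2) * y)"
proof -
  have "(a / 2) ^ k * y ^ k \<le> fact k * exp (a / 2 * y)"
    unfolding power_mult_distrib [symmetric]
    by (rule power_le_fact_mult_exp) (use assms in auto)
  hence "(2 / a) ^ k * ((a / 2) ^ k * y ^ k) \<le> (2 / a) ^ k * (fact k * exp (a / 2 * y))"
    by (intro mult_left_mono) (use assms in auto)
  moreover have "(2 / a) ^ k * ((a / 2) ^ k * y ^ k) = y ^ k"
    using assms by (simp add: power_divide)
  ultimately have "y ^ k * exp (- a * y) \<le> (2 / a) ^ k * (fact k * exp (a / 2 * y)) * exp (- a * y)"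
    by (intro mult_right_mono) auto
  also have "\<dots> = fact k * (2 / a) ^ k * (exp (a / 2 * y) * exp (- a * y))" by simp
  also have "exp (a / 2 * y) * exp (- a * y) = exp (- (a / 2) * y)"
    by (simp add: exp_add [symmetric])
  finally show ?thesis .
qed

lemma summable_power_exp_square:
  fixes a :: real assumes "a > 0"
  shows "summable (\<lambda>m. real (Suc m) ^ k * exp (- a * real (Suc m) ^ 2))"
proof (rule summable_comparison_test')
  have "summable (\<lambda>m. exp (- (a / 2)) ^ Suc m)"
    by (subst summable_Suc_iff, rule summable_geometric) (use assms in auto)
  thus "summable (\<lambda>m. fact k * (2 / a) ^ k * exp (- (a / 2)) ^ Suc m)"
    by (rule summable_mult)
  fix m :: nat
  have "real (Suc m) ^ k * exp (- a * real (Suc m) ^ 2) \<le> real (Suc m) ^ k * exp (- a * real (Suc m))"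
    using assms by (intro mult_left_mono) (auto simp: power2_eq_square)
  also have "\<dots> \<le> fact k * (2 / a) ^ k * exp (- (a / 2) * real (Suc m))"
    by (rule power_mult_exp_le) (use assms in auto)
  also have "exp (- (a / 2) * real (Suc m)) = exp (- (a / 2)) ^ Suc m"
    by (subst exp_of_nat_mult [symmetric]) (simp add: mult.commute)
  finally show "norm (real (Suc m) ^ k * exp (- a * real (Suc m) ^ 2)) \<le>
      fact k * (2 / a) ^ k * exp (- (a / 2)) ^ Suc m" by simp
qed

abbreviation theta_term :: "nat \<Rightarrow> nat \<Rightarrow> real \<Rightarrow> real" where
  "theta_term k m x \<equiv> real (Suc m) ^ k * exp (- pi * real (Suc m) ^ 2 * x)"

text \<open>The index k is the power of the summation variable. Each derivative in x raises it by 2,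
  so k = 0, 2, 4 carry theta and its first two derivatives.\<close>

definition theta_tail :: "nat \<Rightarrow> real \<Rightarrow> real" where
  "theta_tail k x = (\<Sum>m. theta_term k m x)"

lemma summable_theta_tail:
  "x > 0 \<Longrightarrow> summable (\<lambda>m. theta_term k m x)"
  using summable_power_exp_square[of "pi * x" k] by (simp add: mult_ac)

lemma theta_tail_nonneg: "x > 0 \<Longrightarrow> theta_tail k x \<ge> 0"
  unfolding theta_tail_def by (intro suminf_nonneg summable_theta_tail) auto

lemma DERIV_theta_tail:
  assumes "x > 0"
  shows "(theta_tail k has_field_derivative (- pi * theta_tail (k + 2) x)) (at x)"
proof -
  define f where "f m t = theta_term k m t" for m and t :: real
  define f' where "f' m t = - pi * (theta_term (k + 2) m t)"
    for m and t :: real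
  have "((\<lambda>t. \<Sum>m. f m t) has_field_derivative (\<Sum>m. f' m x)) (at x)"
  proof (rule has_field_derivative_series')
    show "convex {x / 2<..}" by simp
    show "(f m has_field_derivative f' m t) (at t within {x / 2<..})" for m t
      unfolding f_def f'_def
      by (auto intro!: derivative_eq_intros simp: power_add power2_eq_square)
    \<comment> \<open>For t > x / 2 each differentiated term is dominated by its value at x / 2,
      which gives a summable majorant independent of t.\<close>
    show "uniformly_convergent_on {x / 2<..} (\<lambda>n t. \<Sum>i<n. f' i t)"
    proof (rule Weierstrass_m_test')
      show "summable (\<lambda>m. pi * (theta_term (k + 2) m (x / 2)))"
        by (intro summable_mult summable_theta_tail) (use assms in auto)
      show "norm (f' m t) \<le> pi * (theta_term (k + 2) m (x / 2))"
        if "t \<in> {x / 2<..}" for m t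
        unfolding f'_def using that
        by (simp add: abs_mult del: of_nat_Suc power_Suc)
    qed
    show "x \<in> {x / 2<..}" "x \<in> interior {x / 2<..}"
      using assms by (auto simp: interior_open)
    show "summable (\<lambda>n. f n x)" unfolding f_def using summable_theta_tail[OF assms] .
  qed
  moreover have "(\<Sum>m. f' m x) = - pi * theta_tail (k + 2) x"
    unfolding f'_def theta_tail_def by (rule suminf_mult) (rule summable_theta_tail [OF assms])
  moreover have "(\<lambda>t. \<Sum>m. f m t) = theta_tail k" by (auto simp: f_def theta_tail_def)
  ultimately show ?thesis by simp
qed

text \<open>The filter that extracts from a binomial expansion the terms in one residue class modulo
  l. The frequency d is an integer because the expansion of an even cosine power is centred at
  0.\<close>

lemma sum_roots_of_unity:
  fixes l :: nat and d :: int assumes l: "l > 0"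
  shows "(\<Sum>k<l. cis (2 * pi * real k / real l * of_int d)) = (if int l dvd d then of_nat l else 0)"
proof -
  define z where "z = cis (2 * pi * of_int d / real l)"
  have pw: "cis (2 * pi * real k / real l * of_int d) = z ^ k" for k
    unfolding z_def Complex.DeMoivre by (simp add: field_simps)
  have zl: "z ^ l = 1"
    unfolding z_def Complex.DeMoivre using l by (simp add: cis_multiple_2pi)
  have z1: "z = 1 \<longleftrightarrow> int l dvd d"
  proof
    assume "z = 1"
    hence "cos (2 * pi * of_int d / real l) = 1" unfolding z_def by (metis cis.simps(1) one_complex.simps(1))
    then obtain n :: int where "2 * pi * of_int d / real l = of_int n * 2 * pi"
      using cos_one_2pi_int by blast
    hence "real_of_int d = of_int n * real l" using l by (simp add: field_simps)
    hence "real_of_int d = of_int (n * int l)" by simp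
    hence "d = n * int l" by linarith
    thus "int l dvd d" by simp
  next
    assume "int l dvd d"
    then obtain n where "d = int l * n" by (auto elim: dvdE)
    hence "2 * pi * of_int d / real l = 2 * pi * of_int n" using l by simp
    thus "z = 1" unfolding z_def by (simp only: cis_multiple_2pi Ints_of_int)
  qed
  show ?thesis
  proof (cases "z = 1")
    case True thus ?thesis using z1 unfolding pw by simp
  next
    case False
    have "(\<Sum>k<l. z ^ k) = 0" using False zl by (simp add: geometric_sum)
    thus ?thesis using False z1 unfolding pw by simp
  qed
qed

text \<open>Since 1 + cis x = cis (x / 2) * 2 cos (x / 2), the cosine power is (1 + cis x) ^ (2 m)
  divided by cis (m x). The half angle makes the frequencies integral.\<close>

lemma cos_power_eq_sum_cis:
  "complex_of_real ((2 * cos (x / 2)) ^ (2 * m)) =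
     (\<Sum>j\<le>2 * m. of_nat ((2 * m) choose j) * cis (x * of_int (int j - int m)))"
proof -
  have sq: "(1 + cis x) ^ 2 = cis x * of_real ((2 * cos (x / 2)) ^ 2)"
  proof -
    have "1 + cis x = cis (x / 2) * (cis (- (x / 2)) + cis (x / 2))"
      by (simp add: distrib_left cis_mult)
    also have "cis (- (x / 2)) + cis (x / 2) = of_real (2 * cos (x / 2))"
      by (simp add: complex_eq_iff)
    finally show ?thesis
      by (simp add: power_mult_distrib Complex.DeMoivre)
  qed
  have "complex_of_real ((2 * cos (x / 2)) ^ (2 * m)) = cis (- (real m * x)) * (cis (real m * x) * of_real ((2 * cos (x / 2)) ^ (2 * m)))"
    by (simp add: mult.assoc [symmetric] cis_mult)
  also have "cis (real m * x) * of_real ((2 * cos (x / 2)) ^ (2 * m)) = ((1 + cis x) ^ 2) ^ m"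
    unfolding sq by (simp add: power_mult_distrib Complex.DeMoivre power_mult)
  also have "\<dots> = (cis x + 1) ^ (2 * m)" by (simp add: power_mult add.commute)
  also have "\<dots> = (\<Sum>j\<le>2 * m. of_nat ((2 * m) choose j) * cis x ^ j * 1 ^ (2 * m - j))"
    by (rule binomial_ring)
  also have "cis (- (real m * x)) * \<dots> = (\<Sum>j\<le>2 * m. of_nat ((2 * m) choose j) * cis (x * of_int (int j - int m)))"
    unfolding sum_distrib_left
  proof (rule sum.cong [OF refl])
    fix j
    have "cis (- (real m * x)) * cis x ^ j = cis (x * of_int (int j - int m))"
      by (simp add: Complex.DeMoivre cis_mult algebra_simps)
    thus "cis (- (real m * x)) * (of_nat ((2 * m) choose j) * cis x ^ j * 1 ^ (2 * m - j)) = of_nat ((2 * m) choose j) * cis (x * of_int (int j - int m))"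
      by (simp add: mult_ac)
  qed
  finally show ?thesis .
qed

text \<open>Polya's finite identity: summing the cosine powers over the l equidistributed angles
  keeps exactly the binomial coefficients whose distance from the central one is a multiple of
  l.\<close>

lemma sum_cos_powers_eq_binomials:
  fixes h m :: nat
  defines "l \<equiv> 2 * h + 1"
  shows "1 + 2 * (\<Sum>k=1..h. cos (pi * real k / real l) ^ (2 * m)) =
         real l / 4 ^ m * (real ((2 * m) choose m) + 2 * (\<Sum>v=1..m. real ((2 * m) choose (m + v * l))))"
proof -
  define c where "c k = (2 * cos (pi * real k / real l)) ^ (2 * m)" for k
  have l: "l > 0" by (simp add: l_def)
  define B where "B j = (if int l dvd int j - int m then real ((2 * m) choose j) else 0)" for j
  have "complex_of_real (\<Sum>k<l. c k) =
     (\<Sum>k<l. \<Sum>j\<le>2 * m. of_nat ((2 * m) choose j) * cis (2 * pi * real k / real l * of_int (int j - int m)))"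
    unfolding c_def of_real_sum
    by (intro sum.cong refl, subst cos_power_eq_sum_cis [symmetric]) (simp add: field_simps)
  also have "\<dots> = (\<Sum>j\<le>2 * m. of_nat ((2 * m) choose j) * (\<Sum>k<l. cis (2 * pi * real k / real l * of_int (int j - int m))))"
    by (subst sum.swap) (simp add: sum_distrib_left)
  also have "\<dots> = complex_of_real (real l * (\<Sum>j\<le>2 * m. B j))"
    unfolding sum_roots_of_unity [OF l] B_def of_real_mult of_real_sum sum_distrib_left
    by (intro sum.cong refl) auto
  finally have main: "(\<Sum>k<l. c k) = real l * (\<Sum>j\<le>2 * m. B j)"
    using of_real_eq_iff by blast
  \<comment> \<open>The angle pi - a changes only the sign of the cosine, which an even power
    ignores. As l is odd, k and l - k pair off the indices 0 < k < l without a fixed point.\<close>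
  have csym: "c (l - k) = c k" if "k \<le> l" for k
  proof -
    have "cos (pi * real (l - k) / real l) = - cos (pi * real k / real l)"
      using that l by (simp add: of_nat_diff right_diff_distrib diff_divide_distrib)
    thus ?thesis by (simp add: c_def)
  qed
  have "(\<Sum>k<l. c k) = c 0 + (\<Sum>k=1..h. c k) + (\<Sum>k=h+1..2*h. c k)"
  proof -
    have "{..<l} = insert 0 ({1..h} \<union> {h+1..2*h})" by (auto simp: l_def)
    thus ?thesis by (simp add: sum.union_disjoint)
  qed
  also have "(\<Sum>k=h+1..2*h. c k) = (\<Sum>k=1..h. c k)"
    by (rule sum.reindex_bij_witness [of _ "\<lambda>k. l - k" "\<lambda>k. l - k"])
       (use csym in \<open>auto simp: l_def\<close>)
  also have "c 0 = 4 ^ m" by (simp add: c_def power_mult)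
  also have "(\<Sum>k=1..h. c k) = 4 ^ m * (\<Sum>k=1..h. cos (pi * real k / real l) ^ (2 * m))"
    unfolding sum_distrib_left
    by (intro sum.cong refl) (simp add: c_def power_mult_distrib power_mult)
  finally have L: "(\<Sum>k<l. c k) = 4 ^ m * (1 + 2 * (\<Sum>k=1..h. cos (pi * real k / real l) ^ (2 * m)))"
    by (simp add: algebra_simps)
  have "(\<Sum>j\<le>2 * m. B j) = B m + (\<Sum>i=1..m. B (m + i)) + (\<Sum>j<m. B j)"
  proof -
    have "{..2*m} = insert m ({..<m} \<union> {m+1..2*m})" by auto
    moreover have "sum B ({..<m} \<union> {m+1..2*m}) = sum B {..<m} + sum B {m+1..2*m}"
      by (rule sum.union_disjoint) auto
    moreover have "(\<Sum>j=m+1..2*m. B j) = (\<Sum>i=1..m. B (m + i))"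
      by (rule sum.reindex_bij_witness [of _ "\<lambda>i. m + i" "\<lambda>k. k - m"]) auto
    ultimately show ?thesis by simp
  qed
  also have "(\<Sum>j<m. B j) = (\<Sum>i=1..m. B (m + i))"
  proof (rule sum.reindex_bij_witness [of _ "\<lambda>i. m - i" "\<lambda>k. m - k"])
    fix j assume j: "j \<in> {..<m}"
    have "((2 * m) choose (m + (m - j))) = ((2 * m) choose j)"
      using j binomial_symmetric [of j "2 * m"] by (simp add: mult_2)
    moreover have "int l dvd int (m + (m - j)) - int m \<longleftrightarrow> int l dvd int j - int m"
      using j dvd_minus_iff [of "int l" "int j - int m"] by (simp add: of_nat_diff)
    ultimately show "B (m + (m - j)) = B j" by (simp add: B_def)
  qed auto
  also have "(\<Sum>i=1..m. B (m + i)) = (\<Sum>i\<in>{i\<in>{1..m}. l dvd i}. real ((2 * m) choose (m + i)))"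
    unfolding B_def by (subst sum.inter_filter) (auto intro!: sum.cong)
  also have "\<dots> = (\<Sum>v\<in>{v\<in>{1..m}. v * l \<le> m}. real ((2 * m) choose (m + v * l)))"
  proof (rule sum.reindex_bij_witness [of _ "\<lambda>v. v * l" "\<lambda>i. i div l"])
    fix i assume "i \<in> {i \<in> {1..m}. l dvd i}"
    then obtain v where v: "i = l * v" "1 \<le> i" "i \<le> m" by (auto elim: dvdE)
    have "v \<le> l * v" using l by (cases l) auto
    hence "v \<le> m" using v by linarith
    moreover have "1 \<le> v" using v by (cases v) auto
    ultimately show "i div l \<in> {v \<in> {1..m}. v * l \<le> m}" "i div l * l = i"
      "real (2 * m choose (m + i div l * l)) = real (2 * m choose (m + i))"
      using v l by (auto simp: mult.commute)
  qed (use l in auto)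
  \<comment> \<open>For v * l > m the binomial coefficient vanishes, so the range can be made
    independent of l.\<close>
  also have "\<dots> = (\<Sum>v=1..m. real ((2 * m) choose (m + v * l)))"
    by (rule sum.mono_neutral_left) auto
  also have "B m = real ((2 * m) choose m)" by (simp add: B_def)
  finally show ?thesis using main unfolding L by (simp add: field_simps)
qed

text \<open>Consecutive coefficients have the ratio q i = 1 - (2 i + 1) / (m + i + 1), with inverse
  1 + (2 i + 1) / (m - i). Applying 1 + y <= exp y to both and adding the odd numbers, whose sum is
  H^2, gives matching Gaussian bounds.\<close>

lemma binomial_ratio_bounds:
  fixes m H :: nat
  shows "H \<le> m \<Longrightarrow> real ((2 * m) choose (m + H)) \<le> real ((2 * m) choose m) * exp (- (real H ^ 2 / (real m + real H)))"
    and "H < m \<Longrightarrow> real ((2 * m) choose (m + H)) \<ge> real ((2 * m) choose m) * exp (- (real H ^ 2 / (real m - real H)))"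
proof -
  have step: "real ((2 * m) choose (m + Suc i)) * (real m + real i + 1) = real ((2 * m) choose (m + i)) * (real m - real i)"
    if "i < m" for i
  proof -
    have "Suc (m + i) * ((2 * m) choose Suc (m + i)) = (2 * m - (m + i)) * ((2 * m) choose (m + i))"
      using binomial_absorb_comp [of "2 * m" "m + i"] binomial_absorption [of "m + i" "2 * m"] by simp
    hence "real (Suc (m + i)) * real ((2 * m) choose Suc (m + i)) = real (m - i) * real ((2 * m) choose (m + i))"
      using that by (metis (no_types, lifting) add_diff_cancel_left mult_2 of_nat_mult)
    thus ?thesis using that by (simp add: of_nat_diff algebra_simps)
  qed
  define q where "q i = (real m - real i) / (real m + real i + 1)" for i
  have eq: "real ((2 * m) choose (m + Suc i)) = real ((2 * m) choose (m + i)) * q i" if "i < m" for i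
    using step [OF that] by (simp add: q_def field_simps)
  have q0: "q i \<ge> 0" if "i < m" for i using that by (simp add: q_def)
  have e: "exp (- (real (Suc i) ^ 2 / D)) = exp (- (real i ^ 2 / D)) * exp (- ((2 * real i + 1) / D))" for i and D :: real
    by (simp add: exp_add [symmetric] power2_eq_square add_divide_distrib algebra_simps)
  have "i \<le> H \<Longrightarrow> real ((2 * m) choose (m + i)) \<le> real ((2 * m) choose m) * exp (- (real i ^ 2 / (real m + real H)))"
    if "H \<le> m" for i
  proof (induction i)
    case (Suc i)
    have im: "i < m" "i < H" using Suc that by auto
    have "q i = 1 + (- ((2 * real i + 1) / (real m + real i + 1)))"
      by (simp add: q_def field_simps)
    also have "\<dots> \<le> exp (- ((2 * real i + 1) / (real m + real i + 1)))"
      by (rule exp_ge_add_one_self)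
    also have "\<dots> \<le> exp (- ((2 * real i + 1) / (real m + real H)))"
      using im by (auto intro!: divide_left_mono)
    finally have "q i \<le> exp (- ((2 * real i + 1) / (real m + real H)))" .
    thus ?case
      unfolding eq [OF im(1)] e mult.assoc [symmetric] using Suc im q0
      by (intro mult_mono) auto
  qed simp_all
  from this [of H] show "H \<le> m \<Longrightarrow> real ((2 * m) choose (m + H)) \<le> real ((2 * m) choose m) * exp (- (real H ^ 2 / (real m + real H)))"
    by auto
  have "i \<le> H \<Longrightarrow> real ((2 * m) choose (m + i)) \<ge> real ((2 * m) choose m) * exp (- (real i ^ 2 / (real m - real H)))"
    if "H < m" for i
  proof (induction i)
    case (Suc i)
    have im: "i < m" "i < H" using Suc that by auto
    have pos: "real m - real H > 0" "real m - real i > 0" using that im by auto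
    have "1 / q i = 1 + (2 * real i + 1) / (real m - real i)"
      using pos by (simp add: q_def field_simps)
    also have "\<dots> \<le> exp ((2 * real i + 1) / (real m - real i))"
      by (rule exp_ge_add_one_self)
    also have "\<dots> \<le> exp ((2 * real i + 1) / (real m - real H))"
      using im pos by (auto intro!: divide_left_mono)
    finally have "q i \<ge> exp (- ((2 * real i + 1) / (real m - real H)))"
      using pos by (simp add: exp_minus q_def field_simps)
    thus ?case
      unfolding eq [OF im(1)] e mult.assoc [symmetric] using Suc im q0
      by (intro mult_mono) auto
  qed simp_all
  from this [of H] show "H < m \<Longrightarrow> real ((2 * m) choose (m + H)) \<ge> real ((2 * m) choose m) * exp (- (real H ^ 2 / (real m - real H)))"
    by auto
qed

section \<open>The functional equation of theta\<close>

text \<open>Serves as a majorant, so the sharp constant 1 / 2 is given up: with x <= 2 the quartic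
  remainder is at most x^2 / 6, and 1 / 2 - 1 / 6 exceeds 1 / 4.\<close>

lemma cos_le_exp_square:
  fixes x :: real assumes "0 \<le> x" "x \<le> pi / 2"
  shows "cos x \<le> exp (- x\<^sup>2 / 4)"
proof (cases "x = 0")
  case False
  hence "x > 0" using assms by simp
  from Maclaurin_cos_expansion2 [OF this, of 4] obtain t where t:
    "cos x = (\<Sum>m<4. cos_coeff m * x ^ m) + cos (t + 1 / 2 * real 4 * pi) / fact 4 * x ^ 4" by auto
  have s: "(\<Sum>m<4. cos_coeff m * x ^ m) = 1 - x\<^sup>2 / 2"
  proof -
    have "{..<4::nat} = {0, 1, 2, 3}" by auto
    thus ?thesis by (simp add: cos_coeff_def fact_numeral)
  qed
  have "cos (t + 1 / 2 * real 4 * pi) / fact 4 * x ^ 4 \<le> 1 / fact 4 * x ^ 4"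
    by (intro mult_right_mono divide_right_mono) auto
  also have "\<dots> = x\<^sup>2 * x\<^sup>2 / 24" by (simp add: fact_numeral power4_eq_xxxx power2_eq_square)
  also have "\<dots> \<le> x\<^sup>2 * 4 / 24"
  proof (intro divide_right_mono mult_left_mono)
    have "x \<le> 2" using assms pi_less_4 by linarith
    thus "x\<^sup>2 \<le> 4" using assms power_mono [of x 2 2] by simp
  qed auto
  finally have "cos x \<le> 1 + (- x\<^sup>2 / 4)" using t s zero_le_power2 [of x] by linarith
  also have "\<dots> \<le> exp (- x\<^sup>2 / 4)" by (rule exp_ge_add_one_self)
  finally show ?thesis .
qed simp

text \<open>The Jacobi theta series over all integers, with m and - m paired.\<close>

definition theta :: "real \<Rightarrow> real" where
  "theta x = 1 + 2 * theta_tail 0 x"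

lemma theta_ge_1: "x > 0 \<Longrightarrow> theta x \<ge> 1"
  by (simp add: theta_def theta_tail_nonneg)

text \<open>Here l is an odd integer within 1 of sqrt (m / c), so m / l^2 tends to c. With this
  scaling the k-th cosine power tends to exp (- pi^2 c k^2) and the v-th binomial ratio to exp (-
  v^2 / c): both sides of the finite identity become theta values, at reciprocal arguments.\<close>

context
  fixes c :: real and h l :: "nat \<Rightarrow> nat"
  assumes c: "c > 0"
  defines "h \<equiv> \<lambda>m. nat \<lfloor>sqrt (real m / c) / 2\<rfloor>"
  defines "l \<equiv> \<lambda>m. 2 * h m + 1"
begin

private lemma l_bounds: "sqrt (real m / c) - 1 \<le> real (l m)" "real (l m) \<le> sqrt (real m / c) + 1"
proof -
  have "real (h m) = of_int \<lfloor>sqrt (real m / c) / 2\<rfloor>"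
    using c by (simp add: h_def)
  moreover have "real (l m) = 2 * real (h m) + 1" by (simp add: l_def)
  ultimately show "sqrt (real m / c) - 1 \<le> real (l m)" "real (l m) \<le> sqrt (real m / c) + 1"
    using floor_correct [of "sqrt (real m / c) / 2"] by linarith+
qed

lemma polya_l_asymp: "(\<lambda>m. real (l m) / sqrt (real m)) \<longlonglongrightarrow> 1 / sqrt c"
proof (rule tendsto_sandwich)
  show "\<forall>\<^sub>F m in sequentially. (sqrt (real m / c) - 1) / sqrt (real m) \<le> real (l m) / sqrt (real m)"
    by (intro always_eventually allI divide_right_mono l_bounds) auto
  show "\<forall>\<^sub>F m in sequentially. real (l m) / sqrt (real m) \<le> (sqrt (real m / c) + 1) / sqrt (real m)"
    by (intro always_eventually allI divide_right_mono l_bounds) auto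
  define d where "d = sqrt c"
  have d: "d > 0" using c by (simp add: d_def)
  have "(\<lambda>m. (sqrt (real m) / d - 1) / sqrt (real m)) \<longlonglongrightarrow> 1 / d"
    "(\<lambda>m. (sqrt (real m) / d + 1) / sqrt (real m)) \<longlonglongrightarrow> 1 / d"
    using d by (real_asymp simp: field_simps)+
  thus "(\<lambda>m. (sqrt (real m / c) - 1) / sqrt (real m)) \<longlonglongrightarrow> 1 / sqrt c"
    "(\<lambda>m. (sqrt (real m / c) + 1) / sqrt (real m)) \<longlonglongrightarrow> 1 / sqrt c"
    by (simp_all add: real_sqrt_divide d_def)
qed

private lemma l_square: "(\<lambda>m. real (l m) ^ 2 / real m) \<longlonglongrightarrow> 1 / c"
  using tendsto_power [OF polya_l_asymp, of 2] c by (simp add: power_divide)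

private lemma l_square': "(\<lambda>m. real m / real (l m) ^ 2) \<longlonglongrightarrow> c"
  using tendsto_inverse [OF l_square] c by simp

private lemma l_at_top: "filterlim (\<lambda>m. real (l m)) at_top sequentially"
proof (rule filterlim_at_top_mono)
  show "filterlim (\<lambda>m. sqrt (real m / c) - 1) at_top sequentially"
    using c by real_asymp
qed (intro always_eventually allI l_bounds)

text \<open>Dominated convergence for series: the sum is padded by zeros beyond h m, each term
  converges because ln (cos y) / y^2 tends to - 1 / 2, and \<open>cos_le_exp_square\<close> gives a
  Gaussian majorant.\<close>

lemma polya_cos_side:
  "(\<lambda>m. 1 + 2 * (\<Sum>k=1..h m. cos (pi * real k / real (l m)) ^ (2 * m))) \<longlonglongrightarrow> theta (pi * c)"
proof -
  define a where "a k m = (if k < h m then cos (pi * real (Suc k) / real (l m)) ^ (2 * m) else 0)" for k m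
  have suma: "(\<Sum>k=1..h m. cos (pi * real k / real (l m)) ^ (2 * m)) = (\<Sum>k. a k m)" for m
  proof -
    have "(\<Sum>k. a k m) = (\<Sum>k<h m. a k m)"
      by (rule suminf_finite) (auto simp: a_def)
    also have "\<dots> = (\<Sum>k=1..h m. cos (pi * real k / real (l m)) ^ (2 * m))"
      by (rule sum.reindex_bij_witness [of _ "\<lambda>k. k - 1" Suc]) (auto simp: a_def)
    finally show ?thesis by simp
  qed
  have hl: "k < h m \<longleftrightarrow> real (2 * k + 1) < real (l m)" for k m
    unfolding of_nat_less_iff l_def by auto
  have angle: "pi * real (Suc k) / real (l m) < pi / 2" if "k < h m" for k m
  proof -
    have "2 * Suc k < l m" using that by (simp add: l_def)
    hence "real (2 * Suc k) < real (l m)" by (simp only: of_nat_less_iff)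
    hence "pi * real (2 * Suc k) < pi * real (l m)" by (intro mult_strict_left_mono) auto
    moreover have "real (l m) > 0" by (simp add: l_def)
    ultimately show ?thesis by (simp add: field_simps)
  qed
  have "((\<lambda>m. \<Sum>k. a k m) \<longlonglongrightarrow> (\<Sum>k. exp (- pi * real (Suc k) ^ 2 * (pi * c))))"
  proof (rule tannerys_theorem [THEN conjunct2, THEN conjunct2])
    show "(\<lambda>m. a k m) \<longlonglongrightarrow> exp (- pi * real (Suc k) ^ 2 * (pi * c))" for k
    proof -
      define x where "x = pi * real (Suc k)"
      have x: "x > 0" by (simp add: x_def)
      have lim0: "filterlim (\<lambda>m. x / real (l m)) (at_right 0) sequentially"
      proof (rule filterlim_compose [OF _ l_at_top])
        show "filterlim (\<lambda>y. x / y) (at_right 0) at_top" using x by real_asymp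
      qed
      have g: "((\<lambda>y::real. ln (cos y) / y ^ 2) \<longlongrightarrow> - 1 / 2) (at_right 0)"
        by real_asymp
      have "(\<lambda>m. exp (2 * (real m / real (l m) ^ 2) * x ^ 2 * (ln (cos (x / real (l m))) / (x / real (l m)) ^ 2)))
          \<longlonglongrightarrow> exp (2 * c * x ^ 2 * (- 1 / 2))"
        by (intro tendsto_intros l_square' filterlim_compose [OF g lim0])
      moreover have "\<forall>\<^sub>F m in sequentially. exp (2 * (real m / real (l m) ^ 2) * x ^ 2 * (ln (cos (x / real (l m))) / (x / real (l m)) ^ 2)) = a k m"
        using filterlim_at_top_dense [THEN iffD1, OF l_at_top, rule_format, of "real (2 * k + 1)"]
      proof eventually_elim
        case (elim m)
        have "k < h m" using elim hl by blast
        hence "x / real (l m) < pi / 2" unfolding x_def by (rule angle)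
        moreover have "0 \<le> x / real (l m)" using x by simp
        ultimately have cp: "cos (x / real (l m)) > 0"
          by (intro cos_gt_zero_pi) (auto intro: less_le_trans [of _ 0])
        have "2 * (real m / real (l m) ^ 2) * x ^ 2 * (ln (cos (x / real (l m))) / (x / real (l m)) ^ 2)
           = real (2 * m) * ln (cos (x / real (l m)))"
          using x by (simp add: power_divide l_def)
        also have "exp \<dots> = cos (x / real (l m)) ^ (2 * m)"
          using cp by (subst exp_of_nat_mult) simp
        finally show ?case using \<open>k < h m\<close> by (simp add: a_def x_def)
      qed
      ultimately have "(\<lambda>m. a k m) \<longlonglongrightarrow> exp (2 * c * x ^ 2 * (- 1 / 2))"
        using Lim_transform_eventually by blast
      moreover have "2 * c * x ^ 2 * (- 1 / 2) = - pi * real (Suc k) ^ 2 * (pi * c)"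
        by (simp add: x_def power_mult_distrib power2_eq_square del: of_nat_Suc)
      ultimately show ?thesis by (simp only:)
    qed
    \<comment> \<open>Half of the limiting value suffices and makes the majorant independent of
      m.\<close>
    have "\<forall>\<^sub>F m in sequentially. real m / real (l m) ^ 2 > c / 2"
      using l_square' c by (intro order_tendstoD) auto
    hence ev: "\<forall>\<^sub>F m in sequentially. \<forall>k. norm (a k m) \<le> exp (- (pi * pi * c / 4) * real (Suc k) ^ 2)"
    proof eventually_elim
      case (elim m)
      show ?case
      proof
        fix k
        show "norm (a k m) \<le> exp (- (pi * pi * c / 4) * real (Suc k) ^ 2)"
        proof (cases "k < h m")
          case True
          define x where "x = pi * real (Suc k) / real (l m)"
          have x: "0 \<le> x" "x \<le> pi / 2" using angle [OF True] by (auto simp: x_def)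
          have "cos x ^ (2 * m) \<le> exp (- x\<^sup>2 / 4) ^ (2 * m)"
            using x by (intro power_mono cos_le_exp_square cos_ge_zero) auto
          also have "\<dots> = exp (real (2 * m) * (- x\<^sup>2 / 4))" by (rule exp_of_nat_mult [symmetric])
          also have "real (2 * m) * (- x\<^sup>2 / 4) = - (pi * pi / 2) * real (Suc k) ^ 2 * (real m / real (l m) ^ 2)"
            by (simp add: x_def power_divide power_mult_distrib power2_eq_square)
          also have "\<dots> \<le> - (pi * pi / 2) * real (Suc k) ^ 2 * (c / 2)"
            using elim by (intro mult_left_mono_neg) auto
          also have "\<dots> = - (pi * pi * c / 4) * real (Suc k) ^ 2" by simp
          finally show ?thesis using True x cos_ge_zero [of x] by (simp add: a_def x_def)
        qed (simp add: a_def)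
      qed
    qed
    show "\<forall>\<^sub>F (k, m) in sequentially \<times>\<^sub>F sequentially. norm (a k m) \<le> exp (- (pi * pi * c / 4) * real (Suc k) ^ 2)"
      unfolding eventually_prod_filter using ev
      by (intro exI [of _ "\<lambda>_. True"] exI [of _ "\<lambda>m. \<forall>k. norm (a k m) \<le> exp (- (pi * pi * c / 4) * real (Suc k) ^ 2)"]) auto
    show "summable (\<lambda>k. exp (- (pi * pi * c / 4) * real (Suc k) ^ 2))"
      using summable_power_exp_square [of "pi * pi * c / 4" 0] c by simp
  qed simp
  thus ?thesis unfolding suma theta_def theta_tail_def
    by (intro tendsto_intros) simp
qed

text \<open>The pointwise limit is squeezed between the two Gaussian bounds, whose denominators m -
  H and m + H agree to first order since H has order sqrt m. The majorant uses only the upper bound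
  with m + H <= 2 m; beyond H = m the coefficients vanish.\<close>

lemma polya_binomial_side:
  "(\<lambda>m. 1 + 2 * (\<Sum>v=1..m. real ((2 * m) choose (m + v * l m)) / real ((2 * m) choose m))) \<longlonglongrightarrow> theta (1 / (pi * c))"
proof -
  define a where "a v m = real ((2 * m) choose (m + Suc v * l m)) / real ((2 * m) choose m)" for v m
  have l0: "l m > 0" for m by (simp add: l_def)
  have suma: "(\<Sum>v=1..m. real ((2 * m) choose (m + v * l m)) / real ((2 * m) choose m)) = (\<Sum>v. a v m)" for m
  proof -
    have "a v m = 0" if "v \<ge> m" for v
    proof -
      have "Suc v * 1 \<le> Suc v * l m" using l0 [of m] by (intro mult_le_mono) auto
      hence "2 * m < m + Suc v * l m" using that by simp
      thus ?thesis by (simp add: a_def del: mult_Suc)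
    qed
    hence "(\<Sum>v. a v m) = (\<Sum>v<m. a v m)"
      by (intro suminf_finite) auto
    also have "\<dots> = (\<Sum>v=1..m. real ((2 * m) choose (m + v * l m)) / real ((2 * m) choose m))"
      by (rule sum.reindex_bij_witness [of _ "\<lambda>k. k - 1" Suc]) (auto simp: a_def)
    finally show ?thesis by simp
  qed
  have cp: "real ((2 * m) choose m) > 0" for m by simp
  have "((\<lambda>m. \<Sum>v. a v m) \<longlonglongrightarrow> (\<Sum>k. exp (- pi * real (Suc k) ^ 2 * (1 / (pi * c)))))"
  proof (rule tannerys_theorem [THEN conjunct2, THEN conjunct2])
    show "(\<lambda>m. a k m) \<longlonglongrightarrow> exp (- pi * real (Suc k) ^ 2 * (1 / (pi * c)))" for k
    proof -
      define H where "H m = Suc k * l m" for m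
      have H0: "(\<lambda>m. real (H m) / real m) \<longlonglongrightarrow> 0"
      proof -
        have "(\<lambda>m. real (Suc k) * (real (l m) / sqrt (real m)) * (1 / sqrt (real m))) \<longlonglongrightarrow> real (Suc k) * (1 / sqrt c) * 0"
        proof (rule tendsto_mult [OF tendsto_mult [OF tendsto_const polya_l_asymp]])
          show "(\<lambda>m. 1 / sqrt (real m)) \<longlonglongrightarrow> 0" by real_asymp
        qed
        thus ?thesis by (simp add: H_def del: mult_Suc of_nat_Suc)
      qed
      have H2: "(\<lambda>m. real (H m) ^ 2 / real m) \<longlonglongrightarrow> real (Suc k) ^ 2 * (1 / c)"
        using tendsto_mult [OF tendsto_const l_square, of "real (Suc k) ^ 2"]
        by (simp add: H_def power_mult_distrib del: of_nat_Suc mult_Suc)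
      have ev: "\<forall>\<^sub>F m in sequentially. real (H m) / real m < 1 \<and> m > 0"
        by (intro eventually_conj order_tendstoD(2) [OF H0] eventually_gt_at_top) auto
      have lim: "(\<lambda>m. exp (- ((real (H m) ^ 2 / real m) / (1 + s * (real (H m) / real m))))) \<longlonglongrightarrow>
         exp (- (real (Suc k) ^ 2 * (1 / c)) / (1 + s * 0))" for s :: real
        using tendsto_exp [OF tendsto_minus [OF tendsto_divide [OF H2
          tendsto_add [OF tendsto_const [of 1] tendsto_mult [OF tendsto_const [of s] H0]]]]] by simp
      show ?thesis
      proof (rule tendsto_sandwich)
        show "\<forall>\<^sub>F m in sequentially. exp (- ((real (H m) ^ 2 / real m) / (1 + (-1) * (real (H m) / real m)))) \<le> a k m"
          using ev
        proof eventually_elim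
          case (elim m)
          hence "H m < m" by (auto simp: divide_less_eq)
          have "(real (H m) ^ 2 / real m) / (1 + (-1) * (real (H m) / real m)) = real (H m) ^ 2 / (real m - real (H m))"
            using elim by (simp add: field_simps)
          moreover have "exp (- (real (H m) ^ 2 / (real m - real (H m)))) \<le> a k m"
            using binomial_ratio_bounds(2) [OF \<open>H m < m\<close>] cp [of m]
            by (simp add: a_def H_def pos_le_divide_eq mult.commute del: mult_Suc)
          ultimately show ?case by (simp only:)
        qed
        show "\<forall>\<^sub>F m in sequentially. a k m \<le> exp (- ((real (H m) ^ 2 / real m) / (1 + 1 * (real (H m) / real m))))"
          using ev
        proof eventually_elim
          case (elim m)
          hence "H m \<le> m" by (auto simp: divide_less_eq)
          have "(real (H m) ^ 2 / real m) / (1 + 1 * (real (H m) / real m)) = real (H m) ^ 2 / (real m + real (H m))"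
            using elim by (simp add: field_simps)
          moreover have "a k m \<le> exp (- (real (H m) ^ 2 / (real m + real (H m))))"
            using binomial_ratio_bounds(1) [OF \<open>H m \<le> m\<close>] cp [of m]
            by (simp add: a_def H_def pos_divide_le_eq mult.commute del: mult_Suc)
          ultimately show ?case by (simp only:)
        qed
      qed (use lim [of 1] lim [of "-1"] in \<open>simp_all\<close>)
    qed
    have "\<forall>\<^sub>F m in sequentially. real (l m) ^ 2 / real m > 1 / (2 * c)"
      using c by (intro order_tendstoD [OF l_square]) (auto simp: field_simps)
    hence ev: "\<forall>\<^sub>F m in sequentially. \<forall>k. norm (a k m) \<le> exp (- (1 / (4 * c)) * real (Suc k) ^ 2)"
      using eventually_gt_at_top [of 0]
    proof eventually_elim
      case (elim m)
      show ?case
      proof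
        fix k
        define H where "H = Suc k * l m"
        show "norm (a k m) \<le> exp (- (1 / (4 * c)) * real (Suc k) ^ 2)"
        proof (cases "H \<le> m")
          case True
          have "a k m \<le> exp (- (real H ^ 2 / (real m + real H)))"
            using binomial_ratio_bounds(1) [OF True] cp [of m]
            by (simp add: a_def H_def pos_divide_le_eq mult.commute del: mult_Suc)
          also have "- (real H ^ 2 / (real m + real H)) \<le> - (real H ^ 2 / (2 * real m))"
            using True elim by (auto intro!: divide_left_mono)
          also have "\<dots> = - (1 / 2) * real (Suc k) ^ 2 * (real (l m) ^ 2 / real m)"
            by (simp add: H_def power_mult_distrib del: mult_Suc of_nat_Suc)
          also have "\<dots> \<le> - (1 / 2) * real (Suc k) ^ 2 * (1 / (2 * c))"
            using elim by (intro mult_left_mono_neg) auto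
          finally show ?thesis by (simp add: a_def)
        next
          case False
          hence "2 * m < m + Suc k * l m" by (simp add: H_def)
          thus ?thesis by (simp add: a_def binomial_eq_0 del: mult_Suc)
        qed
      qed
    qed
    show "\<forall>\<^sub>F (k, m) in sequentially \<times>\<^sub>F sequentially. norm (a k m) \<le> exp (- (1 / (4 * c)) * real (Suc k) ^ 2)"
      unfolding eventually_prod_filter using ev
      by (intro exI [of _ "\<lambda>_. True"] exI [of _ "\<lambda>m. \<forall>k. norm (a k m) \<le> exp (- (1 / (4 * c)) * real (Suc k) ^ 2)"]) auto
    show "summable (\<lambda>k. exp (- (1 / (4 * c)) * real (Suc k) ^ 2))"
      using summable_power_exp_square [of "1 / (4 * c)" 0] c by simp
  qed simp
  thus ?thesis unfolding suma theta_def theta_tail_def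
    by (intro tendsto_intros) simp
qed

text \<open>The identity divided by the binomial side. What remains on the left is the central
  binomial coefficient times l, so c enters it only through l.\<close>

lemma polya_limit:
  "(\<lambda>m. real (l m) * (real ((2 * m) choose m) / 4 ^ m)) \<longlonglongrightarrow> theta (pi * c) / theta (1 / (pi * c))"
proof -
  define R where "R m = 1 + 2 * (\<Sum>v=1..m. real ((2 * m) choose (m + v * l m)) / real ((2 * m) choose m))" for m
  have R1: "R m \<ge> 1" for m by (simp add: R_def sum_nonneg)
  have "(\<lambda>m. (1 + 2 * (\<Sum>k=1..h m. cos (pi * real k / real (l m)) ^ (2 * m))) / R m) \<longlonglongrightarrow> theta (pi * c) / theta (1 / (pi * c))"
    unfolding R_def
    by (intro tendsto_divide polya_cos_side polya_binomial_side)
       (use theta_ge_1 [of "1 / (pi * c)"] c in auto)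
  moreover have "(1 + 2 * (\<Sum>k=1..h m. cos (pi * real k / real (l m)) ^ (2 * m))) / R m =
      real (l m) * (real ((2 * m) choose m) / 4 ^ m)" for m
  proof -
    have "real ((2 * m) choose m) + 2 * (\<Sum>v=1..m. real ((2 * m) choose (m + v * l m))) = real ((2 * m) choose m) * R m"
      by (simp add: R_def sum_divide_distrib [symmetric] field_simps)
    thus ?thesis using sum_cos_powers_eq_binomials [of "h m" m, folded l_def] R1 [of m]
      by (simp add: l_def field_simps)
  qed
  ultimately show ?thesis by simp
qed

end

theorem theta_functional_equation:
  assumes "x > 0"
  shows "theta x = theta (1 / x) / sqrt x"
proof -
  define l where "l c m = real (2 * nat \<lfloor>sqrt (real m / c) / 2\<rfloor> + 1)" for c :: real and m :: nat
  have c: "x / pi > 0" "1 / pi > 0" using assms by auto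
  have lim: "(\<lambda>m. l c m * (real ((2 * m) choose m) / 4 ^ m)) \<longlonglongrightarrow> theta (pi * c) / theta (1 / (pi * c))"
    if "c > 0" for c using polya_limit [OF that] by (simp add: l_def)
  have las: "(\<lambda>m. l c m / sqrt (real m)) \<longlonglongrightarrow> 1 / sqrt c" if "c > 0" for c
    using polya_l_asymp [OF that] by (simp add: l_def)
  have "(\<lambda>m. (l (1 / pi) m * (real ((2 * m) choose m) / 4 ^ m)) * ((l (x / pi) m / sqrt (real m)) / (l (1 / pi) m / sqrt (real m))))
      \<longlonglongrightarrow> (theta (pi * (1 / pi)) / theta (1 / (pi * (1 / pi)))) * ((1 / sqrt (x / pi)) / (1 / sqrt (1 / pi)))"
    by (intro tendsto_intros lim las c) auto
  moreover have "\<forall>\<^sub>F m in sequentially. (l (1 / pi) m * (real ((2 * m) choose m) / 4 ^ m)) * ((l (x / pi) m / sqrt (real m)) / (l (1 / pi) m / sqrt (real m)))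
      = l (x / pi) m * (real ((2 * m) choose m) / 4 ^ m)"
    using eventually_gt_at_top [of 0]
  proof eventually_elim
    case (elim m)
    have "l (1 / pi) m > 0" unfolding l_def by (simp only: of_nat_0_less_iff)
    thus ?case using elim by (simp add: field_simps)
  qed
  ultimately have "(\<lambda>m. l (x / pi) m * (real ((2 * m) choose m) / 4 ^ m)) \<longlonglongrightarrow>
      (theta (pi * (1 / pi)) / theta (1 / (pi * (1 / pi)))) * ((1 / sqrt (x / pi)) / (1 / sqrt (1 / pi)))"
    by (rule Lim_transform_eventually)
  moreover note lim [OF c(1)]
  ultimately have "(theta (pi * (1 / pi)) / theta (1 / (pi * (1 / pi)))) * ((1 / sqrt (x / pi)) / (1 / sqrt (1 / pi)))
      = theta (pi * (x / pi)) / theta (1 / (pi * (x / pi)))"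
    by (rule LIMSEQ_unique)
  moreover have "(1 / sqrt (x / pi)) / (1 / sqrt (1 / pi)) = 1 / sqrt x"
    by (simp add: real_sqrt_divide)
  ultimately show ?thesis
    using theta_ge_1 [of 1] theta_ge_1 [of "1 / x"] assms by (simp add: field_simps)
qed

section \<open>The kernel of xi\<close>

text \<open>This is x^2 theta'' + (3 / 2) x theta', that is, x powr (1 / 2) times the derivative of
  x powr (3 / 2) theta'. The operator kills 1 and x powr (- 1 / 2), the two leading terms of theta
  at infinity and at 0.\<close>

definition omega :: "real \<Rightarrow> real" where
  "omega x = 2 * pi\<^sup>2 * x\<^sup>2 * theta_tail 4 x - 3 * pi * x * theta_tail 2 x"

text \<open>The operator x^2 D^2 + (3 / 2) x D commutes with the involution taking f to f (1 / x) /
  sqrt x, and theta is a fixed point of it. Concretely, the functional equation of theta is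
  differentiated twice.\<close>

theorem omega_functional_equation:
  assumes x: "x > 0"
  shows "omega x = omega (1 / x) / sqrt x"
proof -
  define t1 where "t1 y = - 2 * pi * theta_tail 2 y" for y
  define t2 where "t2 y = 2 * pi\<^sup>2 * theta_tail 4 y" for y
  have d1: "(theta has_field_derivative t1 y) (at y)" if "y > 0" for y
    unfolding theta_def t1_def using that
    by (auto intro!: derivative_eq_intros DERIV_theta_tail simp: numeral_2_eq_2)
  have d2: "(t1 has_field_derivative t2 y) (at y)" if "y > 0" for y
    unfolding t1_def t2_def using that
    by (auto intro!: derivative_eq_intros DERIV_theta_tail simp: power2_eq_square)
  have om: "omega y = y\<^sup>2 * t2 y + 3 / 2 * y * t1 y" for y
    by (simp add: omega_def t1_def t2_def)
  \<comment> \<open>With symbols for the inverse square root and the inverse, every derivative below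
    is a polynomial in r, i, T and T1.\<close>
  define r where "r y = inverse (sqrt y)" for y
  define i where "i y = inverse y" for y :: real
  define T where "T y = theta (1 / y)" for y
  define T1 where "T1 y = t1 (1 / y)" for y
  have dr: "(r has_field_derivative (- (r y * i y / 2))) (at y)" if "y > 0" for y
    unfolding r_def i_def using that
    by (auto intro!: derivative_eq_intros simp: field_simps power2_eq_square)
  have di: "(i has_field_derivative (- (i y * i y))) (at y)" if "y > 0" for y
    unfolding i_def using that
    by (auto intro!: derivative_eq_intros simp: field_simps power2_eq_square)
  have iv: "((\<lambda>y. 1 / y) has_field_derivative (- (i y * i y))) (at y)" if "y > 0" for y
    using di [OF that] by (simp add: i_def [abs_def] divide_inverse)
  have dT: "(T has_field_derivative (T1 y * - (i y * i y))) (at y)" if "y > 0" for y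
    unfolding T_def T1_def using that by (intro DERIV_chain2 [OF d1 iv]) auto
  have dT1: "(T1 has_field_derivative (t2 (1 / y) * - (i y * i y))) (at y)" if "y > 0" for y
    unfolding T1_def using that by (intro DERIV_chain2 [OF d2 iv]) auto
  define u where "u y = T y * r y" for y
  define u1 where "u1 y = - (r y * i y ^ 2 * T1 y) - r y * i y / 2 * T y" for y
  have du: "(u has_field_derivative u1 y) (at y)" if "y > 0" for y
    unfolding u_def u1_def
    by (auto intro!: derivative_eq_intros dr [OF that] dT [OF that] simp: algebra_simps power2_eq_square)
  have eq1: "t1 y = u1 y" if y: "y > 0" for y
  \<comment> \<open>Both sides of the theta equation agree on the open half-line, so uniqueness of
    the derivative turns it into an equation for t1; the same argument then gives t2.\<close>
  proof -
    have "(theta has_field_derivative u1 y) (at y)"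
    proof (rule has_field_derivative_transform_within_open [OF du [OF y], of "{0<..}"])
      show "u z = theta z" if "z \<in> {0<..}" for z
        using theta_functional_equation [of z] that by (simp add: u_def T_def r_def divide_inverse)
    qed (use y in auto)
    thus ?thesis using d1 [OF y] DERIV_unique by blast
  qed
  define u2 where "u2 = r x * (3 / 4 * i x ^ 2 * T x + 3 * i x ^ 3 * T1 x + i x ^ 4 * t2 (1 / x))"
  have du1: "(u1 has_field_derivative u2) (at x)"
    unfolding u1_def u2_def
    by (auto intro!: derivative_eq_intros dr [OF x] di [OF x] dT [OF x] dT1 [OF x]
          simp: field_simps eval_nat_numeral)
  have "(t1 has_field_derivative u2) (at x)"
  proof (rule has_field_derivative_transform_within_open [OF du1, of "{0<..}"])
    show "u1 z = t1 z" if "z \<in> {0<..}" for z using eq1 [of z] that by simp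
  qed (use x in auto)
  hence eq2: "t2 x = u2" using d2 [OF x] DERIV_unique by blast
  show ?thesis unfolding om eq2 eq1 [OF x] unfolding u2_def u1_def r_def i_def T_def T1_def
    using x by (simp add: field_simps power2_eq_square eval_nat_numeral)
qed

text \<open>Each term is compared with itself at 1 / 2: the exponent drops by at least 2 (x - 1 /
  2), which is at least x for \<open>x \<ge> 1\<close>.\<close>

lemma theta_tail_le_exp:
  assumes "x \<ge> 1"
  shows "theta_tail k x \<le> theta_tail k (1 / 2) * exp (- x)"
proof -
  have "theta_tail k x \<le> (\<Sum>m. theta_term k m (1 / 2) * exp (- x))"
    unfolding theta_tail_def
  proof (rule suminf_le)
    fix m
    have "pi * real (Suc m) ^ 2 * (x - 1 / 2) \<ge> 2 * 1 * (x - 1 / 2)"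
      using assms pi_ge_two by (intro mult_mono) (auto simp: one_le_power)
    hence "- pi * real (Suc m) ^ 2 * x \<le> - pi * real (Suc m) ^ 2 * (1 / 2) + (- x)"
      using assms by (simp add: algebra_simps)
    hence "exp (- pi * real (Suc m) ^ 2 * x) \<le> exp (- pi * real (Suc m) ^ 2 * (1 / 2)) * exp (- x)"
      by (simp only: exp_add [symmetric] exp_le_cancel_iff)
    thus "theta_term k m x \<le> theta_term k m (1 / 2) * exp (- x)"
      by (simp only: mult.assoc mult_left_mono of_nat_0_le_iff zero_le_power)
  qed (intro summable_mult2 summable_theta_tail; use assms in simp)+
  also have "\<dots> = theta_tail k (1 / 2) * exp (- x)"
    unfolding theta_tail_def by (rule suminf_mult2 [symmetric]) (rule summable_theta_tail, simp)
  finally show ?thesis .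
qed

lemma omega_bound_ge_1:
  obtains C where "C > 0" "\<And>x. x \<ge> 1 \<Longrightarrow> \<bar>omega x\<bar> \<le> C * exp (- (x / 2))"
proof -
  define C where "C = 2 * pi\<^sup>2 * theta_tail 4 (1 / 2) * (fact 2 * 2 ^ 2) + 3 * pi * theta_tail 2 (1 / 2) * (fact 1 * 2 ^ 1) + 1"
  have nn: "theta_tail k (1 / 2) \<ge> 0" for k by (rule theta_tail_nonneg) simp
  have C: "C > 0" unfolding C_def using nn by (intro add_nonneg_pos add_nonneg_nonneg mult_nonneg_nonneg) auto
  have "\<bar>omega x\<bar> \<le> C * exp (- (x / 2))" if x: "x \<ge> 1" for x
  proof -
    have p: "x ^ k * exp (- x) \<le> fact k * 2 ^ k * exp (- (x / 2))" for k
      using power_mult_exp_le [of x 1 k] x by simp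
    have t: "x ^ j * theta_tail k x \<le> theta_tail k (1 / 2) * (fact j * 2 ^ j) * exp (- (x / 2))" for j k
    proof -
      have "x ^ j * theta_tail k x \<le> x ^ j * (theta_tail k (1 / 2) * exp (- x))"
        using x by (intro mult_left_mono theta_tail_le_exp) auto
      also have "\<dots> = theta_tail k (1 / 2) * (x ^ j * exp (- x))" by simp
      also have "\<dots> \<le> theta_tail k (1 / 2) * (fact j * 2 ^ j * exp (- (x / 2)))"
        by (intro mult_left_mono p nn)
      finally show ?thesis by (simp add: mult.assoc)
    qed
    have "\<bar>omega x\<bar> \<le> 2 * pi\<^sup>2 * (x ^ 2 * theta_tail 4 x) + 3 * pi * (x ^ 1 * theta_tail 2 x)"
      unfolding omega_def using theta_tail_nonneg [of x] x
      by (intro order.trans [OF abs_triangle_ineq4]) (auto simp: abs_mult)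
    also have "\<dots> \<le> 2 * pi\<^sup>2 * (theta_tail 4 (1 / 2) * (fact 2 * 2 ^ 2) * exp (- (x / 2))) + 3 * pi * (theta_tail 2 (1 / 2) * (fact 1 * 2 ^ 1) * exp (- (x / 2)))"
      by (intro add_mono mult_left_mono t) auto
    also have "\<dots> \<le> C * exp (- (x / 2))"
      by (simp add: C_def algebra_simps)
    finally show ?thesis .
  qed
  thus ?thesis using that C by blast
qed

text \<open>The functional equation turns the exponential decay at infinity into decay at 0.\<close>
lemma omega_bound:
  fixes A :: real
  obtains C where "C > 0" "\<And>x. x > 0 \<Longrightarrow> \<bar>omega x\<bar> * exp (A * \<bar>ln x\<bar>) \<le> C * exp (- (x / 4))"
proof -
  from omega_bound_ge_1 obtain C0 where C0: "C0 > 0" "\<And>x. x \<ge> 1 \<Longrightarrow> \<bar>omega x\<bar> \<le> C0 * exp (- (x / 2))" by blast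
  obtain k :: nat where k: "real k \<ge> \<bar>A\<bar> + 1" using real_arch_simple by blast
  define M where "M = fact k * 4 ^ k * C0"
  have M: "M > 0" using C0 by (simp add: M_def)
  \<comment> \<open>The spare factor x pays for the \<open>sqrt y\<close> that the functional
    equation produces on the side x < 1, where y = 1 / x.\<close>
  have *: "\<bar>omega x\<bar> * exp (A * ln x) * x \<le> M * exp (- (x / 4))" if x: "x \<ge> 1" for x
  proof -
    have "(A + 1) * ln x \<le> real k * ln x" using k x by (intro mult_right_mono) auto
    hence "exp (A * ln x) * x \<le> exp (real k * ln x)" using x
      by (subst (2) exp_ln [symmetric]) (auto simp: exp_add [symmetric] algebra_simps simp del: exp_ln)
    also have "\<dots> = x ^ k" using x by (simp add: exp_of_nat_mult)
    finally have "\<bar>omega x\<bar> * (exp (A * ln x) * x) \<le> (C0 * exp (- (x / 2))) * x ^ k"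
      using C0 x by (intro mult_mono) auto
    also have "\<dots> = C0 * (x ^ k * exp (- (1 / 2) * x))" by simp
    also have "\<dots> \<le> C0 * (fact k * 4 ^ k * exp (- (x / 4)))"
      using power_mult_exp_le [of x "1 / 2" k] x C0 by (intro mult_left_mono) auto
    finally show ?thesis by (simp add: M_def mult_ac)
  qed
  show ?thesis
  proof (rule that [of "M * exp (1 / 4)"])
    show "M * exp (1 / 4) > 0" using M by simp
    fix x :: real assume x: "x > 0"
    show "\<bar>omega x\<bar> * exp (A * \<bar>ln x\<bar>) \<le> M * exp (1 / 4) * exp (- (x / 4))"
    proof (cases "x \<ge> 1")
      case True
      have "\<bar>omega x\<bar> * exp (A * ln x) * 1 \<le> \<bar>omega x\<bar> * exp (A * ln x) * x"
        using True by (intro mult_left_mono) auto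
      also have "\<dots> \<le> M * exp (- (x / 4))" by (rule * [OF True])
      also have "\<dots> \<le> M * exp (1 / 4) * exp (- (x / 4))" using M by simp
      finally show ?thesis using True by simp
    next
      case False
      define y where "y = 1 / x"
      have y: "y \<ge> 1" "y > 0" using False x by (auto simp: y_def)
      have "\<bar>omega x\<bar> * exp (A * \<bar>ln x\<bar>) = \<bar>omega y\<bar> * exp (A * ln y) * sqrt y"
        using omega_functional_equation [OF x] False x
        by (simp add: y_def ln_div real_sqrt_divide abs_mult)
      also have "\<dots> \<le> \<bar>omega y\<bar> * exp (A * ln y) * y"
      proof (intro mult_left_mono)
        have "1 * y \<le> y * y" using y by (intro mult_right_mono) auto
        hence "sqrt y \<le> sqrt (y * y)" by (intro real_sqrt_le_mono) simp
        thus "sqrt y \<le> y" using y by simp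
      qed auto
      also have "\<dots> \<le> M * exp (- (y / 4))" by (rule * [OF y(1)])
      also have "\<dots> \<le> M * 1" using M y by (intro mult_left_mono) auto
      also have "1 \<le> exp (1 / 4) * exp (- (x / 4))" using False by (simp add: exp_add [symmetric])
      finally show ?thesis using M by (simp add: mult.assoc)
    qed
  qed
qed

section \<open>The Mellin transform of the kernel\<close>

text \<open>Euler's integral rescaled by a. Powers are written as exponentials of
  \<open>ln x\<close>, so that exponents simply add and real and complex versions have the same
  shape.\<close>

lemma has_bochner_integral_Gamma:
  fixes z :: complex and a :: real
  assumes z: "Re z > 0" and a: "a > 0"
  shows "has_bochner_integral lborel
    (\<lambda>x. indicator {0<..} x *\<^sub>R (exp ((z - 1) * of_real (ln x)) * of_real (exp (- a * x))))
    (Gamma z * exp (- z * of_real (ln a)))"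
proof -
  define f where "f x = indicator {0<..} x *\<^sub>R (exp ((z - 1) * of_real (ln x)) * of_real (exp (- x)))" for x :: real
  define g where "g t = complex_of_real t powr (z - 1) / of_real (exp t)" for t
  have fg: "exp ((z - 1) * of_real (ln x)) * of_real (exp (- x)) = g x" if "x \<in> {0<..}" for x
    using that by (simp add: g_def powr_def Ln_of_real exp_minus divide_inverse)
  have "set_integrable lebesgue {0<..} g"
    using absolutely_integrable_Gamma_integral' [OF z] by (simp add: g_def [abs_def])
  hence "set_integrable lebesgue {0<..} (\<lambda>x. exp ((z - 1) * of_real (ln x)) * of_real (exp (- x)))"
    by (subst set_integrable_cong [OF refl refl fg])
  hence "integrable lebesgue f"
    by (simp add: set_integrable_def f_def [abs_def])
  \<comment> \<open>Borel measurability is what lets integrability pass from the completed measure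
    down to \<open>lborel\<close>.\<close>
  moreover have fm: "f \<in> borel_measurable lborel"
    unfolding f_def by measurable
  ultimately have fi: "integrable lborel f" using integrable_completion by blast
  have "(g has_integral Gamma z) {0<..}"
    using Gamma_integral_complex' [OF z] by (simp add: g_def [abs_def])
  hence "((\<lambda>x. exp ((z - 1) * of_real (ln x)) * of_real (exp (- x))) has_integral Gamma z) {0<..}"
    by (subst has_integral_cong [OF fg])
  hence "integral {0<..} (\<lambda>x. exp ((z - 1) * of_real (ln x)) * complex_of_real (exp (- x))) = Gamma z"
    by (rule integral_unique)
  moreover have "set_integrable lborel {0<..} (\<lambda>x. exp ((z - 1) * of_real (ln x)) * complex_of_real (exp (- x)))"
    using fi by (simp add: set_integrable_def f_def [abs_def])
  ultimately have "integral\<^sup>L lborel f = Gamma z"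
    using set_borel_integral_eq_integral(2) by (fastforce simp: set_lebesgue_integral_def f_def [abs_def])
  with fi have hf: "has_bochner_integral lborel f (Gamma z)"
    using has_bochner_integral_integrable by metis
  have "has_bochner_integral lborel (\<lambda>x. f (0 + a * x)) (Gamma z /\<^sub>R \<bar>a\<bar>)"
    using hf a lborel_has_bochner_integral_real_affine_iff [of a f "Gamma z" 0] by simp
  hence "has_bochner_integral lborel (\<lambda>x. exp ((1 - z) * of_real (ln a)) * f (0 + a * x)) (exp ((1 - z) * of_real (ln a)) * (Gamma z /\<^sub>R \<bar>a\<bar>))"
    by (rule has_bochner_integral_mult_right)
  moreover have "exp ((1 - z) * of_real (ln a)) * (Gamma z /\<^sub>R \<bar>a\<bar>) = Gamma z * exp (- z * of_real (ln a))"
  proof -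
    have "exp ((1 - z) * of_real (ln a)) = exp (of_real (ln a)) * exp (- z * of_real (ln a))"
      by (simp add: exp_add [symmetric] algebra_simps)
    also have "exp (complex_of_real (ln a)) = of_real a"
      using a by (simp add: exp_of_real)
    finally show ?thesis using a by (simp add: scaleR_conv_of_real)
  qed
  moreover have "exp ((1 - z) * of_real (ln a)) * f (0 + a * x) =
      indicator {0<..} x *\<^sub>R (exp ((z - 1) * of_real (ln x)) * of_real (exp (- a * x)))" for x
  proof (cases "x > 0")
    case True
    hence "exp ((1 - z) * of_real (ln a)) * exp ((z - 1) * of_real (ln (a * x))) = exp ((z - 1) * of_real (ln x))"
      using a by (simp add: ln_mult exp_add [symmetric] algebra_simps)
    thus ?thesis using True a by (simp add: f_def mult.assoc [symmetric])
  next
    case False thus ?thesis using a by (simp add: f_def zero_less_mult_iff)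
  qed
  ultimately show ?thesis by simp
qed

lemma has_bochner_integral_Gamma_real:
  fixes z a :: real
  assumes z: "z > 0" and a: "a > 0"
  shows "has_bochner_integral lborel
    (\<lambda>x. indicator {0<..} x * (exp ((z - 1) * ln x) * exp (- a * x))) (Gamma z * exp (- z * ln a))"
proof -
  have "has_bochner_integral lborel
    (\<lambda>x. Re (indicator {0<..} x *\<^sub>R (exp ((of_real z - 1) * of_real (ln x)) * of_real (exp (- a * x)))))
    (Re (Gamma (of_real z) * exp (- of_real z * of_real (ln a))))"
    by (intro has_bochner_integral_Re has_bochner_integral_Gamma) (use assms in auto)
  moreover have "(of_real z - 1) * of_real (ln x) = complex_of_real ((z - 1) * ln x)" for x by simp
  moreover have "- of_real z * of_real (ln a) = complex_of_real (- z * ln a)" by simp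
  ultimately show ?thesis
    by (simp only: exp_of_real Gamma_complex_of_real of_real_mult [symmetric] Re_complex_of_real
         scaleR_conv_of_real)
qed

lemma set_integrable_exp_decay:
  fixes f :: "real \<Rightarrow> 'a :: {banach, second_countable_topology}"
  assumes f: "continuous_on {0<..} f" and a: "a > 0" and le: "\<And>x. x > 0 \<Longrightarrow> norm (f x) \<le> C * exp (- a * x)"
  shows "set_integrable lborel {0<..} f"
  unfolding set_integrable_def
proof (rule Bochner_Integration.integrable_bound)
  have "integrable lborel (\<lambda>x. indicator {0<..} x * (exp ((1 - 1) * ln x) * exp (- a * x)))"
    using has_bochner_integral_Gamma_real [of 1 a] a by (auto intro: integrable.intros)
  thus "integrable lborel (\<lambda>x. C * (indicator {0<..} x * exp (- a * x)))" by simp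
  have "f \<in> borel_measurable (restrict_space borel {0<..})"
    by (rule borel_measurable_continuous_on_restrict [OF f])
  thus "(\<lambda>x. indicator {0<..} x *\<^sub>R f x) \<in> borel_measurable lborel"
    by (simp add: borel_measurable_restrict_space_iff)
  have C: "C \<ge> 0"
  proof -
    have "0 \<le> C * exp (- a * 1)" using order.trans [OF norm_ge_zero le [of 1]] by simp
    thus ?thesis by (simp add: zero_le_mult_iff)
  qed
  show "AE x in lborel. norm (indicat_real {0<..} x *\<^sub>R f x) \<le> norm (C * (indicator {0<..} x * exp (- a * x)))"
    using le C by (intro AE_I2) (auto simp: indicator_def)
qed

lemma continuous_on_omega: "continuous_on {0<..} omega"
proof -
  have "continuous_on {0<..} (theta_tail k)" for k
    by (intro DERIV_continuous_on [OF DERIV_subset [OF DERIV_theta_tail]]) auto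
  thus ?thesis unfolding omega_def [abs_def] by (intro continuous_intros)
qed

text \<open>The argument is s / 2 because the m-th term of theta depends on m^2 x.\<close>

definition mellin_omega :: "complex \<Rightarrow> complex" where
  "mellin_omega s = (LINT x:{0<..}|lborel. exp ((s / 2 - 1) * of_real (ln x)) * of_real (omega x))"

text \<open>Integrated term by term, the m-th part of omega gives 2 Gamma (s / 2 + 2) - 3 Gamma (s /
  2 + 1) times (pi m^2) powr (- s / 2), and the Gamma recurrence turns the difference into s (s - 1)
  / 2 * Gamma (s / 2). The condition on Re s makes the absolute values summable, as the exchange of
  sum and integral requires.\<close>

theorem mellin_omega_eq:
  assumes s: "Re s > 1"
  shows "(\<lambda>m. s * (s - 1) / 2 * of_real pi powr (- s / 2) * Gamma (s / 2) * (1 / of_nat (Suc m) powr s))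
           sums mellin_omega s"
proof -
  define a where "a m = pi * real (Suc m) ^ 2" for m
  have a: "a m > 0" for m by (simp add: a_def)
  define \<sigma> where "\<sigma> = Re s"
  have \<sigma>: "\<sigma> > 1" using s by (simp add: \<sigma>_def)
  define e where "e w x = exp (w * complex_of_real (ln x))" for w x
  define f where "f m x = indicator {0<..} x *\<^sub>R (e (s / 2 - 1) x * of_real ((2 * a m ^ 2 * x ^ 2 - 3 * a m * x) * exp (- a m * x)))" for m x
  have fsplit: "f m x = of_real (2 * a m ^ 2) * (indicator {0<..} x *\<^sub>R (e (s / 2 + 2 - 1) x * of_real (exp (- a m * x))))
      - of_real (3 * a m) * (indicator {0<..} x *\<^sub>R (e (s / 2 + 1 - 1) x * of_real (exp (- a m * x))))" for m x
  proof (cases "x > 0")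
    case True
    hence el: "exp (complex_of_real (ln x)) = of_real x" by (simp add: exp_of_real)
    have "e (s / 2 + 1 - 1) x = e (s / 2 - 1) x * of_real x"
      unfolding e_def el [symmetric] exp_add [symmetric] by (simp add: algebra_simps)
    moreover have "e (s / 2 + 2 - 1) x = e (s / 2 - 1) x * of_real (x ^ 2)"
      unfolding e_def of_real_power el [symmetric] exp_of_nat_mult [symmetric] exp_add [symmetric] by (simp add: algebra_simps)
    ultimately show ?thesis using True by (simp add: f_def algebra_simps)
  qed (simp add: f_def)
  have hbf: "has_bochner_integral lborel (f m) (of_real (2 * a m ^ 2) * (Gamma (s / 2 + 2) * exp (- (s / 2 + 2) * of_real (ln (a m))))
      - of_real (3 * a m) * (Gamma (s / 2 + 1) * exp (- (s / 2 + 1) * of_real (ln (a m)))))" for m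
    unfolding fsplit e_def
    by (intro has_bochner_integral_diff has_bochner_integral_mult_right has_bochner_integral_Gamma a) (use s in auto)
  have val: "of_real (2 * a m ^ 2) * (Gamma (s / 2 + 2) * exp (- (s / 2 + 2) * of_real (ln (a m))))
      - of_real (3 * a m) * (Gamma (s / 2 + 1) * exp (- (s / 2 + 1) * of_real (ln (a m))))
      = s * (s - 1) / 2 * of_real pi powr (- s / 2) * Gamma (s / 2) * (1 / of_nat (Suc m) powr s)" for m
  proof -
    have ne: "s / 2 \<notin> \<int>\<^sub>\<le>\<^sub>0" "s / 2 + 1 \<notin> \<int>\<^sub>\<le>\<^sub>0"
      using s by (auto elim!: nonpos_Ints_cases simp: complex_eq_iff)
    have G1: "Gamma (s / 2 + 1) = s / 2 * Gamma (s / 2)"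
      by (rule Gamma_plus1 [OF ne(1)])
    have G2: "Gamma (s / 2 + 2) = (s / 2 + 1) * (s / 2) * Gamma (s / 2)"
      using Gamma_plus1 [OF ne(2)] G1 by (simp add: add.assoc)
    have el: "exp (complex_of_real (ln (a m))) = of_real (a m)" using a [of m] by (simp add: exp_of_real)
    have E1: "of_real (a m) * exp (- (s / 2 + 1) * of_real (ln (a m))) = exp (- (s / 2) * of_real (ln (a m)))"
      unfolding el [symmetric] exp_add [symmetric] by (simp add: algebra_simps)
    have E2: "of_real (a m ^ 2) * exp (- (s / 2 + 2) * of_real (ln (a m))) = exp (- (s / 2) * of_real (ln (a m)))"
      unfolding of_real_power el [symmetric] exp_of_nat_mult [symmetric] exp_add [symmetric] by (simp add: algebra_simps)
    have "ln (a m) = ln pi + 2 * ln (real (Suc m))"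
      by (simp add: a_def ln_mult ln_realpow del: of_nat_Suc)
    hence "exp (- (s / 2) * of_real (ln (a m))) = exp (- s / 2 * of_real (ln pi)) * exp (- s * of_real (ln (real (Suc m))))"
      by (simp only: exp_add [symmetric]) (simp add: algebra_simps del: of_nat_Suc)
    also have "exp (- s / 2 * of_real (ln pi)) = of_real pi powr (- s / 2)"
      by (simp add: powr_def Ln_of_real)
    also have "exp (- s * of_real (ln (real (Suc m)))) = 1 / of_nat (Suc m) powr s"
      by (simp add: powr_def Ln_of_nat exp_minus divide_inverse del: of_nat_Suc)
    finally have E: "exp (- (s / 2) * of_real (ln (a m))) = of_real pi powr (- s / 2) * (1 / of_nat (Suc m) powr s)" .
    have "of_real (2 * a m ^ 2) * (Gamma (s / 2 + 2) * exp (- (s / 2 + 2) * of_real (ln (a m))))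
      - of_real (3 * a m) * (Gamma (s / 2 + 1) * exp (- (s / 2 + 1) * of_real (ln (a m))))
      = 2 * Gamma (s / 2 + 2) * (of_real (a m ^ 2) * exp (- (s / 2 + 2) * of_real (ln (a m))))
      - 3 * Gamma (s / 2 + 1) * (of_real (a m) * exp (- (s / 2 + 1) * of_real (ln (a m))))"
      by (simp add: mult_ac)
    also have "\<dots> = (2 * Gamma (s / 2 + 2) - 3 * Gamma (s / 2 + 1)) * exp (- (s / 2) * of_real (ln (a m)))"
      unfolding E1 E2 by (simp add: algebra_simps)
    also have "2 * Gamma (s / 2 + 2) - 3 * Gamma (s / 2 + 1) = s * (s - 1) / 2 * Gamma (s / 2)"
      unfolding G1 G2 by (simp add: field_simps)
    finally show ?thesis unfolding E by (simp add: mult_ac)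
  qed
  \<comment> \<open>The majorant replaces s by its real part and the difference by a sum. Its
    integral is a constant times m powr (- \<sigma>).\<close>
  define g where "g m x = 2 * a m ^ 2 * (indicator {0<..} x * (exp ((\<sigma> / 2 + 2 - 1) * ln x) * exp (- a m * x)))
      + 3 * a m * (indicator {0<..} x * (exp ((\<sigma> / 2 + 1 - 1) * ln x) * exp (- a m * x)))" for m x
  have hbg: "has_bochner_integral lborel (g m) (2 * a m ^ 2 * (Gamma (\<sigma> / 2 + 2) * exp (- (\<sigma> / 2 + 2) * ln (a m)))
      + 3 * a m * (Gamma (\<sigma> / 2 + 1) * exp (- (\<sigma> / 2 + 1) * ln (a m))))" for m
    unfolding g_def
    by (intro has_bochner_integral_add has_bochner_integral_mult_right has_bochner_integral_Gamma_real a) (use \<sigma> in auto)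
  have gval: "2 * a m ^ 2 * (Gamma (\<sigma> / 2 + 2) * exp (- (\<sigma> / 2 + 2) * ln (a m)))
      + 3 * a m * (Gamma (\<sigma> / 2 + 1) * exp (- (\<sigma> / 2 + 1) * ln (a m)))
      = (2 * Gamma (\<sigma> / 2 + 2) + 3 * Gamma (\<sigma> / 2 + 1)) * exp (- (\<sigma> / 2) * ln pi) * real (Suc m) powr (- \<sigma>)" for m
  proof -
    have el: "exp (ln (a m)) = a m" using a [of m] by simp
    have E1: "a m * exp (- (\<sigma> / 2 + 1) * ln (a m)) = exp (- (\<sigma> / 2) * ln (a m))"
      by (subst (1) el [symmetric], unfold exp_add [symmetric]) (simp add: algebra_simps)
    have E2: "a m ^ 2 * exp (- (\<sigma> / 2 + 2) * ln (a m)) = exp (- (\<sigma> / 2) * ln (a m))"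
      by (subst (1) el [symmetric], unfold exp_of_nat_mult [symmetric] exp_add [symmetric]) (simp add: algebra_simps)
    have "ln (a m) = ln pi + 2 * ln (real (Suc m))"
      by (simp add: a_def ln_mult ln_realpow del: of_nat_Suc)
    hence E: "exp (- (\<sigma> / 2) * ln (a m)) = exp (- (\<sigma> / 2) * ln pi) * real (Suc m) powr (- \<sigma>)"
      by (simp add: powr_def exp_add [symmetric] algebra_simps del: of_nat_Suc)
    have "2 * a m ^ 2 * (Gamma (\<sigma> / 2 + 2) * exp (- (\<sigma> / 2 + 2) * ln (a m)))
      + 3 * a m * (Gamma (\<sigma> / 2 + 1) * exp (- (\<sigma> / 2 + 1) * ln (a m))) =
      2 * Gamma (\<sigma> / 2 + 2) * (a m ^ 2 * exp (- (\<sigma> / 2 + 2) * ln (a m)))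
      + 3 * Gamma (\<sigma> / 2 + 1) * (a m * exp (- (\<sigma> / 2 + 1) * ln (a m)))"
      by (simp add: mult_ac)
    also have "\<dots> = (2 * Gamma (\<sigma> / 2 + 2) + 3 * Gamma (\<sigma> / 2 + 1)) * exp (- (\<sigma> / 2) * ln (a m))"
      unfolding E1 E2 by (simp add: algebra_simps)
    finally show ?thesis unfolding E by (simp add: mult_ac)
  qed
  have fg: "norm (f m x) \<le> g m x" for m x
  proof (cases "x > 0")
    case True
    have n: "norm (e w x) = exp (Re w * ln x)" for w by (simp add: e_def)
    have "norm (f m x) \<le> norm (of_real (2 * a m ^ 2) * (indicator {0<..} x *\<^sub>R (e (s / 2 + 2 - 1) x * of_real (exp (- a m * x)))))
      + norm (of_real (3 * a m) * (indicator {0<..} x *\<^sub>R (e (s / 2 + 1 - 1) x * complex_of_real (exp (- a m * x)))))"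
      unfolding fsplit by (rule norm_triangle_ineq4)
    also have "\<dots> = g m x"
      using True a [of m] unfolding g_def norm_mult norm_scaleR n
      by (simp add: \<sigma>_def norm_mult norm_power)
    finally show ?thesis .
  qed (simp add: f_def g_def)
  have "(\<lambda>m. integral\<^sup>L lborel (f m)) sums integral\<^sup>L lborel (\<lambda>x. \<Sum>m. f m x)"
  proof (rule sums_integral)
    show "integrable lborel (f m)" for m using hbf by (rule integrable.intros)
    show "AE x in lborel. summable (\<lambda>m. norm (f m x))"
    proof (intro AE_I2)
      fix x :: real
      show "summable (\<lambda>m. norm (f m x))"
      proof (cases "x > 0")
        case True
        have "summable (\<lambda>m. 2 * pi ^ 2 * exp ((\<sigma> / 2 + 2 - 1) * ln x) * theta_term 4 m x
           + 3 * pi * exp ((\<sigma> / 2 + 1 - 1) * ln x) * theta_term 2 m x)"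
          by (intro summable_add summable_mult summable_theta_tail True)
        also have "(\<lambda>m. 2 * pi ^ 2 * exp ((\<sigma> / 2 + 2 - 1) * ln x) * theta_term 4 m x
           + 3 * pi * exp ((\<sigma> / 2 + 1 - 1) * ln x) * theta_term 2 m x) = (\<lambda>m. g m x)"
          using True by (simp add: g_def a_def power_mult_distrib mult_ac del: of_nat_Suc)
        finally show ?thesis by (rule summable_comparison_test') (use fg in auto)
      qed (simp add: f_def)
    qed
    have "summable (\<lambda>m. real (Suc m) powr (- \<sigma>))"
      using summable_real_powr_iff [of "- \<sigma>"] \<sigma> by (subst summable_Suc_iff) auto
    hence "summable (\<lambda>m. (2 * Gamma (\<sigma> / 2 + 2) + 3 * Gamma (\<sigma> / 2 + 1)) * exp (- (\<sigma> / 2) * ln pi) * real (Suc m) powr (- \<sigma>))"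
      by (rule summable_mult)
    hence "summable (\<lambda>m. integral\<^sup>L lborel (g m))"
      using hbg gval by (simp only: has_bochner_integral_integral_eq [OF hbg])
    thus "summable (\<lambda>m. LINT x|lborel. norm (f m x))"
      by (rule summable_comparison_test')
         (auto intro!: integral_mono fg integrable.intros [OF hbg] integrable_norm integrable.intros [OF hbf])
  qed
  also have "(\<lambda>m. integral\<^sup>L lborel (f m)) = (\<lambda>m. s * (s - 1) / 2 * of_real pi powr (- s / 2) * Gamma (s / 2) * (1 / of_nat (Suc m) powr s))"
    using has_bochner_integral_integral_eq [OF hbf] val by simp
  moreover have "(\<Sum>m. f m x) = indicator {0<..} x *\<^sub>R (e (s / 2 - 1) x * of_real (omega x))" for x
  proof (cases "x > 0")
    case True
    have "(\<lambda>m. 2 * pi ^ 2 * x ^ 2 * theta_term 4 m x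
           - 3 * pi * x * theta_term 2 m x) sums omega x"
      unfolding omega_def theta_tail_def
      by (intro sums_diff sums_mult summable_sums summable_theta_tail True)
    also have "(\<lambda>m. 2 * pi ^ 2 * x ^ 2 * theta_term 4 m x
           - 3 * pi * x * theta_term 2 m x)
       = (\<lambda>m. (2 * a m ^ 2 * x ^ 2 - 3 * a m * x) * exp (- a m * x))"
      by (simp add: a_def power_mult_distrib algebra_simps del: of_nat_Suc)
    finally have "(\<lambda>m. f m x) sums (indicator {0<..} x *\<^sub>R (e (s / 2 - 1) x * of_real (omega x)))"
      unfolding f_def by (intro sums_scaleR_right sums_mult sums_of_real)
    thus ?thesis by (rule sums_unique [symmetric])
  qed (simp add: f_def)
  ultimately show ?thesis unfolding mellin_omega_def set_lebesgue_integral_def e_def by simp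
qed

section \<open>Derivatives of xi at 1/2 as moments\<close>

text \<open>At s = 1 / 2 + z the Mellin factor is exp (z ln x / 2) times x powr (- 3 / 4), so this
  is the coefficient of z^k / k!.\<close>

definition xi_moment :: "nat \<Rightarrow> real" where
  "xi_moment k = (LINT x:{0<..}|lborel. (ln x / 2) ^ k * exp (- (3 / 4) * ln x) * omega x)"

lemma set_integrable_xi_kernel:
  fixes f :: "real \<Rightarrow> 'a :: {real_normed_algebra, banach, second_countable_topology}"
  assumes "continuous_on {0<..} f" and "\<And>x. x > 0 \<Longrightarrow> norm (f x) \<le> B * (exp (A * \<bar>ln x\<bar>) * \<bar>omega x\<bar>)"
    and "B \<ge> 0"
  shows "set_integrable lborel {0<..} f"
proof -
  obtain C where C: "C > 0" "\<And>x. x > 0 \<Longrightarrow> \<bar>omega x\<bar> * exp (A * \<bar>ln x\<bar>) \<le> C * exp (- (x / 4))"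
    using omega_bound [of A] by blast
  show ?thesis
  proof (rule set_integrable_exp_decay [where a = "1 / 4" and C = "B * C"])
    fix x :: real assume x: "x > 0"
    have "norm (f x) \<le> B * (\<bar>omega x\<bar> * exp (A * \<bar>ln x\<bar>))" using assms(2) [OF x] by (simp add: mult.commute)
    also have "\<dots> \<le> B * (C * exp (- (x / 4)))" by (intro mult_left_mono C x assms)
    finally show "norm (f x) \<le> B * C * exp (- (1 / 4) * x)" by simp
  qed (use assms in auto)
qed

lemma set_integrable_xi_moment:
  "set_integrable lborel {0<..} (\<lambda>x. (ln x / 2) ^ k * exp (- (3 / 4) * ln x) * omega x)"
proof (rule set_integrable_xi_kernel)
  show "continuous_on {0<..} (\<lambda>x. (ln x / 2) ^ k * exp (- (3 / 4) * ln x) * omega x)"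
    by (intro continuous_intros continuous_on_omega) auto
  fix x :: real assume "x > 0"
  have "\<bar>ln x / 2\<bar> ^ k \<le> fact k * exp \<bar>ln x / 2\<bar>" by (rule power_le_fact_mult_exp) simp
  moreover have "exp (- (3 / 4) * ln x) \<le> exp (3 / 4 * \<bar>ln x\<bar>)" by simp
  ultimately have "\<bar>ln x / 2\<bar> ^ k * exp (- (3 / 4) * ln x) \<le> (fact k * exp \<bar>ln x / 2\<bar>) * exp (3 / 4 * \<bar>ln x\<bar>)"
    by (intro mult_mono) auto
  also have "\<dots> = fact k * exp (5 / 4 * \<bar>ln x\<bar>)" by (simp add: exp_add [symmetric])
  finally show "norm ((ln x / 2) ^ k * exp (- (3 / 4) * ln x) * omega x) \<le> fact k * (exp (5 / 4 * \<bar>ln x\<bar>) * \<bar>omega x\<bar>)"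
    by (simp add: abs_mult power_abs mult.assoc [symmetric] mult_right_mono)
qed auto

text \<open>The exponential series in z is integrated termwise. All partial sums are dominated by
  exp (norm z * |ln x| / 2) times the weight, which is integrable because omega decays faster than
  any power both at 0 and at infinity. As z is arbitrary, the transform is entire.\<close>

lemma sums_mellin_omega:
  "(\<lambda>k. of_real (xi_moment k / fact k) * z ^ k) sums mellin_omega (1 / 2 + z)"
proof -
  define \<phi> where "\<phi> x = exp (- (3 / 4) * ln x) * omega x" for x
  define t where "t k x = (z * of_real (ln x / 2)) ^ k /\<^sub>R fact k" for k and x :: real
  define s where "s n x = indicator {0<..} x *\<^sub>R ((\<Sum>k<n. t k x) * of_real (\<phi> x))" for n x
  have c\<phi>: "continuous_on {0<..} \<phi>"
    unfolding \<phi>_def by (intro continuous_intros continuous_on_omega) auto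
  have ti: "set_integrable lborel {0<..} (\<lambda>x. t k x * of_real (\<phi> x))"
    "(LINT x:{0<..}|lborel. t k x * of_real (\<phi> x)) = of_real (xi_moment k / fact k) * z ^ k" for k
  proof -
    have "t k x = z ^ k / fact k * of_real ((ln x / 2) ^ k)" for x
      unfolding t_def power_mult_distrib scaleR_conv_of_real by (simp add: field_simps)
    hence eq: "t k x * of_real (\<phi> x) = (z ^ k / fact k) * of_real ((ln x / 2) ^ k * exp (- (3 / 4) * ln x) * omega x)" for x
      by (simp only: \<phi>_def of_real_mult mult.assoc)
    have si: "set_integrable lborel {0<..} (\<lambda>x. complex_of_real ((ln x / 2) ^ k * exp (- (3 / 4) * ln x) * omega x))"
      using set_integrable_xi_moment [of k] unfolding set_integrable_def
      by (subst (asm) complex_of_real_integrable_eq [symmetric]) (simp add: scaleR_conv_of_real)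
    show "set_integrable lborel {0<..} (\<lambda>x. t k x * of_real (\<phi> x))"
      unfolding eq using si by (rule set_integrable_mult_right)
    have "(LINT x:{0<..}|lborel. t k x * of_real (\<phi> x)) =
       (z ^ k / fact k) * (LINT x:{0<..}|lborel. complex_of_real ((ln x / 2) ^ k * exp (- (3 / 4) * ln x) * omega x))"
      unfolding eq by (rule set_integral_mult_right)
    also have "(LINT x:{0<..}|lborel. complex_of_real ((ln x / 2) ^ k * exp (- (3 / 4) * ln x) * omega x)) = of_real (xi_moment k)"
      unfolding xi_moment_def by (rule set_integral_complex_of_real)
    finally show "(LINT x:{0<..}|lborel. t k x * of_real (\<phi> x)) = of_real (xi_moment k / fact k) * z ^ k"
      by simp
  qed
  have s_sum: "s n x = (\<Sum>k<n. indicator {0<..} x *\<^sub>R (t k x * of_real (\<phi> x)))" for n x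
    by (simp add: s_def sum_distrib_right scaleR_sum_right)
  have "(\<lambda>n. integral\<^sup>L lborel (s n)) \<longlonglongrightarrow> integral\<^sup>L lborel (\<lambda>x. indicator {0<..} x *\<^sub>R (exp (z * of_real (ln x / 2)) * of_real (\<phi> x)))"
  proof (rule integral_dominated_convergence)
    define w where "w x = indicator {0<..} x * (exp (norm z * \<bar>ln x / 2\<bar>) * \<bar>\<phi> x\<bar>)" for x
    have "set_integrable lborel {0<..} (\<lambda>x. exp (norm z * \<bar>ln x / 2\<bar>) * \<bar>\<phi> x\<bar>)"
    proof (rule set_integrable_xi_kernel)
      show "continuous_on {0<..} (\<lambda>x. exp (norm z * \<bar>ln x / 2\<bar>) * \<bar>\<phi> x\<bar>)"
        by (intro continuous_intros c\<phi>) auto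
      fix x :: real assume "x > 0"
      have "\<bar>\<phi> x\<bar> \<le> exp (3 / 4 * \<bar>ln x\<bar>) * \<bar>omega x\<bar>"
        by (auto simp: \<phi>_def abs_mult intro!: mult_right_mono)
      hence "exp (norm z * \<bar>ln x / 2\<bar>) * \<bar>\<phi> x\<bar> \<le> exp (norm z * \<bar>ln x / 2\<bar>) * (exp (3 / 4 * \<bar>ln x\<bar>) * \<bar>omega x\<bar>)"
        by (intro mult_left_mono) auto
      also have "\<dots> = 1 * (exp ((norm z / 2 + 3 / 4) * \<bar>ln x\<bar>) * \<bar>omega x\<bar>)"
        unfolding mult.assoc [symmetric] exp_add [symmetric] by (simp add: algebra_simps)
      finally show "norm (exp (norm z * \<bar>ln x / 2\<bar>) * \<bar>\<phi> x\<bar>) \<le> 1 * (exp ((norm z / 2 + 3 / 4) * \<bar>ln x\<bar>) * \<bar>omega x\<bar>)"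
        by simp
    qed auto
    thus "integrable lborel w" by (simp add: set_integrable_def w_def [abs_def])
    show "s n \<in> borel_measurable lborel" for n
      unfolding s_sum [abs_def] using ti(1)
      by (intro borel_measurable_sum borel_measurable_integrable) (simp add: set_integrable_def)
    have "continuous_on {0<..} (\<lambda>x. exp (z * of_real (ln x / 2)) * complex_of_real (\<phi> x))"
      by (intro continuous_intros c\<phi>) auto
    hence "(\<lambda>x. exp (z * of_real (ln x / 2)) * complex_of_real (\<phi> x)) \<in> borel_measurable (restrict_space borel {0<..})"
      by (rule borel_measurable_continuous_on_restrict)
    thus "(\<lambda>x. indicator {0<..} x *\<^sub>R (exp (z * of_real (ln x / 2)) * complex_of_real (\<phi> x))) \<in> borel_measurable lborel"
      by (simp add: borel_measurable_restrict_space_iff)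
    show "AE x in lborel. (\<lambda>n. s n x) \<longlonglongrightarrow> indicator {0<..} x *\<^sub>R (exp (z * of_real (ln x / 2)) * of_real (\<phi> x))"
    proof (intro AE_I2)
      fix x :: real
      have "(\<lambda>k. t k x) sums exp (z * of_real (ln x / 2))"
        unfolding t_def by (rule exp_converges)
      thus "(\<lambda>n. s n x) \<longlonglongrightarrow> indicator {0<..} x *\<^sub>R (exp (z * of_real (ln x / 2)) * of_real (\<phi> x))"
        unfolding s_def sums_def by (intro tendsto_intros)
    qed
    show "AE x in lborel. norm (s n x) \<le> w x" for n
    proof (intro AE_I2)
      fix x :: real
      define y where "y = norm z * \<bar>ln x / 2\<bar>"
      have "norm (\<Sum>k<n. t k x) \<le> (\<Sum>k<n. y ^ k /\<^sub>R fact k)"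
        by (rule order.trans [OF norm_sum]) (simp add: t_def y_def norm_mult norm_power)
      also have "\<dots> \<le> exp y"
        using exp_converges [of y] by (intro sum_le_suminf [of "\<lambda>k. y ^ k /\<^sub>R fact k", unfolded sums_unique [OF exp_converges, symmetric]]) (auto simp: sums_iff y_def)
      finally show "norm (s n x) \<le> w x"
        unfolding s_def w_def y_def [symmetric] norm_scaleR norm_mult
        by (auto simp: indicator_def intro!: mult_right_mono)
    qed
  qed
  moreover have "integral\<^sup>L lborel (s n) = (\<Sum>k<n. of_real (xi_moment k / fact k) * z ^ k)" for n
  proof -
    have "integral\<^sup>L lborel (s n) = (\<Sum>k<n. (LINT x:{0<..}|lborel. t k x * of_real (\<phi> x)))"
      unfolding s_sum [abs_def] set_lebesgue_integral_def using ti(1)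
      by (intro Bochner_Integration.integral_sum) (simp add: set_integrable_def)
    thus ?thesis using ti by simp
  qed
  moreover have "(\<lambda>x. indicator {0<..} x *\<^sub>R (exp (z * of_real (ln x / 2)) * of_real (\<phi> x))) =
      (\<lambda>x. indicator {0<..} x *\<^sub>R (exp (((1 / 2 + z) / 2 - 1) * of_real (ln x)) * complex_of_real (omega x)))"
  proof
    fix x :: real
    have "exp (z * of_real (ln x / 2)) * of_real (\<phi> x) = (exp (z * of_real (ln x / 2)) * exp (of_real (- (3 / 4) * ln x))) * complex_of_real (omega x)"
      unfolding \<phi>_def exp_of_real by (simp only: of_real_mult mult.assoc)
    also have "exp (z * of_real (ln x / 2)) * exp (complex_of_real (- (3 / 4) * ln x)) = exp (((1 / 2 + z) / 2 - 1) * of_real (ln x))"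
      unfolding exp_add [symmetric] by (simp add: field_simps)
    finally show "indicator {0<..} x *\<^sub>R (exp (z * of_real (ln x / 2)) * of_real (\<phi> x)) =
      indicator {0<..} x *\<^sub>R (exp (((1 / 2 + z) / 2 - 1) * of_real (ln x)) * complex_of_real (omega x))" by simp
  qed
  ultimately show ?thesis
    unfolding sums_def mellin_omega_def set_lebesgue_integral_def by simp
qed

definition xi_fps :: "complex fps" where
  "xi_fps = Abs_fps (\<lambda>k. of_real (xi_moment k / fact k))"

lemma eval_xi_fps: "eval_fps xi_fps z = mellin_omega (1 / 2 + z)"
  using sums_mellin_omega [of z] by (simp add: eval_fps_def xi_fps_def sums_iff)

lemma fps_conv_radius_xi_fps: "fps_conv_radius xi_fps = \<infinity>"
  unfolding fps_conv_radius_def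
proof (rule conv_radius_inftyI'')
  show "summable (\<lambda>n. fps_nth xi_fps n * z ^ n)" for z
    using sums_mellin_omega [of z] by (simp add: xi_fps_def sums_iff)
qed

lemma holomorphic_mellin_omega: "mellin_omega holomorphic_on A"
proof -
  have "eval_fps xi_fps \<circ> (\<lambda>s. s - 1 / 2) holomorphic_on A"
    by (rule holomorphic_on_compose_gen [where t = UNIV])
       (auto intro!: holomorphic_intros simp: fps_conv_radius_xi_fps)
  thus ?thesis by (simp add: o_def eval_xi_fps)
qed

lemma rGamma_half_plus1:
  assumes "Re s > 0"
  shows "rGamma (s / 2 + 1) = 1 / (s / 2 * Gamma (s / 2))"
proof -
  have "s / 2 * rGamma (s / 2 + 1) = inverse (Gamma (s / 2))"
    using rGamma_plus1 [of "s / 2"] by (simp only: rGamma_inverse_Gamma)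
  moreover have "s / 2 \<noteq> 0" using assms by auto
  moreover have "R = 1 / (a * G)" if "a * R = inverse G" "a \<noteq> 0" for a R G :: complex
  proof -
    have "inverse a * (a * R) = R" using that(2) by simp
    thus ?thesis unfolding that(1) by (simp add: divide_inverse)
  qed
  ultimately show ?thesis by blast
qed

text \<open>Existence and uniqueness for the definite description at once. The entire function
  \<open>rGamma (s / 2 + 1)\<close> takes the place of 1 / (s / 2 * Gamma (s / 2)), so that the
  candidate is holomorphic at 0, -2, -4, ... too. Uniqueness is analytic continuation from the
  half-plane Re s > 1 through the connected punctured plane.\<close>

lemma riemann_zeta_eq:
  "riemann_zeta = (\<lambda>s. if s = 1 then 0 else
     mellin_omega s * of_real pi powr (s / 2) * rGamma (s / 2 + 1) / (s - 1))" (is "_ = ?Z")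
  unfolding riemann_zeta_def
proof (rule the_equality)
  have "?Z holomorphic_on - {1} \<longleftrightarrow> (\<lambda>s. mellin_omega s * of_real pi powr (s / 2) * rGamma (s / 2 + 1) / (s - 1)) holomorphic_on - {1}"
    by (rule holomorphic_cong) auto
  also have "\<dots>" by (intro holomorphic_intros holomorphic_mellin_omega) auto
  finally have Zh: "?Z holomorphic_on - {1}" .
  have Zs: "(\<lambda>n. 1 / of_nat (Suc n) powr s) sums ?Z s" if s: "Re s > 1" for s
  proof -
    have ne: "s \<noteq> 0" "s \<noteq> 1" "s / 2 \<notin> \<int>\<^sub>\<le>\<^sub>0" using s by (auto elim!: nonpos_Ints_cases simp: complex_eq_iff)
    define c where "c = s * (s - 1) / 2 * of_real pi powr (- s / 2) * Gamma (s / 2)"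
    have "c \<noteq> 0" using ne by (simp add: c_def Gamma_eq_zero_iff)
    have "(\<lambda>n. c * (1 / of_nat (Suc n) powr s) / c) sums (mellin_omega s / c)"
      using mellin_omega_eq [OF s] unfolding c_def [symmetric] by (rule sums_divide)
    moreover have "mellin_omega s / c = ?Z s"
    proof -
      have "?Z s = mellin_omega s * of_real pi powr (s / 2) * (1 / (s / 2 * Gamma (s / 2))) / (s - 1)"
        using ne s rGamma_half_plus1 [of s] by simp
      thus ?thesis using ne \<open>c \<noteq> 0\<close> by (simp add: c_def powr_minus field_simps)
    qed
    ultimately show ?thesis using \<open>c \<noteq> 0\<close> by simp
  qed
  show "?Z holomorphic_on - {1} \<and> (\<forall>s. 1 < Re s \<longrightarrow> (\<lambda>n. 1 / of_nat (Suc n) powr s) sums ?Z s) \<and> ?Z 1 = 0"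
    using Zh Zs by simp
  fix f :: "complex \<Rightarrow> complex"
  assume f: "f holomorphic_on - {1} \<and> (\<forall>s. 1 < Re s \<longrightarrow> (\<lambda>n. 1 / of_nat (Suc n) powr s) sums f s) \<and> f 1 = 0"
  show "f = ?Z"
  proof
    fix s
    show "f s = ?Z s"
    proof (cases "s = 1")
      case False
      show ?thesis
      proof (rule analytic_continuation_open [of "{s. Re s > 1}" "- {1}" f ?Z s])
        show "open {s. Re s > 1}" by (rule open_halfspace_Re_gt)
        show "{s. Re s > 1} \<noteq> {}" by (auto intro!: exI [of _ 2])
        show "connected (- {1 :: complex})" by (rule connected_punctured_universe) simp
        show "f z = ?Z z" if "z \<in> {s. Re s > 1}" for z
          using f Zs [of z] that sums_unique2 by blast
      qed (use f Zh False in auto)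
    qed (use f in simp)
  qed
qed

lemma riemann_xi_eq_mellin_omega:
  assumes "Re s > 0" "s \<noteq> 1"
  shows "riemann_xi s = mellin_omega s"
proof -
  have ne: "s \<noteq> 0" "s / 2 \<notin> \<int>\<^sub>\<le>\<^sub>0" using assms by (auto elim!: nonpos_Ints_cases simp: complex_eq_iff)
  hence "Gamma (s / 2) \<noteq> 0" by (simp add: Gamma_eq_zero_iff)
  moreover have "riemann_zeta s = mellin_omega s * of_real pi powr (s / 2) * (1 / (s / 2 * Gamma (s / 2))) / (s - 1)"
    using assms rGamma_half_plus1 [of s] by (simp add: riemann_zeta_eq)
  ultimately show ?thesis using ne assms
    by (simp add: riemann_xi_def powr_minus field_simps)
qed

theorem higher_deriv_riemann_xi: "(deriv ^^ n) riemann_xi (1 / 2) = of_real (xi_moment n)"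
proof -
  \<comment> \<open>Radius 1 / 2 keeps 1 / 2 + z in the right half-plane and away from 1, where the
    formula for xi is not subject to conventions.\<close>
  have "\<forall>\<^sub>F z in nhds (0 :: complex). z \<in> ball 0 (1 / 2)"
    by (rule eventually_nhds_in_open) auto
  hence "\<forall>\<^sub>F z in nhds 0. (riemann_xi \<circ> (+) (1 / 2)) z = eval_fps xi_fps z"
  proof eventually_elim
    case (elim z)
    hence "norm z < 1 / 2" by simp
    hence "\<bar>Re z\<bar> < 1 / 2" using abs_Re_le_cmod [of z] by linarith
    hence "Re (1 / 2 + z) > 0" "1 / 2 + z \<noteq> 1" by (auto simp: complex_eq_iff)
    thus ?case by (simp add: riemann_xi_eq_mellin_omega eval_xi_fps)
  qed
  hence "(deriv ^^ n) (riemann_xi \<circ> (+) (1 / 2)) 0 = (deriv ^^ n) (eval_fps xi_fps) 0"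
    by (rule higher_deriv_cong_ev) simp
  also have "\<dots> = fact n * fps_nth xi_fps n"
    using fps_nth_conv_deriv [of xi_fps n] by (simp add: fps_conv_radius_xi_fps)
  finally show ?thesis
    by (subst higher_deriv_shift_0) (simp add: xi_fps_def)
qed

section \<open>Splitting off the first term of the theta series\<close>

text \<open>Under x -> 1 / x the even power of the logarithm is invariant, and the exponents 3 / 4
  from the weight, 1 / 2 from omega and - 2 from the Jacobian add up to - 3 / 4 again. The two
  halves of the integral are therefore equal.\<close>

lemma xi_moment_even_eq:
  assumes n: "n \<ge> 1"
  shows "xi_moment (2 * n) = 2 * (LINT x:{1<..}|lborel. (ln x / 2) ^ (2 * n) * exp (- (3 / 4) * ln x) * omega x)"
proof -
  define f where "f x = (ln x / 2) ^ (2 * n) * exp (- (3 / 4) * ln x) * omega x" for x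
  have f: "set_integrable lborel {0<..} f"
    unfolding f_def by (rule set_integrable_xi_moment)
  have fsub: "set_integrable lborel A f" if "A \<in> sets borel" "A \<subseteq> {0<..}" for A
    using set_integrable_subset [OF f] that by auto
  have sym: "\<bar>- (1 / x ^ 2)\<bar> * f (1 / x) = f x" if "x \<in> {1<..}" for x
  proof -
    have x: "x > 0" using that by simp
    have "exp (3 / 4 * ln x) = exp (- (3 / 4) * ln x) * exp (3 / 2 * ln x)"
      by (simp add: exp_add [symmetric])
    also have "exp (3 / 2 * ln x) = x * sqrt x"
    proof -
      have "exp (3 / 2 * ln x) = exp (ln x) * exp (ln x / 2)" by (simp add: exp_add [symmetric])
      also have "exp (ln x / 2) = sqrt x" using x by (simp add: powr_half_sqrt [symmetric] powr_def)
      finally show ?thesis using x by simp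
    qed
    finally have e: "exp (3 / 4 * ln x) = exp (- (3 / 4) * ln x) * (x * sqrt x)" .
    have o: "omega (1 / x) = sqrt x * omega x"
      using omega_functional_equation [OF x] x by (simp add: field_simps)
    have "f (1 / x) = (ln x / 2) ^ (2 * n) * exp (3 / 4 * ln x) * (sqrt x * omega x)"
      using x by (simp add: f_def o ln_div)
    also have "\<dots> = f x * (x * (sqrt x * sqrt x))"
      unfolding e f_def by (simp add: mult_ac)
    also have "\<dots> = f x * x ^ 2" using x by (simp add: power2_eq_square)
    finally show ?thesis using x by simp
  qed
  have im: "(\<lambda>x. 1 / x) ` {1<..} = {0<..<1 :: real}"
  proof
    show "{0<..<1 :: real} \<subseteq> (\<lambda>x. 1 / x) ` {1<..}"
    proof
      fix y :: real assume "y \<in> {0<..<1}"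
      thus "y \<in> (\<lambda>x. 1 / x) ` {1<..}" by (intro image_eqI [of _ _ "1 / y"]) auto
    qed
  qed auto
  have cov: "(\<lambda>x. \<bar>- (1 / x ^ 2)\<bar> * f (1 / x)) absolutely_integrable_on {1<..} \<and>
        integral {1<..} (\<lambda>x. \<bar>- (1 / x ^ 2)\<bar> * f (1 / x)) = integral {0<..<1} f
     \<longleftrightarrow> f absolutely_integrable_on ((\<lambda>x. 1 / x) ` {1<..}) \<and> integral ((\<lambda>x. 1 / x) ` {1<..}) f = integral {0<..<1} f"
    by (rule has_absolute_integral_change_of_variables_1')
       (auto intro!: derivative_eq_intros inj_onI simp: power2_eq_square)
  have sub: "{0<..<1 :: real} \<subseteq> {0<..}" by auto
  have "integrable lborel (\<lambda>x. indicator {0<..<1} x *\<^sub>R f x)"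
    using fsub [of "{0<..<1}"] sub by (auto simp: set_integrable_def)
  hence "f absolutely_integrable_on {0<..<1}"
    unfolding set_integrable_def using integrable_completion borel_measurable_integrable by blast
  hence "integral {1<..} (\<lambda>x. \<bar>- (1 / x ^ 2)\<bar> * f (1 / x)) = integral {0<..<1} f"
    using cov unfolding im by simp
  also have "integral {1<..} (\<lambda>x. \<bar>- (1 / x ^ 2)\<bar> * f (1 / x)) = integral {1<..} f"
    by (rule Henstock_Kurzweil_Integration.integral_cong) (rule sym)
  finally have ie: "(LINT x:{0<..<1}|lborel. f x) = (LINT x:{1<..}|lborel. f x)"
    using set_borel_integral_eq_integral(2) [OF fsub, of "{0<..<1}"]
      set_borel_integral_eq_integral(2) [OF fsub, of "{1<..}"] sub by auto
  have "(LINT x:{0<..}|lborel. f x) = (LINT x:{0<..<1} \<union> {1..}|lborel. f x)"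
    by (rule arg_cong [where f = "\<lambda>A. set_lebesgue_integral lborel A f"]) auto
  also have "\<dots> = (LINT x:{0<..<1}|lborel. f x) + (LINT x:{1..}|lborel. f x)"
    by (rule set_integral_Un) (auto intro!: fsub)
  \<comment> \<open>The integrands agree even at the endpoint: ln 1 = 0, and its exponent 2 n is
    positive.\<close>
  also have "(LINT x:{1..}|lborel. f x) = (LINT x:{1<..}|lborel. f x)"
    unfolding set_lebesgue_integral_def
    by (rule Bochner_Integration.integral_cong) (use n in \<open>auto simp: indicator_def f_def\<close>)
  finally have "(LINT x:{0<..}|lborel. f x) = 2 * (LINT x:{1<..}|lborel. f x)" unfolding ie by simp
  thus ?thesis unfolding xi_moment_def f_def .
qed

text \<open>The remaining terms decay at least like exp (- 4 pi x). One of the four units is split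
  up: part evaluates the series at 1 / 8 and makes it converge, and part leaves exp (- x / 8), which
  later absorbs the powers x and x^2 in omega.\<close>

lemma theta_tail_minus_first:
  assumes x: "x \<ge> 1"
  shows "\<bar>theta_tail k x - exp (- pi * x)\<bar> \<le> theta_tail k (1 / 8) * exp (- 3 * pi * x) * exp (- (1 / 8) * x)"
proof -
  define f where "f m t = theta_term k m t" for m t
  have sf: "summable (\<lambda>m. f m t)" if "t > 0" for t unfolding f_def by (rule summable_theta_tail [OF that])
  have sS: "summable (\<lambda>m. f (Suc m) t)" if "t > 0" for t
    using summable_Suc_iff [of "\<lambda>m. f m t"] sf [OF that] by simp
  have nn: "f m t \<ge> 0" for m t by (simp add: f_def)
  have "theta_tail k x - exp (- pi * x) = (\<Sum>m. f (Suc m) x)"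
    using suminf_split_head [OF sf [of x]] x by (simp add: theta_tail_def f_def)
  moreover have "0 \<le> (\<Sum>m. f (Suc m) x)" using sS x nn by (intro suminf_nonneg) auto
  moreover have "(\<Sum>m. f (Suc m) x) \<le> (\<Sum>m. f (Suc m) (1 / 8) * (exp (- 3 * pi * x) * exp (- (1 / 8) * x)))"
  proof (rule suminf_le)
    fix m
    define q where "q = real (Suc (Suc m)) ^ 2"
    have q: "q \<ge> 4" using power_mono [of 2 "real (Suc (Suc m))" 2] by (simp add: q_def)
    have "4 * x \<le> q * x" "4 * (x - 1) \<le> q * (x - 1)" using q x by (intro mult_right_mono; simp)+
    hence "3 * x + x / 8 + q / 8 \<le> q * x" using q x by argo
    moreover have "x / 8 \<le> pi * (x / 8)" using x pi_gt3 by simp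
    ultimately have "pi * (3 * x + x / 8 + q / 8) \<le> pi * (q * x)" "x / 8 \<le> pi * (x / 8)"
      by (auto intro: mult_left_mono)
    hence "- pi * q * x \<le> - pi * q * (1 / 8) + (- 3 * pi * x + (- (1 / 8) * x))"
      by (simp add: algebra_simps)
    hence "exp (- pi * q * x) \<le> exp (- pi * q * (1 / 8)) * (exp (- 3 * pi * x) * exp (- (1 / 8) * x))"
      by (simp only: exp_add [symmetric] exp_le_cancel_iff)
    thus "f (Suc m) x \<le> f (Suc m) (1 / 8) * (exp (- 3 * pi * x) * exp (- (1 / 8) * x))"
      unfolding f_def q_def mult.assoc by (intro mult_left_mono) auto
  qed (use sS x in \<open>auto intro!: summable_mult2\<close>)
  moreover have "(\<Sum>m. f (Suc m) (1 / 8) * (exp (- 3 * pi * x) * exp (- (1 / 8) * x))) = (\<Sum>m. f (Suc m) (1 / 8)) * (exp (- 3 * pi * x) * exp (- (1 / 8) * x))"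
    by (rule suminf_mult2 [symmetric]) (use sS in auto)
  moreover have "(\<Sum>m. f (Suc m) (1 / 8)) \<le> theta_tail k (1 / 8)"
    using suminf_split_head [OF sf [of "1 / 8"]] nn [of 0 "1 / 8"] by (simp add: theta_tail_def f_def)
  hence "(\<Sum>m. f (Suc m) (1 / 8)) * (exp (- 3 * pi * x) * exp (- (1 / 8) * x)) \<le> theta_tail k (1 / 8) * (exp (- 3 * pi * x) * exp (- (1 / 8) * x))"
    by (intro mult_right_mono) auto
  ultimately show ?thesis unfolding mult.assoc by linarith
qed

text \<open>What is subtracted is the m = 1 term of omega; only that term has the decay rate exp (-
  pi x).\<close>

definition omega_rest :: "real \<Rightarrow> real" where
  "omega_rest x = omega x - (2 * pi\<^sup>2 * x\<^sup>2 - 3 * pi * x) * exp (- pi * x)"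

lemma omega_rest_bound:
  obtains C where "C > 0" "\<And>x. x \<ge> 1 \<Longrightarrow> \<bar>omega_rest x\<bar> \<le> C * exp (- 3 * pi * x)"
proof -
  define C where "C = 2 * pi\<^sup>2 * theta_tail 4 (1 / 8) * (fact 2 * 16 ^ 2) + 3 * pi * theta_tail 2 (1 / 8) * (fact 1 * 16 ^ 1) + 1"
  have nn: "theta_tail k (1 / 8) \<ge> 0" for k by (rule theta_tail_nonneg) simp
  have C: "C > 0" unfolding C_def using nn by (intro add_nonneg_pos add_nonneg_nonneg mult_nonneg_nonneg) auto
  have "\<bar>omega_rest x\<bar> \<le> C * exp (- 3 * pi * x)" if x: "x \<ge> 1" for x
  proof -
    have t: "x ^ j * \<bar>theta_tail k x - exp (- pi * x)\<bar> \<le> theta_tail k (1 / 8) * (fact j * 16 ^ j) * exp (- 3 * pi * x)" for j k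
    proof -
      have "x ^ j * \<bar>theta_tail k x - exp (- pi * x)\<bar> \<le> x ^ j * (theta_tail k (1 / 8) * exp (- 3 * pi * x) * exp (- (1 / 8) * x))"
        using x by (intro mult_left_mono theta_tail_minus_first) auto
      also have "\<dots> = theta_tail k (1 / 8) * exp (- 3 * pi * x) * (x ^ j * exp (- (1 / 8) * x))" by simp
      also have "\<dots> \<le> theta_tail k (1 / 8) * exp (- 3 * pi * x) * (fact j * (2 / (1 / 8)) ^ j * exp (- (1 / 8 / 2) * x))"
        using x nn by (intro mult_left_mono power_mult_exp_le) auto
      also have "\<dots> \<le> theta_tail k (1 / 8) * exp (- 3 * pi * x) * (fact j * (2 / (1 / 8)) ^ j * 1)"
        using x nn by (intro mult_left_mono) auto
      finally show ?thesis by (simp add: mult_ac)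
    qed
    have "omega_rest x = 2 * pi\<^sup>2 * (x ^ 2 * (theta_tail 4 x - exp (- pi * x))) - 3 * pi * (x ^ 1 * (theta_tail 2 x - exp (- pi * x)))"
      unfolding omega_rest_def omega_def by (simp add: algebra_simps)
    also have "\<bar>\<dots>\<bar> \<le> 2 * pi\<^sup>2 * (x ^ 2 * \<bar>theta_tail 4 x - exp (- pi * x)\<bar>) + 3 * pi * (x ^ 1 * \<bar>theta_tail 2 x - exp (- pi * x)\<bar>)"
      using x by (intro order.trans [OF abs_triangle_ineq4]) (auto simp: abs_mult)
    also have "\<dots> \<le> 2 * pi\<^sup>2 * (theta_tail 4 (1 / 8) * (fact 2 * 16 ^ 2) * exp (- 3 * pi * x)) + 3 * pi * (theta_tail 2 (1 / 8) * (fact 1 * 16 ^ 1) * exp (- 3 * pi * x))"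
      by (intro add_mono mult_left_mono t) auto
    also have "\<dots> \<le> C * exp (- 3 * pi * x)"
      by (simp add: C_def algebra_simps)
    finally show ?thesis .
  qed
  thus ?thesis using that C by blast
qed

text \<open>Needed for \<beta> = 2 - 3 / 4 and \<beta> = 1 - 3 / 4, the exponents of x in the first
  term of omega times the weight.\<close>

definition saddle_integral :: "nat \<Rightarrow> real \<Rightarrow> real" where
  "saddle_integral n \<beta> = (LINT x:{1<..}|lborel. ln x ^ (2 * n) * exp (\<beta> * ln x) * exp (- pi * x))"

lemma set_integrable_saddle:
  "set_integrable lborel {1<..} (\<lambda>x. ln x ^ k * exp (\<beta> * ln x) * exp (- pi * x))"
proof -
  \<comment> \<open>Freezing the logarithm below 1 gives a continuous function on the whole
    half-line, without a singularity at 0, that agrees with the integrand for x > 1.\<close>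
  define g where "g x = ln (max x 1) ^ k * exp (\<beta> * ln (max x 1)) * exp (- pi * x)" for x
  obtain j :: nat where j: "real j \<ge> \<beta> + 1" using real_arch_simple by blast
  have "set_integrable lborel {0<..} g"
  proof (rule set_integrable_exp_decay [where a = "pi / 2" and C = "fact k * (fact j * (2 / pi) ^ j * exp pi)"])
    show "continuous_on {0<..} g" unfolding g_def
      by (intro continuous_intros) auto
    fix x :: real assume x: "x > 0"
    define m where "m = max x 1"
    have m: "m \<ge> 1" "m \<ge> x" "m \<le> x + 1" using x by (auto simp: m_def)
    have "\<bar>ln m\<bar> = ln m" using m by simp
    hence "exp \<bar>ln m\<bar> * exp (\<beta> * ln m) = exp ((\<beta> + 1) * ln m)"
      by (simp only: exp_add [symmetric]) (simp add: algebra_simps)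
    also have "\<dots> \<le> exp (real j * ln m)" using j m by (simp add: mult_right_mono)
    also have "\<dots> = m ^ j" using m by (simp add: exp_of_nat_mult)
    finally have e: "exp \<bar>ln m\<bar> * exp (\<beta> * ln m) \<le> m ^ j" .
    have "norm (g x) = \<bar>ln m\<bar> ^ k * exp (\<beta> * ln m) * exp (- pi * x)"
      by (simp add: g_def m_def abs_mult power_abs)
    also have "\<dots> \<le> (fact k * exp \<bar>ln m\<bar>) * exp (\<beta> * ln m) * exp (- pi * x)"
      by (intro mult_right_mono power_le_fact_mult_exp) auto
    also have "\<dots> = fact k * ((exp \<bar>ln m\<bar> * exp (\<beta> * ln m)) * exp (- pi * x))" by simp
    also have "\<dots> \<le> fact k * (m ^ j * (exp (- pi * m) * exp pi))"
    proof (intro mult_left_mono mult_mono e)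
      have "pi * m \<le> pi * (x + 1)" using m by (intro mult_left_mono) auto
      hence "- pi * x \<le> - pi * m + pi" by (simp add: algebra_simps)
      thus "exp (- pi * x) \<le> exp (- pi * m) * exp pi" by (simp add: exp_add [symmetric])
    qed (use m in auto)
    also have "\<dots> = fact k * exp pi * (m ^ j * exp (- pi * m))" by simp
    also have "\<dots> \<le> fact k * exp pi * (fact j * (2 / pi) ^ j * exp (- (pi / 2) * m))"
      using m by (intro mult_left_mono power_mult_exp_le) auto
    also have "\<dots> \<le> fact k * exp pi * (fact j * (2 / pi) ^ j * exp (- (pi / 2) * x))"
      using m by (intro mult_left_mono) auto
    finally show "norm (g x) \<le> fact k * (fact j * (2 / pi) ^ j * exp pi) * exp (- (pi / 2) * x)"
      by (simp add: mult_ac)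
  qed auto
  hence "set_integrable lborel {1<..} g" by (rule set_integrable_subset) auto
  moreover have "set_integrable lborel {1<..} g = set_integrable lborel {1<..} (\<lambda>x. ln x ^ k * exp (\<beta> * ln x) * exp (- pi * x))"
    by (rule set_integrable_cong) (auto simp: g_def max_def)
  ultimately show "set_integrable lborel {1<..} (\<lambda>x. ln x ^ k * exp (\<beta> * ln x) * exp (- pi * x))" by simp
qed

abbreviation rest_integral :: "nat \<Rightarrow> real" where
  "rest_integral n \<equiv> LINT x:{1<..}|lborel. ln x ^ (2 * n) * exp (- (3 / 4) * ln x) * omega_rest x"

text \<open>The factor 2 comes from folding the integral at 1 and 4 ^ n from the halved logarithm in
  \<open>xi_moment\<close>.\<close>

lemma xi_moment_decomp:
  assumes n: "n \<ge> 1"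
  defines "R \<equiv> (\<lambda>x. ln x ^ (2 * n) * exp (- (3 / 4) * ln x) * omega_rest x)"
  shows "set_integrable lborel {1<..} R"
    and "xi_moment (2 * n) = 2 / 4 ^ n * (2 * pi\<^sup>2 * saddle_integral n (5 / 4) - 3 * pi * saddle_integral n (1 / 4)
           + (LINT x:{1<..}|lborel. R x))"
proof -
  define A where "A \<beta> x = ln x ^ (2 * n) * exp (\<beta> * ln x) * exp (- pi * x)" for \<beta> x
  define f where "f x = (ln x / 2) ^ (2 * n) * exp (- (3 / 4) * ln x) * omega x" for x
  have A: "set_integrable lborel {1<..} (A \<beta>)" for \<beta>
    unfolding A_def by (rule set_integrable_saddle)
  have f: "set_integrable lborel {1<..} f"
    unfolding f_def by (rule set_integrable_subset [OF set_integrable_xi_moment]) auto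
  have eq: "R x = 4 ^ n * f x - (2 * pi\<^sup>2 * A (5 / 4) x - 3 * pi * A (1 / 4) x)" if "x \<in> {1<..}" for x
  proof -
    have x: "x > 0" using that by simp
    have e: "exp (5 / 4 * ln x) = exp (- (3 / 4) * ln x) * x ^ 2" "exp (1 / 4 * ln x) = exp (- (3 / 4) * ln x) * x"
    proof -
      have "exp (5 / 4 * ln x) = exp (- (3 / 4) * ln x) * exp (2 * ln x)"
        "exp (1 / 4 * ln x) = exp (- (3 / 4) * ln x) * exp (ln x)"
        by (simp_all add: exp_add [symmetric])
      moreover have "exp (ln x) = x" "exp (2 * ln x) = x ^ 2"
        using x exp_of_nat_mult [of 2 "ln x"] by simp_all
      ultimately show "exp (5 / 4 * ln x) = exp (- (3 / 4) * ln x) * x ^ 2" "exp (1 / 4 * ln x) = exp (- (3 / 4) * ln x) * x"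
        by simp_all
    qed
    have "4 ^ n * f x = ln x ^ (2 * n) * exp (- (3 / 4) * ln x) * omega x"
      by (simp add: f_def power_divide power_mult)
    moreover have "R x = ln x ^ (2 * n) * exp (- (3 / 4) * ln x) * omega x - ln x ^ (2 * n) * exp (- (3 / 4) * ln x) * ((2 * pi\<^sup>2 * x\<^sup>2 - 3 * pi * x) * exp (- pi * x))"
      unfolding R_def omega_rest_def by (rule right_diff_distrib)
    moreover have "2 * pi\<^sup>2 * A (5 / 4) x - 3 * pi * A (1 / 4) x = ln x ^ (2 * n) * exp (- (3 / 4) * ln x) * ((2 * pi\<^sup>2 * x\<^sup>2 - 3 * pi * x) * exp (- pi * x))"
      unfolding A_def e by (simp add: algebra_simps)
    ultimately show ?thesis by simp
  qed
  have rhs: "set_integrable lborel {1<..} (\<lambda>x. 4 ^ n * f x - (2 * pi\<^sup>2 * A (5 / 4) x - 3 * pi * A (1 / 4) x))"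
    by (intro set_integral_diff set_integrable_mult_right A f)
  show "set_integrable lborel {1<..} R"
    using rhs by (subst set_integrable_cong [OF refl refl eq])
  have "(LINT x:{1<..}|lborel. R x) = (LINT x:{1<..}|lborel. 4 ^ n * f x - (2 * pi\<^sup>2 * A (5 / 4) x - 3 * pi * A (1 / 4) x))"
    by (rule set_lebesgue_integral_cong) (use eq in auto)
  also have "\<dots> = 4 ^ n * (LINT x:{1<..}|lborel. f x) - (2 * pi\<^sup>2 * saddle_integral n (5 / 4) - 3 * pi * saddle_integral n (1 / 4))"
    unfolding saddle_integral_def A_def [symmetric]
    by (simp add: set_integral_diff(2) set_integrable_mult_right A f)
  finally have *: "(LINT x:{1<..}|lborel. R x) = 4 ^ n * (LINT x:{1<..}|lborel. f x)
      - (2 * pi\<^sup>2 * saddle_integral n (5 / 4) - 3 * pi * saddle_integral n (1 / 4))" .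
  have "xi_moment (2 * n) = 2 * (LINT x:{1<..}|lborel. f x)"
    unfolding xi_moment_even_eq [OF n] f_def ..
  thus "xi_moment (2 * n) = 2 / 4 ^ n * (2 * pi\<^sup>2 * saddle_integral n (5 / 4) - 3 * pi * saddle_integral n (1 / 4)
           + (LINT x:{1<..}|lborel. R x))"
    unfolding * by simp
qed

section \<open>The phase at the saddle point\<close>

lemma of_real_fps_nth_power:
  fixes f :: "nat \<Rightarrow> real"
  shows "of_real (fps_nth (Abs_fps f ^ j) i) = fps_nth (Abs_fps (\<lambda>k. of_real (f k) :: 'a :: {real_algebra_1, comm_ring_1}) ^ j) i"
proof (induction j arbitrary: i)
  case (Suc j)
  show ?case by (simp add: fps_mult_nth Suc [symmetric])
qed (simp add: fps_one_nth)

lemma of_real_ord_bell: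
  "of_real (ord_bell i j p) = fps_nth (Abs_fps (\<lambda>k. if k = 0 then 0 else complex_of_real (p k)) ^ j) i"
  unfolding ord_bell_def of_real_fps_nth_power by (simp add: if_distrib cong: if_cong)

definition ln_fps :: "complex fps" where
  "ln_fps = Abs_fps (\<lambda>k. if k = 0 then 0 else complex_of_real ((-1) ^ (k + 1) / real k))"

lemma has_fps_expansion_Ln_1_plus: "(\<lambda>z. Ln (1 + z)) has_fps_expansion ln_fps"
proof (rule has_fps_expansionI)
  have "\<forall>\<^sub>F u in nhds (0 :: complex). u \<in> ball 0 1"
    by (rule eventually_nhds_in_open) auto
  thus "\<forall>\<^sub>F u in nhds 0. (\<lambda>n. fps_nth ln_fps n * u ^ n) sums Ln (1 + u)"
  proof eventually_elim
    case (elim u)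
    have "(\<lambda>n. (- 1) ^ Suc n / of_nat n * u ^ n) = (\<lambda>n. fps_nth ln_fps n * u ^ n)"
      by (auto simp: ln_fps_def fun_eq_iff)
    thus ?case using Ln_series [of u] elim by simp
  qed
qed

text \<open>At x = exp w * (1 + z) the inner argument is ln x / w. Since L w = 2 n, the product L *
  \<open>log_log w z\<close> is the logarithm of (ln x / w) ^ (2 n).\<close>

definition log_log :: "real \<Rightarrow> complex \<Rightarrow> complex" where
  "log_log w z = of_real w * Ln (1 + of_real (1 / w) * Ln (1 + z))"

text \<open>Composition of two logarithm series; the Bell polynomials in \<open>ell\<close> are the
  coefficients of the powers of the inner one.\<close>

lemma has_fps_expansion_log_log:
  "log_log w has_fps_expansion Abs_fps (\<lambda>i. of_real (w * ell i w))"
proof -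
  let ?G = "fps_const (complex_of_real (1 / w)) * ln_fps"
  have "((\<lambda>z. Ln (1 + z)) \<circ> (\<lambda>z. of_real (1 / w) * Ln (1 + z))) has_fps_expansion (ln_fps oo ?G)"
    by (intro has_fps_expansion_compose has_fps_expansion_Ln_1_plus has_fps_expansion_cmult_left)
       (simp add: ln_fps_def)
  hence "(\<lambda>z. of_real w * ((\<lambda>z. Ln (1 + z)) \<circ> (\<lambda>z. of_real (1 / w) * Ln (1 + z))) z) has_fps_expansion
      fps_const (of_real w) * (ln_fps oo ?G)"
    by (rule has_fps_expansion_cmult_left)
  moreover have "fps_const (of_real w) * (ln_fps oo ?G) = Abs_fps (\<lambda>i. of_real (w * ell i w))"
  proof (rule fps_ext)
    fix i
    have "fps_nth (ln_fps oo ?G) i = (\<Sum>j=0..i. fps_nth ln_fps j * fps_nth (?G ^ j) i)"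
      by (simp add: fps_compose_nth)
    also have "\<dots> = (\<Sum>j=1..i. fps_nth ln_fps j * fps_nth (?G ^ j) i)"
      by (rule sum.mono_neutral_right) (auto simp: ln_fps_def)
    also have "\<dots> = of_real (ell i w)"
      unfolding ell_def of_real_sum
    proof (rule sum.cong [OF refl])
      fix j assume j: "j \<in> {1..i}"
      have "fps_nth (?G ^ j) i = of_real (1 / w ^ j) * fps_nth (ln_fps ^ j) i"
        by (simp add: power_mult_distrib fps_const_power power_divide)
      also have "fps_nth (ln_fps ^ j) i = of_real (ord_bell i j (\<lambda>k. (-1) ^ (k + 1) / real k))"
        by (simp only: of_real_ord_bell ln_fps_def)
      finally show "fps_nth ln_fps j * fps_nth (?G ^ j) i =
          of_real (ord_bell i j (\<lambda>k. (-1) ^ (k + 1) / real k) * ((-1) ^ (j + 1) / (real j * w ^ j)))"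
        using j by (simp add: ln_fps_def field_simps)
    qed
    finally show "fps_nth (fps_const (of_real w) * (ln_fps oo ?G)) i = fps_nth (Abs_fps (\<lambda>i. of_real (w * ell i w))) i"
      by simp
  qed
  ultimately show ?thesis by (simp add: log_log_def [abs_def] o_def)
qed

text \<open>The bound 2 * norm z for the logarithm is applied twice; the outer w cancels the inner 1
  / w, so nothing depends on w.\<close>

lemma log_log_bounds:
  assumes "w \<ge> 1" "norm z < 1 / 4"
  shows "norm (of_real (1 / w) * Ln (1 + z)) < 1 / 2" "norm (log_log w z) \<le> 4 * norm z"
proof -
  have L: "norm (Ln (1 + z)) \<le> 2 * norm z" by (rule norm_Ln_le) (use assms in auto)
  hence a: "norm (Ln (1 + z)) < 1 / 2" using assms by simp
  have eq: "norm (of_real (1 / w) * Ln (1 + z)) = norm (Ln (1 + z)) / w"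
    using assms by (simp add: norm_mult norm_divide)
  also have "\<dots> \<le> norm (Ln (1 + z)) / 1" using assms by (intro divide_left_mono) auto
  finally show b: "norm (of_real (1 / w) * Ln (1 + z)) < 1 / 2" using a by simp
  have "norm (log_log w z) = w * norm (Ln (1 + of_real (1 / w) * Ln (1 + z)))"
    using assms by (simp add: log_log_def norm_mult)
  also have "\<dots> \<le> w * (2 * norm (of_real (1 / w) * Ln (1 + z)))"
    using assms b by (intro mult_left_mono norm_Ln_le) auto
  also have "\<dots> = 2 * norm (Ln (1 + z))" using assms unfolding eq by simp
  finally show "norm (log_log w z) \<le> 4 * norm z" using L by simp
qed

lemma one_plus_notin_nonpos_Reals:
  assumes "norm (z :: complex) < 1" shows "1 + z \<notin> \<real>\<^sub>\<le>\<^sub>0"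
proof
  assume "1 + z \<in> \<real>\<^sub>\<le>\<^sub>0"
  hence "Re (1 + z) \<le> 0" by (simp add: complex_nonpos_Reals_iff)
  thus False using assms abs_Re_le_cmod [of z] by simp
qed

lemma holomorphic_log_log:
  assumes "w \<ge> 1" shows "log_log w holomorphic_on ball 0 (1 / 4)"
  unfolding log_log_def [abs_def]
proof (intro holomorphic_intros)
  fix z :: complex assume "z \<in> ball 0 (1 / 4)"
  hence z: "norm z < 1 / 4" by simp
  show "1 + z \<notin> \<real>\<^sub>\<le>\<^sub>0" by (rule one_plus_notin_nonpos_Reals) (use z in simp)
  show "1 + of_real (1 / w) * Ln (1 + z) \<notin> \<real>\<^sub>\<le>\<^sub>0"
    by (rule one_plus_notin_nonpos_Reals) (use log_log_bounds(1) [OF assms z] in linarith)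
qed

text \<open>Cauchy's inequality on the circle of radius 1 / 8, where \<open>log_log\<close> is at
  most 4 / 8.\<close>

lemma ell_bound:
  assumes "w \<ge> 1" shows "\<bar>w * ell i w\<bar> \<le> 8 ^ i"
proof -
  have "norm ((deriv ^^ i) (log_log w) 0) \<le> fact i * 1 / (1 / 8) ^ i"
  proof (rule Cauchy_inequality)
    show "log_log w holomorphic_on ball 0 (1 / 8)"
      by (rule holomorphic_on_subset [OF holomorphic_log_log [OF assms]]) auto
    show "continuous_on (cball 0 (1 / 8)) (log_log w)"
      by (rule holomorphic_on_imp_continuous_on, rule holomorphic_on_subset [OF holomorphic_log_log [OF assms]]) auto
    show "norm (log_log w z) \<le> 1" if "norm (0 - z) = 1 / 8" for z
      using log_log_bounds(2) [OF assms, of z] that by simp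
  qed simp
  moreover have "(deriv ^^ i) (log_log w) 0 = fact i * of_real (w * ell i w)"
    using fps_nth_fps_expansion [OF has_fps_expansion_log_log, of w i] by simp
  ultimately have "norm (fact i * complex_of_real (w * ell i w)) \<le> fact i * 8 ^ i"
    by (simp add: power_one_over)
  hence "fact i * \<bar>w * ell i w\<bar> \<le> fact i * 8 ^ i"
    by (simp only: norm_mult norm_of_real norm_fact)
  thus ?thesis by (simp only: mult_le_cancel_left_pos fact_gt_zero)
qed

text \<open>The phase from its cubic term on, divided by z^2. The constant coefficient is left out
  because the quadratic term belongs to the Gaussian.\<close>

definition saddle_fps :: "real \<Rightarrow> complex fps" where
  "saddle_fps w = Abs_fps (\<lambda>i. if i = 0 then 0 else complex_of_real (w * ell (i + 2) w))"

text \<open>The coefficients are at most 64 * 8 ^ i, and for norm z < 1 / 16 the geometric ratio is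
  below 1 / 2. Since the series starts at i = 1, the total is at most 2 * 512 * norm z.\<close>

lemma saddle_fps_bounds:
  assumes w: "w \<ge> 1"
  shows "fps_conv_radius (saddle_fps w) \<ge> ereal (1 / 16)"
    and "norm z < 1 / 16 \<Longrightarrow> norm (eval_fps (saddle_fps w) z) \<le> 1024 * norm z"
proof -
  have c: "norm (fps_nth (saddle_fps w) i) \<le> 64 * 8 ^ i" for i
    using ell_bound [OF w, of "i + 2"] by (simp add: saddle_fps_def power_add norm_mult abs_mult)
  have t: "norm (fps_nth (saddle_fps w) i * z ^ i) \<le> 64 * (8 * norm z) ^ i" for i z
    using c [of i] unfolding norm_mult norm_power power_mult_distrib mult.assoc [symmetric]
    by (intro mult_right_mono) auto
  have g: "summable (\<lambda>i. 64 * (8 * norm (z :: complex)) ^ i)" if "norm z \<le> 1 / 16" for z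
    using that by (intro summable_mult summable_geometric) auto
  have s: "summable (\<lambda>i. norm (fps_nth (saddle_fps w) i * z ^ i))" if "norm z \<le> 1 / 16" for z
    by (rule summable_comparison_test' [OF g [OF that]]) (use t in auto)
  show "fps_conv_radius (saddle_fps w) \<ge> ereal (1 / 16)"
    unfolding fps_conv_radius_def
    using conv_radius_geI [OF summable_norm_cancel [OF s [of "1 / 16"]]] by simp
  assume z: "norm z < 1 / 16"
  have "norm (eval_fps (saddle_fps w) z) \<le> (\<Sum>i. norm (fps_nth (saddle_fps w) i * z ^ i))"
    unfolding eval_fps_def by (rule summable_norm) (rule s, use z in simp)
  also have "\<dots> = (\<Sum>i. norm (fps_nth (saddle_fps w) (Suc i) * z ^ Suc i))"
    using suminf_split_head [OF s [of z]] z by (simp add: saddle_fps_def)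
  also have "\<dots> \<le> (\<Sum>i. (512 * norm z) * (8 * norm z) ^ i)"
  proof (rule suminf_le)
    show "norm (fps_nth (saddle_fps w) (Suc i) * z ^ Suc i) \<le> (512 * norm z) * (8 * norm z) ^ i" for i
      using t [of "Suc i" z] by simp
    show "summable (\<lambda>i. norm (fps_nth (saddle_fps w) (Suc i) * z ^ Suc i))"
      using summable_Suc_iff [of "\<lambda>i. norm (fps_nth (saddle_fps w) i * z ^ i)"] s [of z] z by simp
    show "summable (\<lambda>i. (512 * norm z) * (8 * norm z) ^ i)"
      using z by (intro summable_mult summable_geometric) auto
  qed
  also have "\<dots> = 512 * norm z * (1 / (1 - 8 * norm z))"
    using z by (subst suminf_mult) (auto simp: suminf_geometric intro!: summable_geometric)
  also have "\<dots> \<le> 512 * norm z * 2"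
    using z by (intro mult_left_mono) (auto simp: divide_le_eq)
  finally show "norm (eval_fps (saddle_fps w) z) \<le> 1024 * norm z" by simp
qed

text \<open>Multiplied by w these are 1, which cancels the linear term - t and so expresses
  stationarity at t = 0, and - (1 + 1 / w) / 2, the Gaussian exponent.\<close>

lemma ell_1_2: "ell 1 w = 1 / w" "ell 2 w = - 1 / (2 * w) - 1 / (2 * w ^ 2)"
proof -
  have "ord_bell i 1 p = (if i = 0 then 0 else p i)" for i p by (simp add: ord_bell_def)
  moreover have "ord_bell 2 2 p = p 1 ^ 2" for p
    by (simp add: ord_bell_def power2_eq_square fps_mult_nth eval_nat_numeral)
  moreover have "{1..2::nat} = {1, 2}" by auto
  ultimately show "ell 1 w = 1 / w" "ell 2 w = - 1 / (2 * w) - 1 / (2 * w ^ 2)"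
    by (simp_all add: ell_def)
qed

lemma saddle_identity:
  assumes w: "w \<ge> 1" and z: "norm z < 1 / 16"
  shows "z ^ 2 * eval_fps (saddle_fps w) z = log_log w z - z + of_real ((1 + 1 / w) / 2) * z ^ 2"
proof -
  define c where "c i = complex_of_real (w * ell i w)" for i
  have "ereal (norm z) < ereal (1 / 4)" using z by simp
  moreover have "log_log w holomorphic_on eball 0 (ereal (1 / 4))" using holomorphic_log_log [OF w] by simp
  ultimately have sm: "(\<lambda>n. c n * z ^ n) sums log_log w z"
    using has_fps_expansion_imp_sums_complex [OF has_fps_expansion_log_log [of w], where r = "ereal (1 / 4)" and z = z]
    by (simp add: c_def)
  have c012: "c 0 = 0" "c 1 = 1" "c 2 = - of_real ((1 + 1 / w) / 2)"
    using w by (simp_all only: c_def ell_1_2) (auto simp: ell_def field_simps power2_eq_square)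
  have "(\<lambda>n. c (n + 3) * z ^ (n + 3)) sums (log_log w z - (\<Sum>i<3. c i * z ^ i))"
    using sm by (rule sums_split_initial_segment)
  also have "(\<Sum>i<3. c i * z ^ i) = z - of_real ((1 + 1 / w) / 2) * z ^ 2"
  proof -
    have "{..<3::nat} = {0, 1, 2}" by auto
    thus ?thesis using c012 by simp
  qed
  finally have 1: "(\<lambda>n. c (n + 3) * z ^ (n + 3)) sums (log_log w z - z + of_real ((1 + 1 / w) / 2) * z ^ 2)"
    by (simp add: algebra_simps)
  have "ereal (norm z) < fps_conv_radius (saddle_fps w)"
    using saddle_fps_bounds(1) [OF w] z by (metis less_ereal.simps(1) less_le_trans)
  hence "(\<lambda>n. fps_nth (saddle_fps w) n * z ^ n) sums eval_fps (saddle_fps w) z"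
    by (rule sums_eval_fps)
  hence "(\<lambda>n. fps_nth (saddle_fps w) (Suc n) * z ^ Suc n) sums eval_fps (saddle_fps w) z"
    using sums_Suc_iff [of "\<lambda>n. fps_nth (saddle_fps w) n * z ^ n"] by (simp add: saddle_fps_def)
  hence "(\<lambda>n. z ^ 2 * (fps_nth (saddle_fps w) (Suc n) * z ^ Suc n)) sums (z ^ 2 * eval_fps (saddle_fps w) z)"
    by (rule sums_mult)
  also have "(\<lambda>n. z ^ 2 * (fps_nth (saddle_fps w) (Suc n) * z ^ Suc n)) = (\<lambda>n. c (n + 3) * z ^ (n + 3))"
    by (simp add: saddle_fps_def c_def power_add power2_eq_square eval_nat_numeral mult_ac)
  finally show ?thesis using 1 sums_unique2 by blast
qed

text \<open>The N-th Taylor coefficient in t of (1 + t) powr \<beta> times the exponential of s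
  times the reduced phase, with s independent of t. The value s = L t^2 is inserted only afterwards,
  so \<open>saddle_poly\<close> is not a Taylor polynomial of the integrand.\<close>

definition saddle_coeff :: "real \<Rightarrow> real \<Rightarrow> nat \<Rightarrow> real \<Rightarrow> real" where
  "saddle_coeff \<beta> w N s = (\<Sum>i=0..N. (\<Sum>j=0..i. s ^ j / fact j * (w ^ j * ord_bell i j (\<lambda>k. ell (k + 2) w)))
      * (\<beta> gchoose (N - i)))"

lemma of_real_gchoose: "of_real (\<beta> gchoose k) = (complex_of_real \<beta> gchoose k)"
  by (simp add: gbinomial_prod_rev)

definition saddle_fun :: "real \<Rightarrow> real \<Rightarrow> real \<Rightarrow> complex \<Rightarrow> complex" where
  "saddle_fun \<beta> w s z = (1 + z) powr of_real \<beta> * exp (of_real s * eval_fps (saddle_fps w) z)"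

lemma has_fps_expansion_saddle_fun:
  assumes w: "w \<ge> 1"
  shows "saddle_fun \<beta> w s has_fps_expansion Abs_fps (\<lambda>N. of_real (saddle_coeff \<beta> w N s))"
proof -
  have r: "fps_conv_radius (saddle_fps w) > 0"
    using saddle_fps_bounds(1) [OF w] by (rule less_le_trans [rotated]) simp
  have "((\<lambda>z. exp (of_real s * z)) \<circ> eval_fps (saddle_fps w)) has_fps_expansion (fps_exp (of_real s) oo saddle_fps w)"
    by (intro has_fps_expansion_compose has_fps_expansion_exp eval_fps_has_fps_expansion r)
       (simp add: saddle_fps_def)
  hence "(\<lambda>z. (1 + z) powr of_real \<beta> * ((\<lambda>z. exp (of_real s * z)) \<circ> eval_fps (saddle_fps w)) z) has_fps_expansion
      fps_binomial (of_real \<beta>) * (fps_exp (of_real s) oo saddle_fps w)"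
    by (intro has_fps_expansion_mult has_fps_expansion_binomial_complex)
  moreover have "fps_binomial (of_real \<beta>) * (fps_exp (of_real s) oo saddle_fps w) = Abs_fps (\<lambda>N. of_real (saddle_coeff \<beta> w N s))"
  proof (rule fps_ext)
    fix N
    have pw: "fps_nth (saddle_fps w ^ j) i = of_real (w ^ j * ord_bell i j (\<lambda>k. ell (k + 2) w))" for i j
    proof -
      define A where "A = Abs_fps (\<lambda>k. if k = 0 then 0 else complex_of_real (ell (k + 2) w))"
      have "saddle_fps w = fps_const (of_real w) * A"
        by (rule fps_ext) (simp add: saddle_fps_def A_def)
      hence "fps_nth (saddle_fps w ^ j) i = of_real (w ^ j) * fps_nth (A ^ j) i"
        by (simp add: power_mult_distrib fps_const_power)
      thus ?thesis by (simp only: A_def of_real_ord_bell [symmetric] of_real_mult)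
    qed
    have "fps_nth (fps_exp (of_real s) oo saddle_fps w) i = of_real (\<Sum>j=0..i. s ^ j / fact j * (w ^ j * ord_bell i j (\<lambda>k. ell (k + 2) w)))" for i
      by (simp add: fps_compose_nth pw)
    hence "fps_nth (fps_binomial (of_real \<beta>) * (fps_exp (of_real s) oo saddle_fps w)) N
       = (\<Sum>i=0..N. of_real (\<Sum>j=0..i. s ^ j / fact j * (w ^ j * ord_bell i j (\<lambda>k. ell (k + 2) w))) * of_real (\<beta> gchoose (N - i)))"
      by (subst mult.commute) (simp only: fps_mult_nth fps_binomial_nth of_real_gchoose)
    also have "\<dots> = of_real (saddle_coeff \<beta> w N s)"
      by (simp only: saddle_coeff_def of_real_sum of_real_mult)
    finally show "fps_nth (fps_binomial (of_real \<beta>) * (fps_exp (of_real s) oo saddle_fps w)) N = fps_nth (Abs_fps (\<lambda>N. of_real (saddle_coeff \<beta> w N s))) N"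
      by simp
  qed
  ultimately show ?thesis by (simp add: saddle_fun_def [abs_def] o_def)
qed

lemma holomorphic_saddle_fun:
  assumes w: "w \<ge> 1" shows "saddle_fun \<beta> w s holomorphic_on ball 0 (1 / 16)"
  unfolding saddle_fun_def [abs_def]
proof (intro holomorphic_intros)
  show "1 + z \<notin> \<real>\<^sub>\<le>\<^sub>0" if "z \<in> ball 0 (1 / 16)" for z :: complex
    by (rule one_plus_notin_nonpos_Reals) (use that in simp)
  show "ball 0 (1 / 16) \<subseteq> eball 0 (fps_conv_radius (saddle_fps w))"
    using ball_eball_mono [OF saddle_fps_bounds(1) [OF w]] .
qed

text \<open>On a circle so small that the cubic part of the phase is at most 1/4, the Cauchy estimates for
  the Taylor coefficients in t cost only a factor exp (s / 4), which half of the Gaussian absorbs.\<close>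
lemma saddle_coeff_bound:
  assumes w: "w \<ge> 1" and s: "s \<ge> 0" and \<beta>: "\<beta> \<ge> 0"
  shows "\<bar>saddle_coeff \<beta> w N s\<bar> \<le> 2 powr \<beta> * exp (s / 4) * 4096 ^ N"
proof -
  have "norm ((deriv ^^ N) (saddle_fun \<beta> w s) 0) \<le> fact N * (2 powr \<beta> * exp (s / 4)) / (1 / 4096) ^ N"
  proof (rule Cauchy_inequality)
    show "saddle_fun \<beta> w s holomorphic_on ball 0 (1 / 4096)"
      by (rule holomorphic_on_subset [OF holomorphic_saddle_fun [OF w]]) auto
    show "continuous_on (cball 0 (1 / 4096)) (saddle_fun \<beta> w s)"
      by (rule holomorphic_on_imp_continuous_on, rule holomorphic_on_subset [OF holomorphic_saddle_fun [OF w]]) auto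
    fix z :: complex assume "norm (0 - z) = 1 / 4096"
    hence z: "norm z = 1 / 4096" by simp
    have "norm ((1 + z) powr of_real \<beta>) = norm (1 + z) powr \<beta>"
      by (subst norm_powr_real_powr') auto
    also have "\<dots> \<le> 2 powr \<beta>"
      using norm_triangle_ineq [of 1 z] z \<beta> by (intro powr_mono2) auto
    finally have 1: "norm ((1 + z) powr of_real \<beta>) \<le> 2 powr \<beta>" .
    \<comment> \<open>The radius 1 / 4096 is chosen against the constant 1024 of
      \<open>saddle_fps_bounds\<close>: their product is 1 / 4.\<close>
    have "Re (of_real s * eval_fps (saddle_fps w) z) \<le> norm (of_real s * eval_fps (saddle_fps w) z)"
      by (rule complex_Re_le_cmod)
    also have "\<dots> \<le> s * (1024 * norm z)"
      using s saddle_fps_bounds(2) [OF w, of z] z by (simp add: norm_mult mult_left_mono)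
    finally have "norm (exp (of_real s * eval_fps (saddle_fps w) z)) \<le> exp (s / 4)"
      using z by simp
    thus "norm (saddle_fun \<beta> w s z) \<le> 2 powr \<beta> * exp (s / 4)"
      unfolding saddle_fun_def norm_mult using 1 by (intro mult_mono) auto
  qed simp
  moreover have "(deriv ^^ N) (saddle_fun \<beta> w s) 0 = fact N * of_real (saddle_coeff \<beta> w N s)"
    using fps_nth_fps_expansion [OF has_fps_expansion_saddle_fun [OF w], of \<beta> s N] by simp
  ultimately have "fact N * \<bar>saddle_coeff \<beta> w N s\<bar> \<le> fact N * (2 powr \<beta> * exp (s / 4) * 4096 ^ N)"
    by (simp add: norm_mult power_one_over field_simps)
  thus ?thesis by (simp only: mult_le_cancel_left_pos fact_gt_zero)
qed

text \<open>The logarithm of the rescaled integrand divided by L; it vanishes to second order at the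
  saddle point t = 0.\<close>

definition saddle_phase :: "real \<Rightarrow> real \<Rightarrow> real" where
  "saddle_phase w t = w * ln (1 + ln (1 + t) / w) - t"

abbreviation saddle_integrand :: "real \<Rightarrow> real \<Rightarrow> real \<Rightarrow> real \<Rightarrow> real" where
  "saddle_integrand \<beta> w L t \<equiv> exp (\<beta> * ln (1 + t)) * exp (L * saddle_phase w t)"

lemma saddle_fun_of_real:
  assumes w: "w \<ge> 1" and t: "\<bar>t\<bar> < 1 / 16"
  shows "saddle_fun \<beta> w (L * t ^ 2) (of_real t) =
    of_real (exp (\<beta> * ln (1 + t)) * exp (L * saddle_phase w t + L * (1 + 1 / w) / 2 * t ^ 2))"
proof -
  have nt: "norm (complex_of_real t) < 1 / 16" using t by simp
  have p1: "1 + t > 0" using t by simp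
  have L1: "Ln (1 + of_real t) = of_real (ln (1 + t))"
    using Ln_of_real [OF p1] by simp
  have "\<bar>ln (1 + t)\<bar> / w < 1 / 2"
    using log_log_bounds(1) [OF w, of "of_real t"] nt w by (simp add: L1 norm_mult norm_divide)
  hence "\<bar>ln (1 + t) / w\<bar> < 1 / 2" using w by simp
  hence p2: "1 + ln (1 + t) / w > 0" by linarith
  have ll: "log_log w (of_real t) = of_real (w * ln (1 + ln (1 + t) / w))"
    using Ln_of_real [OF p2] by (simp add: log_log_def L1)
  have "complex_of_real (L * t ^ 2) * eval_fps (saddle_fps w) (of_real t)
     = of_real L * (of_real t ^ 2 * eval_fps (saddle_fps w) (of_real t))" by simp
  also have "\<dots> = of_real (L * saddle_phase w t + L * (1 + 1 / w) / 2 * t ^ 2)"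
    unfolding saddle_identity [OF w nt] ll by (simp add: saddle_phase_def algebra_simps)
  finally have "exp (complex_of_real (L * t ^ 2) * eval_fps (saddle_fps w) (of_real t)) =
      of_real (exp (L * saddle_phase w t + L * (1 + 1 / w) / 2 * t ^ 2))"
    by (simp only: exp_of_real)
  moreover have "(1 + of_real t) powr of_real \<beta> = complex_of_real (exp (\<beta> * ln (1 + t)))"
  proof -
    have "1 + complex_of_real t \<noteq> 0"
      using p1 by (metis less_irrefl of_real_1 of_real_add of_real_eq_0_iff)
    thus ?thesis by (simp add: powr_def L1 exp_of_real [symmetric])
  qed
  ultimately show ?thesis by (simp add: saddle_fun_def)
qed

text \<open>The second bound concerns the polynomial alone, outside the interval where the expansion
  is valid. Its shape equals that of the Taylor error, so the truncated integrand can be compared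
  with Gaussian integrals over the whole line without a separate tail estimate.\<close>

lemma saddle_taylor:
  assumes \<beta>: "\<beta> \<ge> 0"
  obtains C where "C \<ge> 0"
    "\<And>w L t. \<lbrakk>w \<ge> 1; L \<ge> 0; \<bar>t\<bar> \<le> 1 / 8192\<rbrakk> \<Longrightarrow>
       \<bar>exp (\<beta> * ln (1 + t)) * exp (L * saddle_phase w t + L * (1 + 1 / w) / 2 * t ^ 2)
          - (\<Sum>N<M. saddle_coeff \<beta> w N (L * t ^ 2) * t ^ N)\<bar> \<le> C * exp (L * t ^ 2 / 4) * \<bar>t\<bar> ^ M"
    "\<And>w L t. \<lbrakk>w \<ge> 1; L \<ge> 0; \<bar>t\<bar> > 1 / 8192\<rbrakk> \<Longrightarrow>
       \<bar>\<Sum>N<M. saddle_coeff \<beta> w N (L * t ^ 2) * t ^ N\<bar> \<le> C * exp (L * t ^ 2 / 4) * \<bar>t\<bar> ^ M"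
proof
  \<comment> \<open>The 2 is the geometric series of ratio 4096 * |t| <= 1 / 2; the summand M * 2 ^
    M bounds the M terms of the polynomial in the other range.\<close>
  define C where "C = 2 powr \<beta> * 4096 ^ M * (2 + real M * 2 ^ M)"
  show "C \<ge> 0" by (simp add: C_def)
  fix w L t :: real assume w: "w \<ge> 1" and l: "L \<ge> 0"
  define s where "s = L * t ^ 2"
  have s: "s \<ge> 0" using l by (simp add: s_def)
  define B where "B = 2 powr \<beta> * exp (s / 4)"
  have B: "B \<ge> 0" by (simp add: B_def)
  define x where "x = 4096 * \<bar>t\<bar>"
  have x: "x \<ge> 0" by (simp add: x_def)
  have bd: "\<bar>saddle_coeff \<beta> w N s * t ^ N\<bar> \<le> B * x ^ N" for N
  proof -
    have "\<bar>saddle_coeff \<beta> w N s * t ^ N\<bar> \<le> (B * 4096 ^ N) * \<bar>t\<bar> ^ N"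
      unfolding abs_mult power_abs B_def
      by (intro mult_right_mono saddle_coeff_bound w s \<beta>) auto
    thus ?thesis by (simp add: x_def power_mult_distrib)
  qed
  have Ceq: "C * exp (L * t ^ 2 / 4) * \<bar>t\<bar> ^ M = B * x ^ M * (2 + real M * 2 ^ M)"
    by (simp add: C_def B_def s_def x_def power_mult_distrib)
  {
    assume t: "\<bar>t\<bar> \<le> 1 / 8192"
    define E where "E = exp (\<beta> * ln (1 + t)) * exp (L * saddle_phase w t + L * (1 + 1 / w) / 2 * t ^ 2)"
    have x2: "x \<le> 1 / 2" using t by (simp add: x_def)
    have "ereal (norm (complex_of_real t)) < ereal (1 / 16)" using t by simp
    moreover have "saddle_fun \<beta> w s holomorphic_on eball 0 (ereal (1 / 16))"
      using holomorphic_saddle_fun [OF w] by simp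
    ultimately have "(\<lambda>N. of_real (saddle_coeff \<beta> w N s) * of_real t ^ N) sums saddle_fun \<beta> w s (of_real t)"
      using has_fps_expansion_imp_sums_complex [OF has_fps_expansion_saddle_fun [OF w, of \<beta> s], where z = "of_real t" and r = "ereal (1 / 16)"]
      by simp
    moreover have "saddle_fun \<beta> w s (of_real t) = of_real E"
      unfolding s_def E_def by (rule saddle_fun_of_real [OF w]) (use t in simp)
    ultimately have "(\<lambda>N. complex_of_real (saddle_coeff \<beta> w N s * t ^ N)) sums of_real E" by simp
    hence "(\<lambda>N. saddle_coeff \<beta> w N s * t ^ N) sums E" by (simp only: sums_of_real_iff)
    hence sm: "(\<lambda>n. saddle_coeff \<beta> w (n + M) s * t ^ (n + M)) sums (E - (\<Sum>N<M. saddle_coeff \<beta> w N s * t ^ N))"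
      by (rule sums_split_initial_segment)
    have sx: "summable (\<lambda>n. B * x ^ M * x ^ n)" using x x2 by (intro summable_mult summable_geometric) auto
    have ab: "\<bar>saddle_coeff \<beta> w (n + M) s * t ^ (n + M)\<bar> \<le> B * x ^ M * x ^ n" for n
      using bd [of "n + M"] by (simp add: power_add mult_ac)
    have sa: "summable (\<lambda>n. \<bar>saddle_coeff \<beta> w (n + M) s * t ^ (n + M)\<bar>)"
      by (rule summable_comparison_test' [OF sx]) (use ab in auto)
    have "\<bar>E - (\<Sum>N<M. saddle_coeff \<beta> w N s * t ^ N)\<bar> \<le> (\<Sum>n. \<bar>saddle_coeff \<beta> w (n + M) s * t ^ (n + M)\<bar>)"
      using summable_rabs [OF sa] sm by (simp add: sums_iff)
    also have "\<dots> \<le> (\<Sum>n. B * x ^ M * x ^ n)"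
      by (rule suminf_le [OF ab sa sx])
    also have "\<dots> = B * x ^ M * (1 / (1 - x))"
      using x x2 by (subst suminf_mult) (auto simp: suminf_geometric intro!: summable_geometric)
    also have "\<dots> \<le> B * x ^ M * (2 + real M * 2 ^ M)"
    proof (intro mult_left_mono)
      have "1 / (1 - x) \<le> 2" using x2 by (simp add: divide_le_eq)
      thus "1 / (1 - x) \<le> 2 + real M * 2 ^ M" by (rule order.trans) simp
    qed (use B x in auto)
    finally show "\<bar>exp (\<beta> * ln (1 + t)) * exp (L * saddle_phase w t + L * (1 + 1 / w) / 2 * t ^ 2)
          - (\<Sum>N<M. saddle_coeff \<beta> w N (L * t ^ 2) * t ^ N)\<bar> \<le> C * exp (L * t ^ 2 / 4) * \<bar>t\<bar> ^ M"
      unfolding Ceq by (simp only: E_def s_def)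
  next
    assume t: "\<bar>t\<bar> > 1 / 8192"
    \<comment> \<open>Beyond the interval every power of x below the M-th is at most (2 x) ^
      M.\<close>
    have x2: "2 * x \<ge> 1" using t by (simp add: x_def)
    have "\<bar>\<Sum>N<M. saddle_coeff \<beta> w N s * t ^ N\<bar> \<le> (\<Sum>N<M. \<bar>saddle_coeff \<beta> w N s * t ^ N\<bar>)" by (rule sum_abs)
    also have "\<dots> \<le> (\<Sum>N<M. B * (2 ^ M * x ^ M))"
    proof (rule sum_mono)
      fix N assume N: "N \<in> {..<M}"
      have "x ^ N \<le> (2 * x) ^ N" using x by (intro power_mono) auto
      also have "\<dots> \<le> (2 * x) ^ M" using x2 N by (intro power_increasing) auto
      finally have "x ^ N \<le> 2 ^ M * x ^ M" by (simp add: power_mult_distrib)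
      thus "\<bar>saddle_coeff \<beta> w N s * t ^ N\<bar> \<le> B * (2 ^ M * x ^ M)"
        using order.trans [OF bd mult_left_mono [OF _ B]] by blast
    qed
    also have "\<dots> \<le> B * x ^ M * (2 + real M * 2 ^ M)"
      using B x by (simp add: algebra_simps)
    finally show "\<bar>\<Sum>N<M. saddle_coeff \<beta> w N (L * t ^ 2) * t ^ N\<bar> \<le> C * exp (L * t ^ 2 / 4) * \<bar>t\<bar> ^ M"
      unfolding Ceq by (simp only: s_def)
  }
qed

section \<open>Gaussian moments\<close>

lemma gaussian_moments:
  fixes A :: real assumes A: "A > 0"
  shows "has_bochner_integral lborel (\<lambda>t. exp (- A * t ^ 2 / 2) * t ^ (2 * k)) (sqrt (2 * pi / A) * (fact (2 * k) / (2 ^ k * fact k)) / A ^ k)"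
    and "has_bochner_integral lborel (\<lambda>t. exp (- A * t ^ 2 / 2) * t ^ (2 * k + 1)) 0"
proof -
  define \<sigma> where "\<sigma> = 1 / sqrt A"
  have \<sigma>: "\<sigma> > 0" "\<sigma>\<^sup>2 = 1 / A" using A by (auto simp: \<sigma>_def power_divide)
  have nd: "sqrt (2 * pi / A) * normal_density 0 \<sigma> t = exp (- A * t ^ 2 / 2)" for t
    using A by (simp add: normal_density_def \<sigma> real_sqrt_divide field_simps)
  have "has_bochner_integral lborel (\<lambda>t. sqrt (2 * pi / A) * (normal_density 0 \<sigma> t * (t - 0) ^ (2 * k))) (sqrt (2 * pi / A) * (fact (2 * k) / ((2 / \<sigma>\<^sup>2) ^ k * fact k)))"
    by (intro has_bochner_integral_mult_right normal_moment_even \<sigma>)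
  moreover have "sqrt (2 * pi / A) * (fact (2 * k) / ((2 / \<sigma>\<^sup>2) ^ k * fact k)) = sqrt (2 * pi / A) * (fact (2 * k) / (2 ^ k * fact k)) / A ^ k"
    by (simp add: \<sigma> power_mult_distrib)
  ultimately have "has_bochner_integral lborel (\<lambda>t. sqrt (2 * pi / A) * (normal_density 0 \<sigma> t * (t - 0) ^ (2 * k))) (sqrt (2 * pi / A) * (fact (2 * k) / (2 ^ k * fact k)) / A ^ k)"
    by (simp only:)
  thus "has_bochner_integral lborel (\<lambda>t. exp (- A * t ^ 2 / 2) * t ^ (2 * k)) (sqrt (2 * pi / A) * (fact (2 * k) / (2 ^ k * fact k)) / A ^ k)"
    unfolding mult.assoc [symmetric] nd by simp
  have "has_bochner_integral lborel (\<lambda>t. sqrt (2 * pi / A) * (normal_density 0 \<sigma> t * (t - 0) ^ (2 * k + 1))) (sqrt (2 * pi / A) * 0)"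
    by (intro has_bochner_integral_mult_right normal_moment_odd \<sigma>)
  thus "has_bochner_integral lborel (\<lambda>t. exp (- A * t ^ 2 / 2) * t ^ (2 * k + 1)) 0"
    unfolding mult.assoc [symmetric] nd by simp
qed

lemma double_fact_odd: "real (double_fact (2 * k - 1)) = fact (2 * k) / (2 ^ k * fact k)"
proof (induction k)
  case (Suc k)
  have "double_fact (2 * Suc k - 1) = (2 * k + 1) * double_fact (2 * k - 1)"
    by (cases k) auto
  hence "real (double_fact (2 * Suc k - 1)) = real (2 * k + 1) * (fact (2 * k) / (2 ^ k * fact k))"
    using Suc by (simp only: of_nat_mult)
  also have "\<dots> = (2 * real k + 2) * (2 * real k + 1) * fact (2 * k) / (2 ^ Suc k * ((real k + 1) * fact k))"
  proof -
    have "(2 * r + 1) * (F / (P * G)) = (2 * r + 2) * (2 * r + 1) * F / (2 * P * ((r + 1) * G))"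
      if "r \<ge> 0" for r F P G :: real
    proof -
      have "(2 * r + 2) * (2 * r + 1) * F / (2 * P * ((r + 1) * G)) = (2 * (r + 1)) * ((2 * r + 1) * F) / ((2 * (r + 1)) * (P * G))"
        by (simp add: algebra_simps)
      also have "\<dots> = ((2 * r + 1) * F) / (P * G)"
        by (rule nonzero_mult_divide_mult_cancel_left) (use that in simp)
      finally show ?thesis by simp
    qed
    from this [of "real k" "fact (2 * k)" "2 ^ k" "fact k"] show ?thesis
      by (simp only: of_nat_add of_nat_mult of_nat_numeral of_nat_1 power_Suc of_nat_0_le_iff)
  qed
  also have "(2 * real k + 2) * (2 * real k + 1) * fact (2 * k) = fact (2 * Suc k)"
    by (simp add: algebra_simps)
  also have "(real k + 1) * fact k = (fact (Suc k) :: real)" by (simp add: algebra_simps)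
  finally show ?case .
qed simp

section \<open>Expansion of the saddle point integral\<close>

lemma sum_even_odd: "(\<Sum>N<2 * K. f N) = (\<Sum>r<K. f (2 * r)) + (\<Sum>r<K. f (2 * r + 1 :: nat))" for f :: "nat \<Rightarrow> real"
  by (induction K) (simp_all add: algebra_simps)

lemma sum_triangle_swap:
  "(\<Sum>i=0..n. \<Sum>j=0..i. f i j) = (\<Sum>j=0..n. \<Sum>i=j..n. f i j)" for f :: "nat \<Rightarrow> nat \<Rightarrow> real"
proof -
  have "(\<Sum>i=0..n. \<Sum>j=0..i. f i j) = (\<Sum>i\<in>{0..n}. \<Sum>j\<in>{j\<in>{0..n}. j \<le> i}. f i j)"
    by (intro sum.cong) auto
  also have "\<dots> = (\<Sum>j\<in>{0..n}. \<Sum>i\<in>{i\<in>{0..n}. j \<le> i}. f i j)"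
    by (rule sum.swap_restrict) auto
  also have "\<dots> = (\<Sum>j=0..n. \<Sum>i=j..n. f i j)"
    by (intro sum.cong) auto
  finally show ?thesis .
qed

definition saddle_poly :: "real \<Rightarrow> real \<Rightarrow> real \<Rightarrow> nat \<Rightarrow> real \<Rightarrow> real" where
  "saddle_poly \<beta> w L M t = (\<Sum>N<M. saddle_coeff \<beta> w N (L * t ^ 2) * t ^ N)"

text \<open>Odd N integrate to 0. For N = 2 r the part with L^j t ^ (2 j + 2 r) has the moment (2 j
  + 2 r - 1)!! / A ^ (j + r), and L w / A = w^2 / (w + 1) rewrites the powers of L, w and A as in
  \<open>a_coeff\<close>, up to division by (L w) ^ r.\<close>

lemma has_bochner_integral_saddle_poly:
  fixes L w :: real
  assumes L: "L > 0" and w: "w > 0"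
  defines "A \<equiv> L * (1 + 1 / w)"
  shows "has_bochner_integral lborel (\<lambda>t. exp (- A * t ^ 2 / 2) * saddle_poly \<beta> w L (2 * K) t)
           (sqrt (2 * pi / A) * (\<Sum>r<K. a_coeff \<beta> r w / (L * w) ^ r))"
proof -
  have A: "A > 0" using L w by (simp add: A_def add_pos_pos)
  define m where "m q = (if even q then sqrt (2 * pi / A) * real (double_fact (q - 1)) / A ^ (q div 2) else 0)" for q :: nat
  have m: "has_bochner_integral lborel (\<lambda>t. exp (- A * t ^ 2 / 2) * t ^ q) (m q)" for q
  proof (cases "even q")
    case True
    then obtain k where "q = 2 * k" by (auto elim: evenE)
    thus ?thesis using gaussian_moments(1) [OF A, of k] by (simp add: m_def double_fact_odd [symmetric])
  next
    case False
    then obtain k where "q = 2 * k + 1" by (auto elim: oddE)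
    thus ?thesis using gaussian_moments(2) [OF A, of k] by (simp add: m_def)
  qed
  define c where "c N i j = L ^ j / fact j * (w ^ j * ord_bell i j (\<lambda>k. ell (k + 2) w)) * (\<beta> gchoose (N - i))" for N i j :: nat
  have eq: "exp (- A * t ^ 2 / 2) * saddle_poly \<beta> w L M t
     = (\<Sum>N<M. \<Sum>i=0..N. \<Sum>j=0..i. c N i j * (exp (- A * t ^ 2 / 2) * t ^ (2 * j + N)))" for t M
    unfolding saddle_poly_def saddle_coeff_def sum_distrib_left sum_distrib_right
    by (intro sum.cong refl) (simp add: c_def power_mult_distrib power_add power_mult [symmetric] mult_ac)
  have "has_bochner_integral lborel (\<lambda>t. exp (- A * t ^ 2 / 2) * saddle_poly \<beta> w L (2 * K) t)
     (\<Sum>N<2 * K. \<Sum>i=0..N. \<Sum>j=0..i. c N i j * m (2 * j + N))"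
    unfolding eq by (intro has_bochner_integral_sum has_bochner_integral_mult_right m)
  also have "(\<Sum>N<2 * K. \<Sum>i=0..N. \<Sum>j=0..i. c N i j * m (2 * j + N))
      = (\<Sum>r<K. \<Sum>i=0..2 * r. \<Sum>j=0..i. c (2 * r) i j * m (2 * j + 2 * r))"
    unfolding sum_even_odd by (simp add: m_def)
  also have "\<dots> = (\<Sum>r<K. sqrt (2 * pi / A) * (a_coeff \<beta> r w / (L * w) ^ r))"
  proof (rule sum.cong [OF refl])
    fix r
    have q: "w\<^sup>2 / (w + 1) = (L * w) / A"
    proof -
      have "A = L * (w + 1) / w" using w by (simp add: A_def field_simps)
      thus ?thesis using L w by (simp add: power2_eq_square)
    qed
    have key: "c (2 * r) i j * m (2 * j + 2 * r) = sqrt (2 * pi / A) * (real (double_fact (2 * j + 2 * r - 1)) / fact j *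
        (w\<^sup>2 / (w + 1)) ^ (j + r) * (ord_bell i j (\<lambda>k. ell (k + 2) w) * (\<beta> gchoose (2 * r - i))) / (L * w) ^ r)" for i j
    proof -
      have "m (2 * j + 2 * r) = sqrt (2 * pi / A) * real (double_fact (2 * j + 2 * r - 1)) / A ^ (j + r)"
        by (simp add: m_def distrib_left [symmetric] del: distrib_left_numeral)
      moreover have "(w\<^sup>2 / (w + 1)) ^ (j + r) / (L * w) ^ r = L ^ j * w ^ j / A ^ (j + r)"
        unfolding q power_divide using L w by (simp add: power_add power_mult_distrib)
      moreover have "s * (d / F * X * (b * g) / Y) = L ^ j / F * (w ^ j * b) * g * (s * d / Z)"
        if "X / Y = L ^ j * w ^ j / Z" for s d F X b g Y Z :: real
      proof -
        have "s * (d / F * X * (b * g) / Y) = s * (d / F * (X / Y) * (b * g))" by simp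
        thus ?thesis unfolding that by simp
      qed
      ultimately show ?thesis unfolding c_def by metis
    qed
    have "(\<Sum>i=0..2 * r. \<Sum>j=0..i. c (2 * r) i j * m (2 * j + 2 * r)) =
       (\<Sum>j=0..2 * r. \<Sum>i=j..2 * r. c (2 * r) i j * m (2 * j + 2 * r))"
      by (rule sum_triangle_swap)
    also have "\<dots> = sqrt (2 * pi / A) * (a_coeff \<beta> r w / (L * w) ^ r)"
      unfolding key a_coeff_def sum_divide_distrib sum_distrib_left by (simp add: mult_ac)
    finally show "(\<Sum>i=0..2 * r. \<Sum>j=0..i. c (2 * r) i j * m (2 * j + 2 * r)) = sqrt (2 * pi / A) * (a_coeff \<beta> r w / (L * w) ^ r)" .
  qed
  finally show ?thesis by (simp add: sum_distrib_left)
qed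

text \<open>The inequality ln (1 + y) <= y removes the outer logarithm and with it w. The condition
  on t says x > 1, so that the inner argument is positive.\<close>

lemma saddle_phase_le:
  assumes w: "w > 0" and t: "t > exp (- w) - 1"
  shows "saddle_phase w t \<le> ln (1 + t) - t"
proof -
  have p: "1 + t > exp (- w)" using t by simp
  hence p0: "1 + t > 0" using exp_gt_zero less_trans by blast
  hence "ln (1 + t) > - w" using p ln_less_cancel_iff [of "exp (- w)" "1 + t"] by simp
  hence "ln (1 + t) / w > - 1" using w by (simp add: field_simps)
  hence "ln (1 + ln (1 + t) / w) \<le> ln (1 + t) / w" by (intro ln_add_one_self_le_self2)
  hence "w * ln (1 + ln (1 + t) / w) \<le> w * (ln (1 + t) / w)" using w by (intro mult_left_mono) auto
  thus ?thesis using w by (simp add: saddle_phase_def)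
qed

text \<open>With y = sqrt (1 + t) and ln y <= y - 1 the left side is at most - (y - 1)^2. From |t| =
  |y - 1| (y + 1) the distance |y - 1| is at least d / 3 when y <= 2, and it exceeds 1
  otherwise.\<close>

lemma ln_le_minus_gap:
  fixes t d :: real
  assumes t: "t > - 1" and d: "\<bar>t\<bar> \<ge> d" and d1: "0 \<le> d" "d \<le> 1"
  shows "ln (1 + t) - t \<le> - (d ^ 2 / 9)"
proof -
  define y where "y = sqrt (1 + t)"
  have y: "y > 0" "1 + t = y ^ 2" using t by (auto simp: y_def)
  have "ln (1 + t) = 2 * ln y" using y by (simp add: ln_realpow)
  also have "\<dots> \<le> 2 * (y - 1)" using ln_le_minus_one [OF y(1)] by simp
  finally have "ln (1 + t) - t \<le> - ((y - 1) ^ 2)"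
    using y(2) by (simp add: power2_eq_square algebra_simps)
  moreover have "(d / 3) ^ 2 \<le> (y - 1) ^ 2"
  proof (cases "y \<le> 2")
    case True
    have "t = (y - 1) * (y + 1)" using y(2) by (simp add: algebra_simps power2_eq_square)
    hence "d \<le> \<bar>y - 1\<bar> * (y + 1)" using d y by (simp add: abs_mult)
    also have "\<dots> \<le> \<bar>y - 1\<bar> * 3" using True by (intro mult_left_mono) auto
    finally have "d / 3 \<le> \<bar>y - 1\<bar>" by simp
    thus ?thesis using d1 by (simp add: abs_le_square_iff [symmetric])
  next
    case False
    hence "\<bar>d / 3\<bar> \<le> \<bar>y - 1\<bar>" using d1 by simp
    thus ?thesis by (simp only: abs_le_square_iff)
  qed
  ultimately show ?thesis by (simp add: power_divide)
qed

definition saddle_J :: "real \<Rightarrow> real \<Rightarrow> real \<Rightarrow> real" where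
  "saddle_J \<beta> w L = (LINT t:{exp (- w) - 1<..}|lborel. saddle_integrand \<beta> w L t)"

abbreviation saddle_core :: "real set" where
  "saddle_core \<equiv> {-1/8192..1/8192}"

abbreviation saddle_outer :: "real \<Rightarrow> real set" where
  "saddle_outer w \<equiv> {exp (- w) - 1<..} - saddle_core"

text \<open>The integrand, cut off outside the core, is compared with Gaussian times polynomial on
  the whole line. The error is at most exp (- L t^2 / 4) t ^ (2 K) up to a constant, whose integral
  has order L powr (- K - 1 / 2); the normalising factor restores the half power.\<close>

lemma saddle_core_bound:
  assumes \<beta>: "\<beta> \<ge> 0"
  obtains C where "C \<ge> 0"
    "\<And>w L. \<lbrakk>w \<ge> 1; L \<ge> 1\<rbrakk> \<Longrightarrow> set_integrable lborel saddle_core (saddle_integrand \<beta> w L)"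
    "\<And>w L. \<lbrakk>w \<ge> 1; L \<ge> 1\<rbrakk> \<Longrightarrow>
       \<bar>sqrt (L * (1 + 1 / w) / (2 * pi)) * (LINT t:saddle_core|lborel. saddle_integrand \<beta> w L t)
          - (\<Sum>r<K. a_coeff \<beta> r w / (L * w) ^ r)\<bar> \<le> C / L ^ K"
proof -
  obtain C where C: "C \<ge> 0" "\<And>w L t. \<lbrakk>w \<ge> 1; L \<ge> 0; \<bar>t\<bar> \<le> 1 / 8192\<rbrakk> \<Longrightarrow>
       \<bar>exp (\<beta> * ln (1 + t)) * exp (L * saddle_phase w t + L * (1 + 1 / w) / 2 * t ^ 2)
          - (\<Sum>N<2 * K. saddle_coeff \<beta> w N (L * t ^ 2) * t ^ N)\<bar> \<le> C * exp (L * t ^ 2 / 4) * \<bar>t\<bar> ^ (2 * K)"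
    "\<And>w L t. \<lbrakk>w \<ge> 1; L \<ge> 0; \<bar>t\<bar> > 1 / 8192\<rbrakk> \<Longrightarrow>
       \<bar>\<Sum>N<2 * K. saddle_coeff \<beta> w N (L * t ^ 2) * t ^ N\<bar> \<le> C * exp (L * t ^ 2 / 4) * \<bar>t\<bar> ^ (2 * K)"
    using saddle_taylor [OF \<beta>, of "2 * K"] by blast
  define M where "M = fact (2 * K) / (2 ^ K * fact K) * (2 ^ K :: real)"
  have M: "M \<ge> 0" by (simp add: M_def)
  define D where "D = 2 * C * M"
  have main: "integrable lborel (\<lambda>t. indicator saddle_core t * (saddle_integrand \<beta> w L t))
     \<and> \<bar>sqrt (L * (1 + 1 / w) / (2 * pi)) * (LINT t|lborel. indicator saddle_core t * (saddle_integrand \<beta> w L t))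
          - (\<Sum>r<K. a_coeff \<beta> r w / (L * w) ^ r)\<bar> \<le> D / L ^ K"
    if w: "w \<ge> 1" and L: "L \<ge> 1" for w L
  proof -
    define A where "A = L * (1 + 1 / w)"
    have A: "A \<ge> L" "A \<le> 2 * L" "A > 0" using L w by (auto simp: A_def add_pos_pos field_simps)
    define f where "f t = indicator saddle_core t * (saddle_integrand \<beta> w L t)" for t
    define g where "g t = exp (- A * t ^ 2 / 2) * saddle_poly \<beta> w L (2 * K) t" for t
    define S where "S = (\<Sum>r<K. a_coeff \<beta> r w / (L * w) ^ r)"
    have g: "has_bochner_integral lborel g (sqrt (2 * pi / A) * S)"
      unfolding g_def S_def A_def by (rule has_bochner_integral_saddle_poly) (use L w in auto)
    have fm: "f \<in> borel_measurable lborel"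
      unfolding f_def saddle_phase_def by measurable
    \<comment> \<open>A Gaussian with parameter L / 2: what is left of exp (- L t^2 / 2) after the
      factor exp (L t^2 / 4) of the Taylor error.\<close>
    define h where "h t = C * (exp (- (L / 2) * t ^ 2 / 2) * t ^ (2 * K))" for t
    have h: "has_bochner_integral lborel h (C * (sqrt (2 * pi / (L / 2)) * (fact (2 * K) / (2 ^ K * fact K)) / (L / 2) ^ K))"
      unfolding h_def by (intro has_bochner_integral_mult_right gaussian_moments) (use L in auto)
    have bd: "\<bar>f t - g t\<bar> \<le> h t" for t
    proof -
      have 1: "\<bar>exp (A * t ^ 2 / 2) * f t - saddle_poly \<beta> w L (2 * K) t\<bar> \<le> C * exp (L * t ^ 2 / 4) * \<bar>t\<bar> ^ (2 * K)"
      proof (cases "\<bar>t\<bar> \<le> 1 / 8192")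
        case True
        hence "t \<in> saddle_core" by auto
        hence "f t = saddle_integrand \<beta> w L t"
          unfolding f_def by (simp only: indicator_simps mult_1)
        hence "exp (A * t ^ 2 / 2) * f t = exp (\<beta> * ln (1 + t)) * exp (L * saddle_phase w t + L * (1 + 1 / w) / 2 * t ^ 2)"
          by (simp add: A_def exp_add mult_ac)
        thus ?thesis using C(2) [of w L t] w L True by (simp add: saddle_poly_def)
      next
        case False
        hence "f t = 0" by (auto simp: f_def indicator_def)
        thus ?thesis using C(3) [of w L t] w L False by (simp add: saddle_poly_def)
      qed
      have "f t - g t = exp (- A * t ^ 2 / 2) * (exp (A * t ^ 2 / 2) * f t - saddle_poly \<beta> w L (2 * K) t)"
        by (simp add: g_def algebra_simps exp_minus)
      hence "\<bar>f t - g t\<bar> = exp (- A * t ^ 2 / 2) * \<bar>exp (A * t ^ 2 / 2) * f t - saddle_poly \<beta> w L (2 * K) t\<bar>"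
        by (simp add: abs_mult)
      also have "\<dots> \<le> exp (- L * t ^ 2 / 2) * (C * exp (L * t ^ 2 / 4) * \<bar>t\<bar> ^ (2 * K))"
        using A 1 by (intro mult_mono) (auto intro!: mult_right_mono)
      also have "\<dots> = C * ((exp (- L * t ^ 2 / 2) * exp (L * t ^ 2 / 4)) * t ^ (2 * K))"
        by (simp add: power_even_abs)
      also have "exp (- L * t ^ 2 / 2) * exp (L * t ^ 2 / 4) = exp (- (L / 2) * t ^ 2 / 2)"
        by (simp add: exp_add [symmetric])
      finally show ?thesis by (simp add: h_def)
    qed
    have hi: "integrable lborel h" and gi: "integrable lborel g"
      using h g by (auto intro: integrable.intros)
    have gm: "g \<in> borel_measurable lborel" using gi by (rule borel_measurable_integrable)
    have di: "integrable lborel (\<lambda>t. f t - g t)"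
    proof (rule Bochner_Integration.integrable_bound [OF hi])
      show "(\<lambda>t. f t - g t) \<in> borel_measurable lborel" using fm gm by (rule borel_measurable_diff)
      show "AE t in lborel. norm (f t - g t) \<le> norm (h t)"
        using bd by (intro AE_I2) (metis abs_ge_self order.trans real_norm_def)
    qed
    hence "integrable lborel (\<lambda>t. (f t - g t) + g t)" using gi by (rule Bochner_Integration.integrable_add)
    hence fi: "integrable lborel f" by simp
    have "\<bar>(LINT t|lborel. f t - g t)\<bar> \<le> (LINT t|lborel. h t)"
      using Bochner_Integration.integral_norm_bound_integral [OF di hi] bd by simp
    moreover have "(LINT t|lborel. f t - g t) = (LINT t|lborel. f t) - sqrt (2 * pi / A) * S"
      using fi gi has_bochner_integral_integral_eq [OF g] by simp
    ultimately have e: "\<bar>(LINT t|lborel. f t) - sqrt (2 * pi / A) * S\<bar> \<le> C * (sqrt (2 * pi / (L / 2)) * (fact (2 * K) / (2 ^ K * fact K)) / (L / 2) ^ K)"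
      using has_bochner_integral_integral_eq [OF h] by simp
    have sA: "sqrt (A / (2 * pi)) * sqrt (2 * pi / A) = 1"
      using A by (simp add: real_sqrt_mult [symmetric])
    have "sqrt (A / (2 * pi)) * (LINT t|lborel. f t) - S = sqrt (A / (2 * pi)) * ((LINT t|lborel. f t) - sqrt (2 * pi / A) * S)"
      using sA by (simp add: right_diff_distrib mult.assoc [symmetric])
    hence "\<bar>sqrt (A / (2 * pi)) * (LINT t|lborel. f t) - S\<bar> = sqrt (A / (2 * pi)) * \<bar>(LINT t|lborel. f t) - sqrt (2 * pi / A) * S\<bar>"
      using A by (simp add: abs_mult)
    also have "\<dots> \<le> sqrt (A / (2 * pi)) * (C * (sqrt (2 * pi / (L / 2)) * (fact (2 * K) / (2 ^ K * fact K)) / (L / 2) ^ K))"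
      using e A by (intro mult_left_mono) auto
    also have "\<dots> = (sqrt (A / (2 * pi)) * sqrt (2 * pi / (L / 2))) * (C * M / L ^ K)"
      by (simp add: M_def power_divide)
    also have "\<dots> \<le> 2 * (C * M / L ^ K)"
    proof (rule mult_right_mono)
      have "sqrt (A / (2 * pi)) * sqrt (2 * pi / (L / 2)) = sqrt (2 * A / L)"
        using L A by (simp add: real_sqrt_mult [symmetric])
      also have "\<dots> \<le> sqrt (2 ^ 2)" using A L by (intro real_sqrt_le_mono) (auto simp: field_simps)
      finally show "sqrt (A / (2 * pi)) * sqrt (2 * pi / (L / 2)) \<le> 2" by simp
    qed (use C M L in auto)
    finally show ?thesis using fi by (simp add: D_def A_def S_def f_def [abs_def])
  qed
  show ?thesis
  proof (rule that [of D])
    show "D \<ge> 0" using C M by (simp add: D_def)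
  qed (use main in \<open>auto simp: set_integrable_def set_lebesgue_integral_def\<close>)
qed

text \<open>A crude bound, used only where an exponentially small factor in L is available.\<close>

lemma saddle_normalisation_le:
  assumes w: "w \<ge> 1" and L: "L \<ge> 1"
  shows "sqrt (L * (1 + 1 / w) / (2 * pi)) \<le> L"
proof -
  have "1 / w \<le> 1" using w by simp
  hence "1 + 1 / w \<le> 2 * pi" using pi_gt3 by linarith
  hence "L * (1 + 1 / w) \<le> L * (2 * pi)" using L by (intro mult_left_mono) auto
  hence "L * (1 + 1 / w) / (2 * pi) \<le> L * 1" by (simp add: field_simps)
  also have "\<dots> \<le> L * L" using L by (intro mult_left_mono) auto
  finally have "sqrt (L * (1 + 1 / w) / (2 * pi)) \<le> sqrt (L * L)" by (rule real_sqrt_le_mono)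
  thus ?thesis using L by simp
qed

text \<open>Of the L copies of the phase, L - 1 are each bounded by - c, giving exponential
  smallness in L. The last copy is kept as ln (1 + t) - t and makes the integral converge, to a
  Gamma value independent of w and L.\<close>

lemma saddle_outer_bound:
  assumes \<beta>: "\<beta> \<ge> 0"
  obtains C where "C \<ge> 0"
    "\<And>w L. \<lbrakk>w \<ge> 1; L \<ge> 1\<rbrakk> \<Longrightarrow> set_integrable lborel (saddle_outer w) (saddle_integrand \<beta> w L)"
    "\<And>w L. \<lbrakk>w \<ge> 1; L \<ge> 1\<rbrakk> \<Longrightarrow>
       \<bar>sqrt (L * (1 + 1 / w) / (2 * pi)) * (LINT t:saddle_outer w|lborel. saddle_integrand \<beta> w L t)\<bar> \<le> C / L ^ K"
proof -
  \<comment> \<open>The gap of \<open>ln_le_minus_gap\<close> at the edge of the core.\<close>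
  define c :: real where "c = (1 / 8192) ^ 2 / 9"
  have c: "c > 0" by (simp add: c_def)
  define G where "G t = indicator {- 1<..} t * (exp ((\<beta> + 1) * ln (1 + t)) * exp (- t))" for t :: real
  have G: "has_bochner_integral lborel G (Gamma (\<beta> + 2) * exp 1)"
  proof -
    define H where "H x = indicator {0<..} x * (exp ((\<beta> + 2 - 1) * ln x) * exp (- 1 * x))" for x :: real
    have "has_bochner_integral lborel H (Gamma (\<beta> + 2) * exp (- (\<beta> + 2) * ln 1))"
      unfolding H_def by (rule has_bochner_integral_Gamma_real) (use \<beta> in auto)
    hence "has_bochner_integral lborel (\<lambda>x. H (1 + 1 * x)) (Gamma (\<beta> + 2))"
      using lborel_has_bochner_integral_real_affine_iff [of 1 H "Gamma (\<beta> + 2)" 1] by simp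
    hence "has_bochner_integral lborel (\<lambda>x. H (1 + 1 * x) * exp 1) (Gamma (\<beta> + 2) * exp 1)"
      by (rule has_bochner_integral_mult_left)
    also have "(\<lambda>x. H (1 + 1 * x) * exp 1) = G"
      by (auto simp: H_def G_def fun_eq_iff indicator_def exp_add [symmetric] add.commute)
    finally show ?thesis .
  qed
  define I where "I = Gamma (\<beta> + 2) * exp 1"
  have I: "I \<ge> 0" using \<beta> by (auto simp: I_def intro!: mult_nonneg_nonneg Gamma_real_nonneg)
  define D where "D = exp c * (fact (K + 1) * (2 / c) ^ (K + 1)) * I"
  have main: "integrable lborel (\<lambda>t. indicator (saddle_outer w) t * (saddle_integrand \<beta> w L t))
     \<and> \<bar>sqrt (L * (1 + 1 / w) / (2 * pi)) * (LINT t|lborel. indicator (saddle_outer w) t * (saddle_integrand \<beta> w L t))\<bar> \<le> D / L ^ K"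
    if w: "w \<ge> 1" and L: "L \<ge> 1" for w L
  proof -
    define f where "f t = indicator (saddle_outer w) t * (saddle_integrand \<beta> w L t)" for t
    have fm: "f \<in> borel_measurable lborel"
      unfolding f_def saddle_phase_def by measurable
    define h where "h t = exp (- c * (L - 1)) * G t" for t
    have h: "has_bochner_integral lborel h (exp (- c * (L - 1)) * I)"
      unfolding h_def I_def by (intro has_bochner_integral_mult_right G)
    have bd: "\<bar>f t\<bar> \<le> h t" for t
    proof (cases "t \<in> saddle_outer w")
      case True
      hence t: "t > exp (- w) - 1" "\<bar>t\<bar> \<ge> 1 / 8192" by auto
      have t1: "t > - 1" using t(1) exp_gt_zero [of "- w"] by linarith
      have p: "saddle_phase w t \<le> ln (1 + t) - t" using w t by (intro saddle_phase_le) auto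
      moreover have "ln (1 + t) - t \<le> - c"
        unfolding c_def by (rule ln_le_minus_gap) (use t1 t in auto)
      ultimately have "(L - 1) * saddle_phase w t \<le> (L - 1) * (- c)"
        using L by (intro mult_left_mono) auto
      hence "L * saddle_phase w t \<le> - c * (L - 1) + (ln (1 + t) - t)"
        using p by (simp add: algebra_simps)
      hence "saddle_integrand \<beta> w L t \<le> exp (\<beta> * ln (1 + t)) * exp (- c * (L - 1) + (ln (1 + t) - t))"
        by simp
      also have "\<dots> = exp (- c * (L - 1)) * (exp ((\<beta> + 1) * ln (1 + t)) * exp (- t))"
        unfolding exp_add [symmetric] by (simp add: algebra_simps)
      finally show ?thesis using True t1 by (simp add: f_def h_def G_def)
    next
      case False
      thus ?thesis by (simp add: f_def h_def G_def)
    qed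
    have hi: "integrable lborel h" using h by (rule integrable.intros)
    have fi: "integrable lborel f"
    proof (rule Bochner_Integration.integrable_bound [OF hi fm])
      show "AE t in lborel. norm (f t) \<le> norm (h t)"
        using bd by (intro AE_I2) (metis abs_ge_self order.trans real_norm_def)
    qed
    have "\<bar>(LINT t|lborel. f t)\<bar> \<le> exp (- c * (L - 1)) * I"
      using Bochner_Integration.integral_norm_bound_integral [OF fi hi] bd has_bochner_integral_integral_eq [OF h] by simp
    moreover have "sqrt (L * (1 + 1 / w) / (2 * pi)) \<le> L" by (rule saddle_normalisation_le [OF w L])
    ultimately have "\<bar>sqrt (L * (1 + 1 / w) / (2 * pi)) * (LINT t|lborel. f t)\<bar> \<le> L * (exp (- c * (L - 1)) * I)"
      unfolding abs_mult using L w I by (intro mult_mono) auto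
    also have "\<dots> = exp c * I * (L ^ (K + 1) * exp (- c * L)) / L ^ K"
      using L by (simp add: exp_add [symmetric] algebra_simps)
    also have "\<dots> \<le> exp c * I * (fact (K + 1) * (2 / c) ^ (K + 1) * 1) / L ^ K"
    proof (intro divide_right_mono mult_left_mono)
      have "L ^ (K + 1) * exp (- c * L) \<le> fact (K + 1) * (2 / c) ^ (K + 1) * exp (- (c / 2) * L)"
        using L c by (intro power_mult_exp_le) auto
      also have "\<dots> \<le> fact (K + 1) * (2 / c) ^ (K + 1) * 1"
        using c L by (intro mult_left_mono) auto
      finally show "L ^ (K + 1) * exp (- c * L) \<le> fact (K + 1) * (2 / c) ^ (K + 1) * 1" .
    qed (use I L in auto)
    also have "\<dots> = D / L ^ K" by (simp add: D_def)
    finally show ?thesis using fi by (simp add: f_def [abs_def])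
  qed
  show ?thesis
  proof (rule that [of D])
    show "D \<ge> 0" using I c by (simp add: D_def)
  qed (use main in \<open>auto simp: set_integrable_def set_lebesgue_integral_def\<close>)
qed

theorem saddle_J_expansion:
  assumes \<beta>: "\<beta> \<ge> 0"
  obtains C where "C \<ge> 0"
    "\<And>w L. \<lbrakk>w \<ge> 1; L \<ge> 1\<rbrakk> \<Longrightarrow>
       \<bar>sqrt (L * (1 + 1 / w) / (2 * pi)) * saddle_J \<beta> w L - (\<Sum>r<K. a_coeff \<beta> r w / (L * w) ^ r)\<bar> \<le> C / L ^ K"
proof -
  obtain C1 where C1: "C1 \<ge> 0"
    "\<And>w L. \<lbrakk>w \<ge> 1; L \<ge> 1\<rbrakk> \<Longrightarrow> set_integrable lborel saddle_core (saddle_integrand \<beta> w L)"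
    "\<And>w L. \<lbrakk>w \<ge> 1; L \<ge> 1\<rbrakk> \<Longrightarrow>
       \<bar>sqrt (L * (1 + 1 / w) / (2 * pi)) * (LINT t:saddle_core|lborel. saddle_integrand \<beta> w L t)
          - (\<Sum>r<K. a_coeff \<beta> r w / (L * w) ^ r)\<bar> \<le> C1 / L ^ K"
    using saddle_core_bound [OF \<beta>, of K] by blast
  obtain C2 where C2: "C2 \<ge> 0"
    "\<And>w L. \<lbrakk>w \<ge> 1; L \<ge> 1\<rbrakk> \<Longrightarrow> set_integrable lborel (saddle_outer w) (saddle_integrand \<beta> w L)"
    "\<And>w L. \<lbrakk>w \<ge> 1; L \<ge> 1\<rbrakk> \<Longrightarrow>
       \<bar>sqrt (L * (1 + 1 / w) / (2 * pi)) * (LINT t:saddle_outer w|lborel. saddle_integrand \<beta> w L t)\<bar> \<le> C2 / L ^ K"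
    using saddle_outer_bound [OF \<beta>, of K] by blast
  show ?thesis
  proof (rule that [of "C1 + C2"])
    fix w L :: real assume w: "w \<ge> 1" and L: "L \<ge> 1"
    define F where "F t = saddle_integrand \<beta> w L t" for t
    define q where "q = sqrt (L * (1 + 1 / w) / (2 * pi))"
    \<comment> \<open>For \<open>w \<ge> 1\<close> the domain starts below - 1 / 2, so it contains
      the whole core.\<close>
    have "exp (- w) \<le> exp (- 1)" using w by simp
    also have "exp (- 1 :: real) \<le> 1 / 2" using exp_ge_add_one_self [of 1] by (simp add: exp_minus field_simps)
    finally have "{exp (- w) - 1<..} = saddle_core \<union> (saddle_outer w)" by auto
    hence "saddle_J \<beta> w L = (LINT t:saddle_core \<union> (saddle_outer w)|lborel. F t)"
      unfolding saddle_J_def F_def by simp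
    also have "\<dots> = (LINT t:saddle_core|lborel. F t) + (LINT t:saddle_outer w|lborel. F t)"
      unfolding F_def using C1(2) [OF w L] C2(2) [OF w L] by (intro set_integral_Un) auto
    finally have "q * saddle_J \<beta> w L = q * (LINT t:saddle_core|lborel. F t) + q * (LINT t:saddle_outer w|lborel. F t)"
      by (simp add: distrib_left)
    thus "\<bar>q * saddle_J \<beta> w L - (\<Sum>r<K. a_coeff \<beta> r w / (L * w) ^ r)\<bar> \<le> (C1 + C2) / L ^ K"
      using C1(3) [OF w L, folded F_def q_def] C2(3) [OF w L, folded F_def q_def]
      unfolding add_divide_distrib by linarith
  qed (use C1 C2 in simp)
qed

section \<open>The coefficients\<close>

text \<open>The denominator must not vanish on the positive axis, so that division by zero cannot
  make the equation hold by convention.\<close>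

definition is_rational :: "(real \<Rightarrow> real) \<Rightarrow> bool" where
  "is_rational f \<longleftrightarrow> (\<exists>P Q :: real poly. \<forall>w>0. poly Q w \<noteq> 0 \<and> f w = poly P w / poly Q w)"

lemma is_rational_const: "is_rational (\<lambda>_. c)"
  unfolding is_rational_def by (rule exI [of _ "[:c:]"], rule exI [of _ 1]) simp

lemma is_rational_ident: "is_rational (\<lambda>w. w)"
  unfolding is_rational_def by (rule exI [of _ "[:0, 1:]"], rule exI [of _ 1]) simp

lemma is_rational_mult:
  assumes "is_rational f" "is_rational g" shows "is_rational (\<lambda>w. f w * g w)"
proof -
  obtain P Q R S where "\<forall>w>0. poly Q w \<noteq> 0 \<and> f w = poly P w / poly Q w"
    "\<forall>w>0. poly S w \<noteq> 0 \<and> g w = poly R w / poly S w"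
    using assms unfolding is_rational_def by blast
  thus ?thesis unfolding is_rational_def
    by (intro exI [of _ "P * R"] exI [of _ "Q * S"]) auto
qed

lemma is_rational_add:
  assumes "is_rational f" "is_rational g" shows "is_rational (\<lambda>w. f w + g w)"
proof -
  obtain P Q R S where "\<forall>w>0. poly Q w \<noteq> 0 \<and> f w = poly P w / poly Q w"
    "\<forall>w>0. poly S w \<noteq> 0 \<and> g w = poly R w / poly S w"
    using assms unfolding is_rational_def by blast
  thus ?thesis unfolding is_rational_def
    by (intro exI [of _ "P * S + R * Q"] exI [of _ "Q * S"]) (auto simp: field_simps)
qed

lemma is_rational_divide:
  assumes "is_rational f" "is_rational g" "\<And>w. w > 0 \<Longrightarrow> g w \<noteq> 0"
  shows "is_rational (\<lambda>w. f w / g w)"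
proof -
  obtain P Q R S where *: "\<forall>w>0. poly Q w \<noteq> 0 \<and> f w = poly P w / poly Q w"
    "\<forall>w>0. poly S w \<noteq> 0 \<and> g w = poly R w / poly S w"
    using assms(1,2) unfolding is_rational_def by blast
  have "poly R w \<noteq> 0" if "w > 0" for w using *(2) assms(3) [OF that] that by auto
  thus ?thesis unfolding is_rational_def using *
    by (intro exI [of _ "P * S"] exI [of _ "Q * R"]) auto
qed

lemma is_rational_diff:
  assumes "is_rational f" "is_rational g" shows "is_rational (\<lambda>w. f w - g w)"
  using is_rational_add [OF assms(1) is_rational_mult [OF is_rational_const [of "-1"] assms(2)]] by simp

lemma is_rational_power: "is_rational f \<Longrightarrow> is_rational (\<lambda>w. f w ^ k)"
  by (induction k) (auto intro: is_rational_const is_rational_mult)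

lemma is_rational_sum: "(\<And>i. i \<in> A \<Longrightarrow> is_rational (f i)) \<Longrightarrow> is_rational (\<lambda>w. \<Sum>i\<in>A. f i w)"
  by (induction A rule: infinite_finite_induct) (auto intro: is_rational_const is_rational_add)

lemma is_rational_fps_nth_power:
  assumes "\<And>k. is_rational (\<lambda>w. p w k)"
  shows "is_rational (\<lambda>w. fps_nth (Abs_fps (p w) ^ j) i)"
proof (induction j arbitrary: i)
  case (Suc j)
  show ?case by (simp add: fps_mult_nth) (intro is_rational_sum is_rational_mult assms Suc)
qed (simp add: fps_one_nth is_rational_const)

lemma is_rational_ord_bell:
  assumes "\<And>k. is_rational (\<lambda>w. p w k)"
  shows "is_rational (\<lambda>w. ord_bell i j (p w))"
  unfolding ord_bell_def
proof (rule is_rational_fps_nth_power)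
  show "is_rational (\<lambda>w. if k = 0 then 0 else p w k)" for k
    using assms by (cases k) (auto intro: is_rational_const)
qed

lemma is_rational_ell: "is_rational (ell i)"
  unfolding ell_def [abs_def]
  by (intro is_rational_sum is_rational_mult is_rational_divide is_rational_const is_rational_power is_rational_ident) auto

lemma is_rational_a_coeff: "is_rational (a_coeff \<beta> r)"
  unfolding a_coeff_def [abs_def]
  by (intro is_rational_sum is_rational_mult is_rational_divide is_rational_const is_rational_power
        is_rational_ident is_rational_ord_bell is_rational_ell is_rational_add) auto

lemma is_rational_mu: "is_rational (mu k)"
proof -
  have "is_rational (\<lambda>w. if k = 0 then 0 else a_coeff (1 / 4) (k - 1) w)"
    by (cases "k = 0") (auto intro: is_rational_const is_rational_a_coeff)
  thus ?thesis unfolding mu_def [abs_def]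
    by (intro is_rational_diff is_rational_mult is_rational_const is_rational_ident is_rational_a_coeff)
qed

section \<open>Growth of the coefficients, uniformly in w\<close>

lemma abs_fps_nth_power_le:
  fixes f g :: "nat \<Rightarrow> real"
  assumes "\<And>k. \<bar>f k\<bar> \<le> g k"
  shows "\<bar>fps_nth (Abs_fps f ^ j) i\<bar> \<le> fps_nth (Abs_fps g ^ j) i"
proof (induction j arbitrary: i)
  case (Suc j)
  have "\<bar>fps_nth (Abs_fps f ^ Suc j) i\<bar> \<le> (\<Sum>k=0..i. \<bar>f k * fps_nth (Abs_fps f ^ j) (i - k)\<bar>)"
    by (simp add: fps_mult_nth sum_abs)
  also have "\<dots> \<le> (\<Sum>k=0..i. g k * fps_nth (Abs_fps g ^ j) (i - k))"
    unfolding abs_mult by (intro sum_mono mult_mono assms Suc order.trans [OF abs_ge_zero assms]) auto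
  finally show ?case by (simp add: fps_mult_nth)
qed (simp add: fps_one_nth)

text \<open>Homogeneity of degree j; it lets a factor w ^ j be moved onto the arguments
  \<open>ell\<close>.\<close>

lemma ord_bell_mult: "ord_bell i j (\<lambda>k. c * p k) = c ^ j * ord_bell i j p"
proof -
  have "Abs_fps (\<lambda>k. if k = 0 then 0 else c * p k) = fps_const c * Abs_fps (\<lambda>k. if k = 0 then 0 else p k)"
    by (rule fps_ext) simp
  thus ?thesis by (simp add: ord_bell_def power_mult_distrib fps_const_power)
qed

text \<open>The factor (w^2 / (w + 1)) ^ (j + r) is at most w^j * w^r. By homogeneity w^j turns each
  \<open>ell\<close> into w * \<open>ell\<close>, which is bounded uniformly in w, so that only w^r
  remains.\<close>

lemma a_coeff_bound:
  obtains D where "D \<ge> 0" "\<And>w. w \<ge> 1 \<Longrightarrow> \<bar>a_coeff \<beta> r w\<bar> \<le> D * w ^ r"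
proof -
  define B where "B i j = ord_bell i j (\<lambda>k. 8 ^ (k + 2))" for i j
  define G where "G j = (\<Sum>i=j..2*r. B i j * \<bar>\<beta> gchoose (2 * r - i)\<bar>)" for j
  define D where "D = (\<Sum>j=0..2*r. real (double_fact (2 * j + 2 * r - 1)) / fact j * G j)"
  have ob: "w ^ j * \<bar>ord_bell i j (\<lambda>k. ell (k + 2) w)\<bar> \<le> B i j" if w: "w \<ge> 1" for w i j
  proof -
    have "\<bar>ord_bell i j (\<lambda>k. w * ell (k + 2) w)\<bar> \<le> B i j"
      unfolding B_def ord_bell_def
    proof (rule abs_fps_nth_power_le)
      show "\<bar>if k = 0 then 0 else w * ell (k + 2) w\<bar> \<le> (if k = 0 then 0 else 8 ^ (k + 2))" for k
        using ell_bound [OF w, of "k + 2"] by (simp only: abs_zero order.refl split: if_split) blast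
    qed
    thus ?thesis using w by (simp add: ord_bell_mult abs_mult)
  qed
  have B0: "B i j \<ge> 0" for i j using ob [OF order.refl, of j i] by (rule order.trans [rotated]) simp
  show ?thesis
  proof (rule that [of D])
    show "D \<ge> 0" unfolding D_def G_def by (intro sum_nonneg mult_nonneg_nonneg B0) auto
    fix w :: real assume w: "w \<ge> 1"
    have "\<bar>a_coeff \<beta> r w\<bar> \<le> (\<Sum>j=0..2*r. \<bar>real (double_fact (2 * j + 2 * r - 1)) / fact j * (w\<^sup>2 / (w + 1)) ^ (j + r) *
        (\<Sum>i=j..2*r. ord_bell i j (\<lambda>k. ell (k + 2) w) * (\<beta> gchoose (2 * r - i)))\<bar>)"
      unfolding a_coeff_def by (rule sum_abs)
    also have "\<dots> \<le> (\<Sum>j=0..2*r. real (double_fact (2 * j + 2 * r - 1)) / fact j * G j * w ^ r)"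
    proof (rule sum_mono)
      fix j
      have "w\<^sup>2 / (w + 1) \<le> w" using w by (simp add: divide_le_eq power2_eq_square)
      hence p: "(w\<^sup>2 / (w + 1)) ^ (j + r) \<le> w ^ (j + r)" using w by (intro power_mono) auto
      define S where "S = \<bar>\<Sum>i=j..2*r. ord_bell i j (\<lambda>k. ell (k + 2) w) * (\<beta> gchoose (2 * r - i))\<bar>"
      have "S \<le>
          (\<Sum>i=j..2*r. \<bar>ord_bell i j (\<lambda>k. ell (k + 2) w)\<bar> * \<bar>\<beta> gchoose (2 * r - i)\<bar>)"
        unfolding S_def abs_mult [symmetric] by (rule sum_abs)
      hence "w ^ j * S \<le>
          w ^ j * (\<Sum>i=j..2*r. \<bar>ord_bell i j (\<lambda>k. ell (k + 2) w)\<bar> * \<bar>\<beta> gchoose (2 * r - i)\<bar>)"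
        using w by (intro mult_left_mono) auto
      also have "\<dots> \<le> G j"
        unfolding G_def sum_distrib_left mult.assoc [symmetric] using ob [OF w]
        by (intro sum_mono mult_right_mono) auto
      finally have s: "w ^ j * S \<le> G j" .
      define X where "X = (w\<^sup>2 / (w + 1)) ^ (j + r)"
      have X: "X \<ge> 0" "X \<le> w ^ (j + r)" using p w by (auto simp: X_def)
      have "X * S \<le> w ^ (j + r) * S" using X by (intro mult_right_mono) (auto simp: S_def)
      also have "\<dots> = (w ^ j * S) * w ^ r" by (simp add: power_add)
      also have "\<dots> \<le> G j * w ^ r"
        using s w by (intro mult_right_mono) auto
      finally have "real (double_fact (2 * j + 2 * r - 1)) / fact j * (X * S) \<le> real (double_fact (2 * j + 2 * r - 1)) / fact j * (G j * w ^ r)"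
        by (intro mult_left_mono) auto
      thus "\<bar>real (double_fact (2 * j + 2 * r - 1)) / fact j * (w\<^sup>2 / (w + 1)) ^ (j + r) *
        (\<Sum>i=j..2*r. ord_bell i j (\<lambda>k. ell (k + 2) w) * (\<beta> gchoose (2 * r - i)))\<bar> \<le>
        real (double_fact (2 * j + 2 * r - 1)) / fact j * G j * w ^ r"
        using X(1) unfolding abs_mult S_def [symmetric] X_def [symmetric] by (simp add: mult.assoc)
    qed
    also have "\<dots> = D * w ^ r" by (simp add: D_def sum_distrib_right)
    finally show "\<bar>a_coeff \<beta> r w\<bar> \<le> D * w ^ r" .
  qed
qed

lemma mu_bound:
  obtains D where "D \<ge> 0" "\<And>w. w \<ge> 1 \<Longrightarrow> \<bar>mu k w\<bar> \<le> D * w ^ k"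
proof -
  obtain D1 where D1: "D1 \<ge> 0" "\<And>w. w \<ge> 1 \<Longrightarrow> \<bar>a_coeff (5 / 4) k w\<bar> \<le> D1 * w ^ k"
    using a_coeff_bound by blast
  obtain D2 where D2: "D2 \<ge> 0" "\<And>w. w \<ge> 1 \<Longrightarrow> \<bar>a_coeff (1 / 4) (k - 1) w\<bar> \<le> D2 * w ^ (k - 1)"
    using a_coeff_bound by blast
  show ?thesis
  proof (rule that [of "2 * D1 + 3 * D2"])
    show "2 * D1 + 3 * D2 \<ge> 0" using D1 D2 by simp
    fix w :: real assume w: "w \<ge> 1"
    define b where "b = (if k = 0 then 0 else a_coeff (1 / 4) (k - 1) w)"
    have b: "w * \<bar>b\<bar> \<le> D2 * w ^ k"
    proof (cases "k = 0")
      case False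
      have "w * \<bar>b\<bar> \<le> w * (D2 * w ^ (k - 1))" using False D2(2) [OF w] w by (simp add: b_def)
      also have "\<dots> = D2 * w ^ k" using False by (cases k) auto
      finally show ?thesis .
    qed (use D2 in \<open>simp add: b_def\<close>)
    have "\<bar>mu k w\<bar> = 1 / 2 ^ (k + 1) * \<bar>2 * a_coeff (5 / 4) k w - 3 * w * b\<bar>"
      by (simp add: mu_def b_def abs_mult)
    also have "\<dots> \<le> 1 * \<bar>2 * a_coeff (5 / 4) k w - 3 * w * b\<bar>"
      using one_le_power [of "2 :: real" "k + 1"] by (intro mult_right_mono) (auto simp: divide_le_eq)
    also have "\<dots> \<le> 2 * \<bar>a_coeff (5 / 4) k w\<bar> + 3 * (w * \<bar>b\<bar>)"
      using w abs_triangle_ineq4 [of "2 * a_coeff (5 / 4) k w" "3 * w * b"] by (simp add: abs_mult)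
    also have "\<dots> \<le> (2 * D1 + 3 * D2) * w ^ k" using D1(2) [OF w] b by (simp add: algebra_simps)
    finally show "\<bar>mu k w\<bar> \<le> (2 * D1 + 3 * D2) * w ^ k" .
  qed
qed

section \<open>The Lambert function and the size of w\<close>

lemma lambert_W_eq:
  assumes "x \<ge> 0"
  shows "lambert_W x \<ge> 0" "lambert_W x * exp (lambert_W x) = x"
proof -
  have sm: "strict_mono_on {0..} (\<lambda>x :: real. x * exp x)"
    by (intro strict_mono_onI mult_strict_mono') auto
  have inj: "inj_on (\<lambda>x :: real. x * exp x) {0..}"
    by (rule strict_mono_on_imp_inj_on [OF sm])
  have "\<exists>w\<ge>0. w \<le> x \<and> w * exp w = x"
  proof (rule IVT')
    show "x \<le> x * exp x" using mult_left_mono [of 1 "exp x" x] assms by simp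
    show "continuous_on {0..x} (\<lambda>w. w * exp w)" by (intro continuous_intros)
  qed (use assms in auto)
  hence im: "x \<in> (\<lambda>x. x * exp x) ` {0..}" by force
  show "lambert_W x * exp (lambert_W x) = x"
    unfolding lambert_W_def using f_the_inv_into_f [OF inj im] .
  show "lambert_W x \<ge> 0"
    using the_inv_into_into [OF inj im order.refl] unfolding lambert_W_def by simp
qed

lemma lambert_W_pos: "x > 0 \<Longrightarrow> lambert_W x > 0"
  using lambert_W_eq [of x] by (cases "lambert_W x = 0") auto

lemma lambert_W_ge:
  assumes "c \<ge> 0" "c * exp c \<le> x" shows "lambert_W x \<ge> c"
proof (rule ccontr)
  assume "\<not> lambert_W x \<ge> c"
  hence lt: "lambert_W x < c" by simp
  have x: "x \<ge> 0" using assms by (meson exp_ge_zero mult_nonneg_nonneg order.trans)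
  have "lambert_W x * exp (lambert_W x) < c * exp c"
    using lt lambert_W_eq(1) [OF x] by (intro mult_strict_mono') auto
  thus False using lambert_W_eq(2) [OF x] assms by simp
qed

lemma eventually_saddle_point:
  "\<forall>\<^sub>F n in sequentially. lambert_W (2 * real n / pi) \<ge> 1 \<and> lambert_W (2 * real n / pi) \<le> ln (real n)"
proof -
  \<comment> \<open>The threshold is the value of x exp x at 1, hence w >= 1; then exp w <= w exp w
    = 2 n / pi <= n bounds w by the logarithm.\<close>
  have "\<forall>\<^sub>F n in sequentially. 2 * real n / pi \<ge> exp 1" by real_asymp
  thus ?thesis
  proof eventually_elim
    case (elim n)
    define w where "w = lambert_W (2 * real n / pi)"
    have w1: "w \<ge> 1" unfolding w_def by (rule lambert_W_ge) (use elim in auto)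
    have n: "n > 0" using elim by (cases n) auto
    have "exp w \<le> w * exp w" using w1 by simp
    also have "\<dots> = 2 * real n / pi" unfolding w_def by (rule lambert_W_eq) simp
    also have "\<dots> \<le> real n" using pi_ge_two n by (simp add: divide_le_eq)
    finally have "w \<le> ln (real n)" using n by (simp add: ln_ge_iff)
    thus ?case using w1 by (simp add: w_def)
  qed
qed

text \<open>Substitution of x = exp w * (1 + t), under which x = 1 becomes t = exp (- w) - 1. The
  Jacobian and x powr \<beta> give exp ((\<beta> + 1) w); pi x = L + L t and 2 n = L w collect the
  rest into the phase.\<close>

lemma saddle_integral_eq:
  assumes w: "w > 0" and L: "L = pi * exp w" "L * w = 2 * real n"
  shows "saddle_integral n \<beta> = exp ((\<beta> + 1) * w) * w ^ (2 * n) * exp (- L) * saddle_J \<beta> w L"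
proof -
  define f where "f x = indicator {1<..} x *\<^sub>R (ln x ^ (2 * n) * exp (\<beta> * ln x) * exp (- pi * x))" for x :: real
  define g where "g t = indicator {exp (- w) - 1<..} t *\<^sub>R (saddle_integrand \<beta> w L t)" for t :: real
  have fg: "exp w * f (exp w + exp w * t) = (exp ((\<beta> + 1) * w) * w ^ (2 * n) * exp (- L)) * g t" for t
  proof (cases "t > exp (- w) - 1")
    case True
    have t1: "1 + t > exp (- w)" using True by simp
    hence t0: "1 + t > 0" using exp_gt_zero less_trans by blast
    have x1: "exp w + exp w * t > 1"
    proof -
      have "exp w * exp (- w) < exp w * (1 + t)" using t1 by (intro mult_strict_left_mono) auto
      thus ?thesis by (simp add: exp_minus algebra_simps)
    qed
    have lx: "ln (exp w + exp w * t) = w + ln (1 + t)"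
    proof -
      have "exp w + exp w * t = exp w * (1 + t)" by (simp add: algebra_simps)
      thus ?thesis using t0 by (simp add: ln_mult)
    qed
    have "w + ln (1 + t) > 0" using x1 lx by (metis ln_gt_zero)
    hence p: "1 + ln (1 + t) / w > 0" using w by (simp add: field_simps)
    have "w + ln (1 + t) = w * (1 + ln (1 + t) / w)" using w by (simp add: field_simps)
    hence "(w + ln (1 + t)) ^ (2 * n) = w ^ (2 * n) * (1 + ln (1 + t) / w) ^ (2 * n)"
      by (simp only: power_mult_distrib)
    also have "(1 + ln (1 + t) / w) ^ (2 * n) = exp (real (2 * n) * ln (1 + ln (1 + t) / w))"
      using p by (simp add: exp_of_nat_mult del: of_nat_mult)
    also have "real (2 * n) * ln (1 + ln (1 + t) / w) = L * (saddle_phase w t + t)"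
      using L(2) by (simp add: saddle_phase_def mult.assoc [symmetric])
    finally have e: "(w + ln (1 + t)) ^ (2 * n) = w ^ (2 * n) * exp (L * (saddle_phase w t + t))" .
    have ex: "- pi * (exp w + exp w * t) = - L - L * t" by (simp add: L(1) algebra_simps)
    have "exp w * f (exp w + exp w * t) = w ^ (2 * n) * (exp w * exp (L * (saddle_phase w t + t)) * exp (\<beta> * (w + ln (1 + t))) * exp (- L - L * t))"
      unfolding f_def using x1 by (simp only: lx e ex) (simp add: mult_ac)
    also have "exp w * exp (L * (saddle_phase w t + t)) * exp (\<beta> * (w + ln (1 + t))) * exp (- L - L * t)
       = exp ((\<beta> + 1) * w) * exp (- L) * (saddle_integrand \<beta> w L t)"
      unfolding exp_add [symmetric] by (simp add: algebra_simps)
    finally show ?thesis using True by (simp add: g_def)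
  next
    case False
    have "exp w * (1 + t) \<le> exp w * exp (- w)" using False by (intro mult_left_mono) auto
    hence "exp w + exp w * t \<le> 1" by (simp add: exp_minus algebra_simps)
    thus ?thesis using False by (simp add: f_def g_def)
  qed
  have "saddle_integral n \<beta> = (LINT x|lborel. f x)"
    unfolding saddle_integral_def set_lebesgue_integral_def f_def ..
  also have "\<dots> = \<bar>exp w\<bar> *\<^sub>R (LINT t|lborel. f (exp w + exp w * t))"
    by (rule lborel_integral_real_affine) simp
  also have "\<dots> = (LINT t|lborel. exp w * f (exp w + exp w * t))" by simp
  also have "\<dots> = (exp ((\<beta> + 1) * w) * w ^ (2 * n) * exp (- L)) * (LINT t|lborel. g t)"
    unfolding fg by simp
  finally show ?thesis unfolding saddle_J_def set_lebesgue_integral_def g_def .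
qed

text \<open>Since y exp (- 2 y) is maximal at y = 1/2, the terms of the theta series beyond the first
  lose a factor 2 powr - L against the main term.\<close>
lemma xi_rest_bound:
  obtains C where "C \<ge> 0" "\<And>n w L. \<lbrakk>n \<ge> 1; w > 0; L = pi * exp w; L * w = 2 * real n\<rbrakk> \<Longrightarrow>
    \<bar>rest_integral n\<bar>
      \<le> C * (w ^ (2 * n) * exp (- L) * exp (- ln 2 * L))"
proof -
  obtain C where C: "C > 0" "\<And>x. x \<ge> 1 \<Longrightarrow> \<bar>omega_rest x\<bar> \<le> C * exp (- 3 * pi * x)"
    using omega_rest_bound by blast
  define I where "I = Gamma 1 * exp (- 1 * ln pi)"
  show ?thesis
  proof (rule that [of "C * I"])
    show "C * I \<ge> 0" using C by (simp add: I_def)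
    fix n :: nat and w L :: real
    assume n: "n \<ge> 1" and w: "w > 0" and L: "L = pi * exp w" "L * w = 2 * real n"
    define Q where "Q = w ^ (2 * n) * exp (- L) * exp (- ln 2 * L)"
    have Lp: "L > 0" using L by simp
    have Q: "Q \<ge> 0" using w by (simp add: Q_def)
    define f where "f x = indicator {1<..} x *\<^sub>R (ln x ^ (2 * n) * exp (- (3 / 4) * ln x) * omega_rest x)" for x :: real
    define g where "g x = C * Q * (indicator {0<..} x * (exp ((1 - 1) * ln x) * exp (- pi * x)))" for x :: real
    have g: "has_bochner_integral lborel g (C * Q * I)"
      unfolding g_def I_def by (intro has_bochner_integral_mult_right has_bochner_integral_Gamma_real) auto
    have "set_integrable lborel {1<..} (\<lambda>x. ln x ^ (2 * n) * exp (- (3 / 4) * ln x) * omega_rest x)"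
      by (rule xi_moment_decomp(1) [OF n])
    hence fi: "integrable lborel f" by (simp add: set_integrable_def f_def [abs_def])
    have "norm (f x) \<le> g x" for x
    proof (cases "x > 1")
      case True
      define y where "y = x / exp w"
      have y: "y > 0" using True by (simp add: y_def)
      have ly: "ln y = ln x - w" using True by (simp add: y_def ln_div)
      \<comment> \<open>From 1 + u <= exp u with u = ln y / w, raised to the power 2 n = L w, the
        logarithmic power is at most w ^ (2 n) * y powr L.\<close>
      have "ln x / w = 1 + ln y / w" using w by (simp add: ly field_simps)
      also have "\<dots> \<le> exp (ln y / w)" by (rule exp_ge_add_one_self)
      finally have "(ln x / w) ^ (2 * n) \<le> exp (ln y / w) ^ (2 * n)"
        using True w by (intro power_mono) auto
      also have "\<dots> = exp (real (2 * n) * (ln y / w))" by (rule exp_of_nat_mult [symmetric])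
      also have "real (2 * n) * (ln y / w) = L * ln y" using L(2) w by (simp add: field_simps)
      finally have "ln x ^ (2 * n) \<le> w ^ (2 * n) * exp (L * ln y)"
        using w by (simp add: power_divide divide_le_eq mult.commute)
      moreover have "L * ln y \<le> - L - ln 2 * L + 2 * pi * x"
      proof -
        have "ln (2 * y) \<le> 2 * y - 1" using y by (intro ln_le_minus_one) auto
        hence "ln y \<le> 2 * y - 1 - ln 2" using y by (simp add: ln_mult)
        hence "L * ln y \<le> L * (2 * y - 1 - ln 2)" using Lp by (intro mult_left_mono) auto
        also have "\<dots> = - L - ln 2 * L + 2 * (L * y)" by (simp add: algebra_simps)
        also have "L * y = pi * x" by (simp add: L(1) y_def)
        finally show ?thesis by simp
      qed
      hence "w ^ (2 * n) * exp (L * ln y) \<le> w ^ (2 * n) * exp (- L - ln 2 * L + 2 * pi * x)"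
        using w by (intro mult_left_mono) auto
      moreover have "w ^ (2 * n) * exp (- L - ln 2 * L + 2 * pi * x) = Q * exp (2 * pi * x)"
        by (simp add: Q_def exp_add [symmetric] exp_diff [symmetric] mult.assoc)
      ultimately have l: "ln x ^ (2 * n) \<le> Q * exp (2 * pi * x)" by linarith
      have "norm (f x) = ln x ^ (2 * n) * exp (- (3 / 4) * ln x) * \<bar>omega_rest x\<bar>"
        using True by (simp add: f_def abs_mult)
      \<comment> \<open>The rate 3 pi of the remainder beats the growth rate 2 pi, leaving an
        integrable exp (- pi x).\<close>
      also have "\<dots> \<le> (Q * exp (2 * pi * x)) * 1 * (C * exp (- 3 * pi * x))"
        using True Q l C by (intro mult_mono) auto
      also have "\<dots> = C * Q * (exp (2 * pi * x) * exp (- 3 * pi * x))" by simp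
      also have "exp (2 * pi * x) * exp (- 3 * pi * x) = exp (- pi * x)" by (simp add: exp_add [symmetric])
      finally show ?thesis using True by (simp add: g_def)
    qed (use C Q in \<open>simp add: f_def g_def\<close>)
    hence "norm (LINT x|lborel. f x) \<le> (LINT x|lborel. g x)"
      by (intro Bochner_Integration.integral_norm_bound_integral fi integrable.intros [OF g])
    hence "\<bar>LINT x|lborel. f x\<bar> \<le> C * Q * I" using has_bochner_integral_integral_eq [OF g] by simp
    thus "\<bar>rest_integral n\<bar>
      \<le> C * I * (w ^ (2 * n) * exp (- L) * exp (- ln 2 * L))"
      unfolding set_lebesgue_integral_def f_def Q_def by (simp add: mult_ac)
  qed
qed

section \<open>Conclusion\<close>

definition xi_scale :: "nat \<Rightarrow> real \<Rightarrow> real" where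
  "xi_scale n w = 4 * pi\<^sup>2 * exp (7 * w / 4) * sqrt (2 * w / (w + 1)) * (w / (2 * exp (1 / w))) ^ (2 * n)"

lemma xi_scale_pos: "w > 0 \<Longrightarrow> xi_scale n w > 0"
  by (simp add: xi_scale_def)

text \<open>Connects the closed form with the prefactor of the saddle integral for \<beta> = 5 / 4.
  The square roots combine to exp (w / 2), which raises the exponent 7 / 4 to 9 / 4 = \<beta> + 1,
  and 2 n / w = L turns exp (1 / w) ^ (2 n) into exp L.\<close>

lemma xi_scale_eq:
  assumes w: "w > 0" and L: "L = pi * exp w" "L * w = 2 * real n"
  shows "sqrt (L * (1 + 1 / w) / (2 * pi)) * xi_scale n w = 4 * pi\<^sup>2 / 4 ^ n * exp (9 * w / 4) * w ^ (2 * n) * exp (- L)"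
proof -
  have "sqrt (L * (1 + 1 / w) / (2 * pi)) * sqrt (2 * w / (w + 1)) = sqrt (L * (1 + 1 / w) / (2 * pi) * (2 * w / (w + 1)))"
    by (rule real_sqrt_mult [symmetric])
  also have "L * (1 + 1 / w) / (2 * pi) * (2 * w / (w + 1)) = exp w"
  proof -
    have "1 + 1 / w = (w + 1) / w" using w by (simp add: field_simps)
    thus ?thesis using w by (simp add: L(1))
  qed
  also have "sqrt (exp w) = exp (w / 2)" by (simp add: powr_half_sqrt [symmetric] powr_def)
  finally have s: "sqrt (L * (1 + 1 / w) / (2 * pi)) * sqrt (2 * w / (w + 1)) = exp (w / 2)" .
  have "exp (1 / w) ^ (2 * n) = exp (real (2 * n) * (1 / w))" by (rule exp_of_nat_mult [symmetric])
  also have "real (2 * n) * (1 / w) = L" using L(2) w by (simp add: field_simps)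
  finally have "(w / (2 * exp (1 / w))) ^ (2 * n) = w ^ (2 * n) / (4 ^ n * exp L)"
    by (simp add: power_divide power_mult_distrib power_mult)
  hence "sqrt (L * (1 + 1 / w) / (2 * pi)) * xi_scale n w
      = 4 * pi\<^sup>2 * exp (7 * w / 4) * (sqrt (L * (1 + 1 / w) / (2 * pi)) * sqrt (2 * w / (w + 1))) * (w ^ (2 * n) / (4 ^ n * exp L))"
    unfolding xi_scale_def by (simp only: mult_ac)
  also have "\<dots> = 4 * pi\<^sup>2 / 4 ^ n * (exp (7 * w / 4) * exp (w / 2)) * w ^ (2 * n) * exp (- L)"
    unfolding s by (simp add: exp_minus field_simps)
  also have "exp (7 * w / 4) * exp (w / 2) = exp (9 * w / 4)" by (simp add: exp_add [symmetric])
  finally show ?thesis .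
qed

text \<open>With L w = 2 n the factor 3 / (2 L) is 3 w / (4 n), so the second sum enters one order
  later. Collecting powers of 1 / n gives \<open>mu\<close>; the constant term is 1 because
  \<open>a_coeff\<close> is 1 at index 0.\<close>

lemma mu_sum_eq:
  assumes K: "K \<ge> 1" and w: "w > 0" and L: "L * w = 2 * real n" and n: "n \<ge> 1"
  shows "(\<Sum>r<K. a_coeff (5 / 4) r w / (L * w) ^ r) - 3 / (2 * L) * (\<Sum>r<K - 1. a_coeff (1 / 4) r w / (L * w) ^ r)
     = 1 + (\<Sum>k=1..K-1. mu k w / real n ^ k)"
proof -
  obtain J where J: "K = Suc J" using K by (cases K) auto
  have a0: "a_coeff (5 / 4) 0 w = 1" by (simp add: a_coeff_def ord_bell_def)
  have Li: "3 / (2 * L) = 3 * w / (4 * real n)"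
  proof -
    have "L = 2 * real n / w" using L w by (simp add: field_simps)
    thus ?thesis by simp
  qed
  have "(\<Sum>r<K. a_coeff (5 / 4) r w / (L * w) ^ r) = 1 + (\<Sum>r<J. a_coeff (5 / 4) (Suc r) w / (L * w) ^ Suc r)"
    unfolding J by (subst sum.lessThan_Suc_shift) (simp add: a0)
  moreover have "(\<Sum>k=1..K-1. mu k w / real n ^ k) = (\<Sum>r<J. mu (Suc r) w / real n ^ Suc r)"
    unfolding J by (rule sum.reindex_bij_witness [of _ Suc "\<lambda>k. k - 1"]) auto
  moreover have "mu (Suc r) w / real n ^ Suc r = a_coeff (5 / 4) (Suc r) w / (L * w) ^ Suc r - 3 / (2 * L) * (a_coeff (1 / 4) r w / (L * w) ^ r)" for r
    unfolding Li L mu_def using n by (simp add: power_mult_distrib field_simps)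
  ultimately show ?thesis unfolding J by (simp add: sum_subtractf sum_distrib_left)
qed

text \<open>Divided by the scale, the moment is the normalised integral for 5 / 4, minus 3 / (2 L)
  times that for 1 / 4, plus the contribution T of the later theta terms. The first is expanded to K
  terms and the second to K - 1.\<close>

lemma xi_moment_expansion:
  assumes K: "K \<ge> 1"
  obtains C where "C \<ge> 0" "\<And>n w L. \<lbrakk>n \<ge> 1; w \<ge> 1; L = pi * exp w; L * w = 2 * real n\<rbrakk> \<Longrightarrow>
    \<bar>xi_moment (2 * n) / xi_scale n w - (1 + (\<Sum>k=1..K-1. mu k w / real n ^ k))\<bar> \<le> C / L ^ K"
proof -
  obtain C1 where C1: "C1 \<ge> 0" "\<And>w L. \<lbrakk>w \<ge> 1; L \<ge> 1\<rbrakk> \<Longrightarrow>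
       \<bar>sqrt (L * (1 + 1 / w) / (2 * pi)) * saddle_J (5 / 4) w L - (\<Sum>r<K. a_coeff (5 / 4) r w / (L * w) ^ r)\<bar> \<le> C1 / L ^ K"
    using saddle_J_expansion [of "5 / 4" K] by auto
  obtain C2 where C2: "C2 \<ge> 0" "\<And>w L. \<lbrakk>w \<ge> 1; L \<ge> 1\<rbrakk> \<Longrightarrow>
       \<bar>sqrt (L * (1 + 1 / w) / (2 * pi)) * saddle_J (1 / 4) w L - (\<Sum>r<K - 1. a_coeff (1 / 4) r w / (L * w) ^ r)\<bar> \<le> C2 / L ^ (K - 1)"
    using saddle_J_expansion [of "1 / 4" "K - 1"] by auto
  obtain C3 where C3: "C3 \<ge> 0" "\<And>n w L. \<lbrakk>n \<ge> 1; w > 0; L = pi * exp w; L * w = 2 * real n\<rbrakk> \<Longrightarrow>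
    \<bar>rest_integral n\<bar>
      \<le> C3 * (w ^ (2 * n) * exp (- L) * exp (- ln 2 * L))"
    using xi_rest_bound by blast
  define M :: real where "M = fact (K + 1) * (2 / ln 2) ^ (K + 1)"
  have M: "M \<ge> 0" by (simp add: M_def)
  show ?thesis
  proof (rule that [of "C1 + 2 * C2 + C3 * M"])
    show "C1 + 2 * C2 + C3 * M \<ge> 0" using C1(1) C2(1) C3(1) M by simp
    fix n :: nat and w L :: real
    assume n: "n \<ge> 1" and w: "w \<ge> 1" and L: "L = pi * exp w" "L * w = 2 * real n"
    have w0: "w > 0" using w by simp
    have L1: "L \<ge> 1"
    proof -
      have "1 * 1 \<le> pi * exp w" using pi_ge_two w by (intro mult_mono) auto
      thus ?thesis by (simp add: L(1))
    qed
    define q where "q = sqrt (L * (1 + 1 / w) / (2 * pi))"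
    have q: "q > 0" "q \<le> L"
      using L1 w saddle_normalisation_le [OF w L1] by (auto simp: q_def add_pos_pos)
    define Q where "Q = w ^ (2 * n) * exp (- L)"
    have Q: "Q > 0" using w0 by (simp add: Q_def)
    define R where "R = rest_integral n"
    define T where "T = q * R / (2 * pi\<^sup>2 * exp (9 * w / 4) * Q)"
    have sc: "q * xi_scale n w = 4 * pi\<^sup>2 / 4 ^ n * exp (9 * w / 4) * Q"
      using xi_scale_eq [OF w0 L] by (simp add: q_def Q_def)
    \<comment> \<open>The two saddle integrals differ in their prefactors by exp w = L / pi, the
      source of the relative factor 1 / L.\<close>
    have e: "pi * exp (5 * w / 4) = pi\<^sup>2 * exp (9 * w / 4) / L"
    proof -
      have "exp (9 * w / 4) = exp (5 * w / 4) * exp w" by (simp add: exp_add [symmetric])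
      thus ?thesis by (simp add: L(1) power2_eq_square)
    qed
    have "xi_moment (2 * n) = 2 / 4 ^ n * (2 * pi\<^sup>2 * saddle_integral n (5 / 4) - 3 * pi * saddle_integral n (1 / 4) + R)"
      unfolding R_def by (rule xi_moment_decomp(2) [OF n])
    also have "saddle_integral n (5 / 4) = exp (9 * w / 4) * Q * saddle_J (5 / 4) w L"
      using saddle_integral_eq [OF w0 L, of "5 / 4"] by (simp add: Q_def)
    also have "3 * pi * saddle_integral n (1 / 4) = 3 * (pi * exp (5 * w / 4)) * Q * saddle_J (1 / 4) w L"
      using saddle_integral_eq [OF w0 L, of "1 / 4"] by (simp add: Q_def)
    also have "R = 2 * pi\<^sup>2 * exp (9 * w / 4) * Q * (T / q)"
      using q(1) Q by (simp add: T_def)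
    also have "2 / 4 ^ n * (2 * pi\<^sup>2 * (exp (9 * w / 4) * Q * saddle_J (5 / 4) w L) - 3 * (pi * exp (5 * w / 4)) * Q * saddle_J (1 / 4) w L + 2 * pi\<^sup>2 * exp (9 * w / 4) * Q * (T / q))
       = (4 * pi\<^sup>2 / 4 ^ n * exp (9 * w / 4) * Q) * (saddle_J (5 / 4) w L - 3 / (2 * L) * saddle_J (1 / 4) w L + T / q)"
      unfolding e by (simp add: field_simps)
    also have "\<dots> = xi_scale n w * (q * saddle_J (5 / 4) w L - 3 / (2 * L) * (q * saddle_J (1 / 4) w L) + T)"
      unfolding sc [symmetric] using q(1) by (simp add: algebra_simps)
    finally have main: "xi_moment (2 * n) / xi_scale n w = q * saddle_J (5 / 4) w L - 3 / (2 * L) * (q * saddle_J (1 / 4) w L) + T"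
      using xi_scale_pos [OF w0, of n] by simp
    have b1: "\<bar>q * saddle_J (5 / 4) w L - (\<Sum>r<K. a_coeff (5 / 4) r w / (L * w) ^ r)\<bar> \<le> C1 / L ^ K"
      using C1(2) [OF w L1] by (simp add: q_def)
    have "\<bar>3 / (2 * L) * (q * saddle_J (1 / 4) w L) - 3 / (2 * L) * (\<Sum>r<K - 1. a_coeff (1 / 4) r w / (L * w) ^ r)\<bar>
        = 3 / (2 * L) * \<bar>q * saddle_J (1 / 4) w L - (\<Sum>r<K - 1. a_coeff (1 / 4) r w / (L * w) ^ r)\<bar>"
      using L1 unfolding right_diff_distrib [symmetric] abs_mult by simp
    also have "\<dots> \<le> 3 / (2 * L) * (C2 / L ^ (K - 1))"
      using C2(2) [OF w L1] L1 by (intro mult_left_mono) (auto simp: q_def)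
    \<comment> \<open>The prefactor 1 / L supplies the order missing from the shorter
      expansion.\<close>
    also have "\<dots> = 3 / 2 * C2 / L ^ K" using K by (cases K) auto
    also have "\<dots> \<le> 2 * C2 / L ^ K" using C2(1) L1 by (intro divide_right_mono) auto
    finally have b2: "\<bar>3 / (2 * L) * (q * saddle_J (1 / 4) w L) - 3 / (2 * L) * (\<Sum>r<K - 1. a_coeff (1 / 4) r w / (L * w) ^ r)\<bar> \<le> 2 * C2 / L ^ K" .
    have b3: "\<bar>T\<bar> \<le> C3 * M / L ^ K"
    proof -
      have "\<bar>R\<bar> \<le> C3 * (Q * exp (- ln 2 * L))"
        using C3(2) [OF n w0 L] by (simp add: R_def Q_def)
      \<comment> \<open>The denominator of T may be reduced to Q, since exp (- ln 2 * L) outweighs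
        every power of L.\<close>
      moreover have "1 * 1 * Q \<le> 2 * pi\<^sup>2 * exp (9 * w / 4) * Q"
      proof (intro mult_right_mono mult_mono)
        have "1 \<le> pi\<^sup>2" using pi_ge_two by (intro one_le_power) auto
        thus "1 \<le> 2 * pi\<^sup>2" by simp
      qed (use Q w in auto)
      moreover have "\<bar>T\<bar> = q * \<bar>R\<bar> / (2 * pi\<^sup>2 * exp (9 * w / 4) * Q)"
        using q(1) Q by (simp add: T_def abs_mult)
      ultimately have "\<bar>T\<bar> \<le> L * (C3 * (Q * exp (- ln 2 * L))) / Q"
        using q Q C3(1) L1 by (simp only:) (intro frac_le mult_mono; simp)
      also have "\<dots> = C3 * (L ^ (K + 1) * exp (- ln 2 * L)) / L ^ K"
        using Q L1 by simp
      also have "\<dots> \<le> C3 * (fact (K + 1) * (2 / ln 2) ^ (K + 1) * 1) / L ^ K"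
      proof (intro divide_right_mono mult_left_mono C3(1))
        have "L ^ (K + 1) * exp (- ln 2 * L) \<le> fact (K + 1) * (2 / ln 2) ^ (K + 1) * exp (- (ln 2 / 2) * L)"
          using L1 by (intro power_mult_exp_le) auto
        also have "\<dots> \<le> fact (K + 1) * (2 / ln 2) ^ (K + 1) * 1"
          using L1 by (intro mult_left_mono) auto
        finally show "L ^ (K + 1) * exp (- ln 2 * L) \<le> fact (K + 1) * (2 / ln 2) ^ (K + 1) * 1" .
      qed (use L1 in auto)
      finally show ?thesis by (simp add: M_def)
    qed
    show "\<bar>xi_moment (2 * n) / xi_scale n w - (1 + (\<Sum>k=1..K-1. mu k w / real n ^ k))\<bar> \<le> (C1 + 2 * C2 + C3 * M) / L ^ K"
      unfolding main mu_sum_eq [OF K w0 L(2) n, symmetric] add_divide_distrib using b1 b2 b3 by linarith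
  qed
qed

theorem theorem1p5:
  shows "(\<forall>K\<ge>1. \<exists>E :: nat \<Rightarrow> real.
            E \<in> O(\<lambda>n. ln (real n) ^ K / real n ^ K) \<and>
            (\<forall>n\<ge>1. let w = lambert_W (2 * real n / pi) in
               (deriv ^^ (2 * n)) riemann_xi (1 / 2) =
               complex_of_real
                 (4 * pi\<^sup>2 * exp (7 * w / 4) * sqrt (2 * w / (w + 1)) *
                  (w / (2 * exp (1 / w))) ^ (2 * n) *
                  (1 + (\<Sum>k=1..K-1. mu k w / real n ^ k) + E n)))) \<and>
         (\<forall>k. (\<exists>P Q :: real poly. \<forall>w>0. poly Q w \<noteq> 0 \<and> mu k w = poly P w / poly Q w) \<and>
              (\<lambda>n. mu k (lambert_W (2 * real n / pi))) \<in> O(\<lambda>n. ln (real n) ^ k))"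
proof (intro conjI allI impI)
  fix K :: nat assume K: "K \<ge> 1"
  define W where "W n = lambert_W (2 * real n / pi)" for n
  \<comment> \<open>E is the exact relative error, so the formula holds for every n >= 1, the scale
    being nonzero because W n > 0; only the order of E is asymptotic.\<close>
  define E where "E n = xi_moment (2 * n) / xi_scale n (W n) - (1 + (\<Sum>k=1..K-1. mu k (W n) / real n ^ k))" for n
  obtain C where C: "C \<ge> 0" "\<And>n w L. \<lbrakk>n \<ge> 1; w \<ge> 1; L = pi * exp w; L * w = 2 * real n\<rbrakk> \<Longrightarrow>
    \<bar>xi_moment (2 * n) / xi_scale n w - (1 + (\<Sum>k=1..K-1. mu k w / real n ^ k))\<bar> \<le> C / L ^ K"
    using xi_moment_expansion [OF K] by blast
  have "\<forall>\<^sub>F n in sequentially. norm (E n) \<le> C * norm (ln (real n) ^ K / real n ^ K)"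
    using eventually_saddle_point eventually_ge_at_top [of 1]
  proof eventually_elim
    case (elim n)
    define w where "w = W n"
    have w: "w \<ge> 1" "w \<le> ln (real n)" using elim by (simp_all add: w_def W_def)
    have ww: "w * exp w = 2 * real n / pi" unfolding w_def W_def by (rule lambert_W_eq) simp
    define L where "L = pi * exp w"
    have Lw: "L * w = 2 * real n" using ww by (simp add: L_def field_simps)
    have "\<bar>E n\<bar> \<le> C / L ^ K"
      unfolding E_def w_def [symmetric] using elim w Lw by (intro C) (auto simp: L_def)
    \<comment> \<open>The equation of the saddle point converts the natural error L powr (- K) into
      a bound in n, with w at most ln n.\<close>
    also have "\<dots> = C * (w / (2 * real n)) ^ K"
    proof -
      have "1 / L = w / (2 * real n)" unfolding Lw [symmetric] using w by simp
      thus ?thesis by (metis divide_inverse inverse_eq_divide power_inverse)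
    qed
    also have "\<dots> \<le> C * (ln (real n) / real n) ^ K"
    proof (intro mult_left_mono power_mono C)
      have "w / (2 * real n) \<le> ln (real n) / (2 * real n)" using w by (intro divide_right_mono) auto
      also have "\<dots> \<le> ln (real n) / real n" using w elim by (intro divide_left_mono) auto
      finally show "w / (2 * real n) \<le> ln (real n) / real n" .
    qed (use w in auto)
    also have "\<dots> = C * norm (ln (real n) ^ K / real n ^ K)"
      using w by (simp add: power_divide)
    finally show ?case by simp
  qed
  hence "E \<in> O(\<lambda>n. ln (real n) ^ K / real n ^ K)" by (rule bigoI)
  moreover have "(deriv ^^ (2 * n)) riemann_xi (1 / 2) =
      complex_of_real (xi_scale n (W n) * (1 + (\<Sum>k=1..K-1. mu k (W n) / real n ^ k) + E n))" if n: "n \<ge> 1" for n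
  proof -
    have "W n > 0" unfolding W_def by (rule lambert_W_pos) (use n in auto)
    hence "xi_scale n (W n) > 0" by (rule xi_scale_pos)
    hence "xi_moment (2 * n) = xi_scale n (W n) * (1 + (\<Sum>k=1..K-1. mu k (W n) / real n ^ k) + E n)"
      by (simp add: E_def)
    thus ?thesis unfolding higher_deriv_riemann_xi by simp
  qed
  ultimately show "\<exists>E :: nat \<Rightarrow> real.
            E \<in> O(\<lambda>n. ln (real n) ^ K / real n ^ K) \<and>
            (\<forall>n\<ge>1. let w = lambert_W (2 * real n / pi) in
               (deriv ^^ (2 * n)) riemann_xi (1 / 2) =
               complex_of_real
                 (4 * pi\<^sup>2 * exp (7 * w / 4) * sqrt (2 * w / (w + 1)) *
                  (w / (2 * exp (1 / w))) ^ (2 * n) *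
                  (1 + (\<Sum>k=1..K-1. mu k w / real n ^ k) + E n)))"
    unfolding Let_def W_def xi_scale_def by blast
next
  fix k :: nat
  show "\<exists>P Q :: real poly. \<forall>w>0. poly Q w \<noteq> 0 \<and> mu k w = poly P w / poly Q w"
    using is_rational_mu unfolding is_rational_def .
  obtain D where D: "D \<ge> 0" "\<And>w. w \<ge> 1 \<Longrightarrow> \<bar>mu k w\<bar> \<le> D * w ^ k"
    using mu_bound by blast
  have "\<forall>\<^sub>F n in sequentially. norm (mu k (lambert_W (2 * real n / pi))) \<le> D * norm (ln (real n) ^ k)"
    using eventually_saddle_point
  proof eventually_elim
    case (elim n)
    have "\<bar>mu k (lambert_W (2 * real n / pi))\<bar> \<le> D * lambert_W (2 * real n / pi) ^ k"
      using elim by (intro D) auto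
    also have "\<dots> \<le> D * ln (real n) ^ k" using elim D(1) by (intro mult_left_mono power_mono) auto
    finally show ?case using elim by simp
  qed
  thus "(\<lambda>n. mu k (lambert_W (2 * real n / pi))) \<in> O(\<lambda>n. ln (real n) ^ k)"
    by (rule bigoI)
qed

end
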